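(* Let $\mathbb{k}$ be a field. (1) If $M\in\mathrm{rep}(\mathbb{Z}^2)$ is finitely generated, then $\mathcal{N}^2(M)\le|\beta_0^M|$. (2) If $f:K\to\mathbb{Z}^2$ is a finite bifiltered simplicial complex, then $\mathcal{N}^2(H_i(f))\le|K_i|$ for every $i\in\mathbb{N}$.
   Context: $\mathrm{rep}(\mathbb{Z}^2)$ is the category of functors from $\mathbb{Z}^2$ (product order) to finite dimensional $\mathbb{k}$-vector spaces, identified with pointwise finite dimensional bigraded $\mathbb{k}[\mathbf{x},\mathbf{y}]$-modules ($\mathbf{x}:M_i\to M_{i+(1,0)}$ and $\mathbf{y}:M_i\to M_{i+(0,1)}$ being structure maps); $M[a]_i=M_{i+a}$. A spread curve is a non-empty, poset-connected, poset-convex subset $I\subseteq\mathbb{Z}^2$ such that $p\in I$ implies $p+(1,1)\notin I$; $\mathbb{k}_I$ is $\mathbb{k}$ on $I$, $0$ elsewhere, with identity structure maps within $I$. The cokernel of $\mathbf{x}\mathbf{y}:M[-1,-1]\to M$ decomposes essentially uniquely as a direct sum of spread curve representations $\mathbb{k}_I$; these spread curves, with multiplicity, are the birth-curves of $M$. For finitely generated $M$, $\mathcal{N}^2(M)$ is defined as the number of birth-curves of $M$ (when $M$ is finite dimensional this equals $\dim M-\dim\mathbf{x}M-\dim\mathbf{y}M+\dim\mathbf{x}\mathbf{y}M$). $|\beta_0^M|$ is the number of generators in a minimal generating set of homogeneous elements, i.e. $|\beta_0^M|=\sum_{p\in\mathbb{Z}^2}\dim\big(M/(\mathbf{x}M+\mathbf{y}M)\big)_p$.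 A finite bifiltered simplicial complex is a finite simplicial complex $K$ with a function $f$ from its simplices to $\mathbb{Z}^2$ that is monotonic ($\sigma\subseteq\tau$ implies $f(\sigma)\le f(\tau)$). $H_i(f)\in\mathrm{rep}(\mathbb{Z}^2)$ is given by $H_i(f)_p=H_i(\{\sigma\in K:f(\sigma)\le p\};\mathbb{k})$, with structure maps induced by inclusions. $K_i$ is the set of $i$-dimensional simplices of $K$. *)

theory Defs
  imports
    "Jordan_Normal_Form.Missing_VectorSpace"
    "HOL-Algebra.AbelCoset"
    "HOL-Library.Product_Order"
    "HOL-Library.Product_Plus"
begin

section \<open>Quotient spaces\<close>

text \<open>
  Only the additive group and the scalar multiplication of a module record matter;
  its fields \<open>mult\<close> and \<open>one\<close> carry no information throughout.
\<close>

definition quot_space :: "('a, 'v) module \<Rightarrow> 'v set \<Rightarrow> ('a, 'v set) module" where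
  "quot_space V W = \<lparr>carrier = a_rcosets\<^bsub>V\<^esub> W, mult = (\<lambda>X Y. W), one = W, zero = W,
     add = set_add V, smult = (\<lambda>a X. ((\<lambda>x. a \<odot>\<^bsub>V\<^esub> x) ` X) <+>\<^bsub>V\<^esub> W)\<rparr>"

text \<open>
  The map from a quotient to \<open>V / W\<close> induced by a linear map \<open>g\<close> into \<open>V\<close>; it sends the coset
  of \<open>x\<close> to the coset of \<open>g x\<close> whenever \<open>g\<close> maps the subspace being divided out into \<open>W\<close>.
\<close>

definition quot_map :: "('a, 'w) module \<Rightarrow> 'w set \<Rightarrow> ('v \<Rightarrow> 'w) \<Rightarrow> 'v set \<Rightarrow> 'w set" where
  "quot_map V W g X = (g ` X) <+>\<^bsub>V\<^esub> W"


section \<open>Representations of \<open>\<int>\<^sup>2\<close>\<close>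

text \<open>The order on \<^typ>\<open>int \<times> int\<close> is the product order.\<close>

record ('a, 'v) rep =
  Space :: "int \<times> int \<Rightarrow> ('a, 'v) module"
  smap :: "int \<times> int \<Rightarrow> int \<times> int \<Rightarrow> 'v \<Rightarrow> 'v"

text \<open>Values of \<^const>\<open>smap\<close> at pairs \<open>p, q\<close> with \<open>\<not> p \<le> q\<close> are irrelevant.\<close>

definition rep2 :: "('a, 'b) ring_scheme \<Rightarrow> ('a, 'v) rep \<Rightarrow> bool" where
  "rep2 k M \<longleftrightarrow>
     (\<forall>p. vectorspace k (Space M p) \<and> vectorspace.fin_dim k (Space M p)) \<and>
     (\<forall>p q. p \<le> q \<longrightarrow> smap M p q \<in> LinearCombinations.module_hom k (Space M p) (Space M q)) \<and>
     (\<forall>p. \<forall>v \<in> carrier (Space M p). smap M p p v = v) \<and>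
     (\<forall>p q r. p \<le> q \<longrightarrow> q \<le> r \<longrightarrow>
        (\<forall>v \<in> carrier (Space M p). smap M q r (smap M p q v) = smap M p r v))"

definition rep_iso :: "('a, 'b) ring_scheme \<Rightarrow> ('a, 'v) rep \<Rightarrow> ('a, 'w) rep \<Rightarrow> bool" where
  "rep_iso k M N \<longleftrightarrow> (\<exists>\<phi>.
     (\<forall>p. \<phi> p \<in> LinearCombinations.module_hom k (Space M p) (Space N p) \<and>
          bij_betw (\<phi> p) (carrier (Space M p)) (carrier (Space N p))) \<and>
     (\<forall>p q. p \<le> q \<longrightarrow>
        (\<forall>v \<in> carrier (Space M p). \<phi> q (smap M p q v) = smap N p q (\<phi> p v))))"

definition shift :: "int \<times> int \<Rightarrow> ('a, 'v) rep \<Rightarrow> ('a, 'v) rep" where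
  "shift a M = \<lparr>Space = (\<lambda>p. Space M (p + a)), smap = (\<lambda>p q. smap M (p + a) (q + a))\<rparr>"

definition coker ::
  "('a, 'w) rep \<Rightarrow> ('a, 'v) rep \<Rightarrow> (int \<times> int \<Rightarrow> 'w \<Rightarrow> 'v) \<Rightarrow> ('a, 'v set) rep" where
  "coker N M \<phi> = (let W = (\<lambda>p. \<phi> p ` carrier (Space N p)) in
     \<lparr>Space = (\<lambda>p. quot_space (Space M p) (W p)),
      smap = (\<lambda>p q. quot_map (Space M q) (W q) (smap M p q))\<rparr>)"

text \<open>Elements of a direct sum are the extensional families with finite support.\<close>

definition direct_sum_rep :: "'j set \<Rightarrow> ('j \<Rightarrow> ('a, 'v) rep) \<Rightarrow> ('a, 'j \<Rightarrow> 'v) rep" where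
  "direct_sum_rep J M =
     \<lparr>Space = (\<lambda>p.
        \<lparr>carrier = {u \<in> \<Pi>\<^sub>E j\<in>J. carrier (Space (M j) p).
                     finite {j \<in> J. u j \<noteq> \<zero>\<^bsub>Space (M j) p\<^esub>}},
         mult = (\<lambda>u v. \<lambda>j\<in>J. \<zero>\<^bsub>Space (M j) p\<^esub>),
         one = (\<lambda>j\<in>J. \<zero>\<^bsub>Space (M j) p\<^esub>),
         zero = (\<lambda>j\<in>J. \<zero>\<^bsub>Space (M j) p\<^esub>),
         add = (\<lambda>u v. \<lambda>j\<in>J. u j \<oplus>\<^bsub>Space (M j) p\<^esub> v j),
         smult = (\<lambda>a u. \<lambda>j\<in>J. a \<odot>\<^bsub>Space (M j) p\<^esub> u j)\<rparr>),
      smap = (\<lambda>p q u. \<lambda>j\<in>J. smap (M j) p q (u j))\<rparr>"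

definition x_act :: "('a, 'v) rep \<Rightarrow> int \<times> int \<Rightarrow> 'v \<Rightarrow> 'v" where
  "x_act M p = smap M p (p + (1, 0))"

definition y_act :: "('a, 'v) rep \<Rightarrow> int \<times> int \<Rightarrow> 'v \<Rightarrow> 'v" where
  "y_act M p = smap M p (p + (0, 1))"

text \<open>
  \<open>M\<close> is generated, as a bigraded module over \<open>k[x, y]\<close>, by finitely many homogeneous elements;
  a pair \<open>(p, v)\<close> stands for the element \<open>v\<close> of degree \<open>p\<close>.
\<close>

definition fin_gen :: "('a, 'b) ring_scheme \<Rightarrow> ('a, 'v) rep \<Rightarrow> bool" where
  "fin_gen k M \<longleftrightarrow> (\<exists>G. finite G \<and> (\<forall>(p, v) \<in> G. v \<in> carrier (Space M p)) \<and>
     (\<forall>q. carrier (Space M q) =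
        LinearCombinations.module.span k (Space M q) {smap M p q v | p v. (p, v) \<in> G \<and> p \<le> q}))"

text \<open>The degree \<open>p\<close> part of \<open>xM + yM\<close>.\<close>

definition xy_rad :: "('a, 'v) rep \<Rightarrow> int \<times> int \<Rightarrow> 'v set" where
  "xy_rad M p =
     (x_act M (p - (1, 0)) ` carrier (Space M (p - (1, 0))))
       <+>\<^bsub>Space M p\<^esub> (y_act M (p - (0, 1)) ` carrier (Space M (p - (0, 1))))"

text \<open>The sum runs over the support, which is finite for finitely generated \<open>M\<close>.\<close>

definition beta0 :: "('a, 'b) ring_scheme \<Rightarrow> ('a, 'v) rep \<Rightarrow> nat" where
  "beta0 k M = (let d = (\<lambda>p. vectorspace.dim k (quot_space (Space M p) (xy_rad M p))) in
     (\<Sum>p | d p \<noteq> 0. d p))"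


section \<open>Birth-curves\<close>

definition spread_curve :: "(int \<times> int) set \<Rightarrow> bool" where
  "spread_curve I \<longleftrightarrow> I \<noteq> {} \<and>
     (\<forall>p\<in>I. \<forall>q\<in>I. (p, q) \<in> {(a, b). a \<in> I \<and> b \<in> I \<and> (a \<le> b \<or> b \<le> a)}\<^sup>*) \<and>
     (\<forall>p\<in>I. \<forall>r\<in>I. \<forall>q. p \<le> q \<longrightarrow> q \<le> r \<longrightarrow> q \<in> I) \<and>
     (\<forall>p\<in>I. p + (1, 1) \<notin> I)"

definition spread_rep :: "('a, 'b) ring_scheme \<Rightarrow> (int \<times> int) set \<Rightarrow> ('a, 'a) rep" where
  "spread_rep k I =
     \<lparr>Space = (\<lambda>p. \<lparr>carrier = (if p \<in> I then carrier k else {\<zero>\<^bsub>k\<^esub>}),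
         mult = (\<lambda>a b. \<zero>\<^bsub>k\<^esub>), one = \<zero>\<^bsub>k\<^esub>, zero = \<zero>\<^bsub>k\<^esub>, add = add k, smult = mult k\<rparr>),
      smap = (\<lambda>p q a. if p \<in> I \<and> q \<in> I then a else \<zero>\<^bsub>k\<^esub>)\<rparr>"

text \<open>The component at \<open>p\<close> of \<open>xy : M[-1,-1] \<rightarrow> M\<close>.\<close>

definition xy_mor :: "('a, 'v) rep \<Rightarrow> int \<times> int \<Rightarrow> 'v \<Rightarrow> 'v" where
  "xy_mor M p = x_act M (p - (1, 0)) \<circ> y_act M (p - (1, 1))"

definition birth_curves ::
  "('a, 'b) ring_scheme \<Rightarrow> ('a, 'v) rep \<Rightarrow> 'j set \<Rightarrow> ('j \<Rightarrow> (int \<times> int) set) \<Rightarrow> bool" where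
  "birth_curves k M J I \<longleftrightarrow> (\<forall>j\<in>J. spread_curve (I j)) \<and>
     rep_iso k (coker (shift (-1, -1) M) M (xy_mor M)) (direct_sum_rep J (\<lambda>j. spread_rep k (I j)))"

text \<open>
  Meant for finitely generated \<open>M\<close>: then a finite family of birth-curves exists, and it is unique
  up to reindexing, so the choice is between equal numbers.
\<close>

definition N2 :: "('a, 'b) ring_scheme \<Rightarrow> ('a, 'v) rep \<Rightarrow> nat" where
  "N2 k M = (SOME n. \<exists>I. birth_curves k M {..<n} I)"


section \<open>Bifiltered simplicial complexes and their homology\<close>

definition bifiltered_complex :: "'v set set \<Rightarrow> ('v set \<Rightarrow> int \<times> int) \<Rightarrow> bool" where
  "bifiltered_complex K f \<longleftrightarrow> finite K \<and> (\<forall>\<sigma>\<in>K. finite \<sigma> \<and> \<sigma> \<noteq> {}) \<and>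
     (\<forall>\<sigma>\<in>K. \<forall>\<tau>. \<tau> \<subseteq> \<sigma> \<longrightarrow> \<tau> \<noteq> {} \<longrightarrow> \<tau> \<in> K) \<and>
     (\<forall>\<sigma>\<in>K. \<forall>\<tau>\<in>K. \<sigma> \<subseteq> \<tau> \<longrightarrow> f \<sigma> \<le> f \<tau>)"

definition simplices :: "nat \<Rightarrow> 'v set set \<Rightarrow> 'v set set" where
  "simplices n S = {\<sigma> \<in> S. card \<sigma> = Suc n}"

text \<open>
  The \<open>n\<close>-chains of \<open>S\<close> are extended by zero to all sets of vertices, so that for
  \<open>S \<subseteq> T\<close> the chains of \<open>S\<close> are literally chains of \<open>T\<close>.
\<close>

definition chains :: "('a, 'b) ring_scheme \<Rightarrow> 'v set set \<Rightarrow> nat \<Rightarrow> ('a, 'v set \<Rightarrow> 'a) module" where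
  "chains k S n =
     \<lparr>carrier = {c. (\<forall>\<sigma> \<in> simplices n S. c \<sigma> \<in> carrier k) \<and> (\<forall>\<sigma>. \<sigma> \<notin> simplices n S \<longrightarrow> c \<sigma> = \<zero>\<^bsub>k\<^esub>)},
      mult = (\<lambda>c d \<sigma>. \<zero>\<^bsub>k\<^esub>), one = (\<lambda>\<sigma>. \<zero>\<^bsub>k\<^esub>), zero = (\<lambda>\<sigma>. \<zero>\<^bsub>k\<^esub>),
      add = (\<lambda>c d \<sigma>. c \<sigma> \<oplus>\<^bsub>k\<^esub> d \<sigma>), smult = (\<lambda>a c \<sigma>. a \<otimes>\<^bsub>k\<^esub> c \<sigma>)\<rparr>"

text \<open>
  Simplices are oriented by the order of their vertices: the coefficient of \<open>\<tau>\<close> in the boundary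
  of \<open>insert v \<tau>\<close> is \<open>(-1)\<^sup>j\<close>, where \<open>j\<close> is the number of vertices preceding \<open>v\<close>. The empty
  face is discarded (unreduced homology).
\<close>

definition boundary ::
  "('a, 'b) ring_scheme \<Rightarrow> 'v::linorder set set \<Rightarrow> ('v set \<Rightarrow> 'a) \<Rightarrow> 'v set \<Rightarrow> 'a" where
  "boundary k S c \<tau> = (if \<tau> = {} then \<zero>\<^bsub>k\<^esub> else
     (\<Oplus>\<^bsub>k\<^esub> v \<in> {v. v \<notin> \<tau> \<and> insert v \<tau> \<in> S}.
        ((\<ominus>\<^bsub>k\<^esub> \<one>\<^bsub>k\<^esub>) [^]\<^bsub>k\<^esub> card {w \<in> \<tau>. w < v}) \<otimes>\<^bsub>k\<^esub> c (insert v \<tau>)))"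

definition cycles ::
  "('a, 'b) ring_scheme \<Rightarrow> 'v::linorder set set \<Rightarrow> nat \<Rightarrow> ('v set \<Rightarrow> 'a) set" where
  "cycles k S n = {c \<in> carrier (chains k S n). boundary k S c = (\<lambda>\<tau>. \<zero>\<^bsub>k\<^esub>)}"

definition boundaries ::
  "('a, 'b) ring_scheme \<Rightarrow> 'v::linorder set set \<Rightarrow> nat \<Rightarrow> ('v set \<Rightarrow> 'a) set" where
  "boundaries k S n = boundary k S ` carrier (chains k S (Suc n))"

definition homology ::
  "('a, 'b) ring_scheme \<Rightarrow> 'v::linorder set set \<Rightarrow> nat \<Rightarrow> ('a, ('v set \<Rightarrow> 'a) set) module" where
  "homology k S n = quot_space (chains k S n\<lparr>carrier := cycles k S n\<rparr>) (boundaries k S n)"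

definition homology_rep ::
  "('a, 'b) ring_scheme \<Rightarrow> 'v::linorder set set \<Rightarrow> ('v set \<Rightarrow> int \<times> int) \<Rightarrow> nat
     \<Rightarrow> ('a, ('v set \<Rightarrow> 'a) set) rep" where
  "homology_rep k K f n = (let S = (\<lambda>p. {\<sigma> \<in> K. f \<sigma> \<le> p}) in
     \<lparr>Space = (\<lambda>p. homology k (S p) n),
      smap = (\<lambda>p q. quot_map (chains k (S q) n\<lparr>carrier := cycles k (S q) n\<rparr>)
                       (boundaries k (S q) n) (\<lambda>c. c))\<rparr>)"

end

theory Submission
  imports Defs
begin

text \<open>
  Let \<open>C\<close> be the cokernel of \<open>xy\<close>. As \<open>xy = 0\<close> on \<open>C\<close>, assigning to \<open>p\<close> the level
  \<open>fst p - snd p\<close> turns \<open>C\<close> into a string module over a line: \<open>x\<close> raises the level by one, \<open>y\<close>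
  lowers it by one, and the image of each lies in the kernel of the other. Sweeping through the
  levels one chooses bases that \<open>x\<close> and \<open>y\<close> map injectively into each other up to elements sent to
  \<open>0\<close>. For the sweep to continue, the claim is strengthened: the basis at the last level
  can be adapted to any prescribed flags of subspaces \<open>R\<close>. At the previous level this only asks for
  a basis adapted to the preimages of the \<open>R\<close> under \<open>x\<close> and their images under \<open>y\<close>, which again form
  flags because \<open>xy = 0\<close>. Outside a bounded range of levels only one of \<open>x\<close>, \<open>y\<close> is nonzero and
  it is surjective, so a basis adapted to the kernels of its powers can be pushed along rays. The
  connected components of the resulting graph on basis elements are the birth-curves.

  Each birth-curve has a minimal point, and the basis elements there are independent modulo
  \<open>xM + yM\<close>; this gives (1). For (2), the cycles of degree \<open>(a, b)\<close> are \<open>X a \<inter> Y b\<close> for two flags in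
  the space of all cycles. A basis of that space adapted to both flags is a homogeneous generating
  set of the cycles, and hence of the homology, with at most as many elements as there are simplices.
\<close>

section \<open>Bases adapted to flags\<close>

text \<open>Any two flags of a finite dimensional space have a common adapted basis, but three flags
  in general do not. This shapes the sweep: a new basis has to fit the bases already chosen and stay
  open for the levels to come, and each of the two maps at a point brings its own chain of
  subspaces. Stacking the two chains means that only one flag is ever passed back. The second flag
  is spent once, at the level \<open>- D\<close>, to prepare the extension along the vertical rays.

  \<open>N2\<close> is a choice among the sizes of finite families of birth-curves. Hence a finite
  family has to be produced, and the bound by \<open>beta0\<close> is proved for every family; the
  same count shows that the constructed family is finite.

  Behind (2) is the fact that a kernel of a map between finitely generated free bigraded modules
  over \<open>k[x, y]\<close> is free. The chains form free modules, and the basis adapted to two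
  flags is an explicit free basis of the cycles, with generators placed at their own
  degrees.\<close>

context vectorspace begin

lemma subspace_carrier: "subspace K (carrier V) V"
  unfolding subspace_def submodule_def using vectorspace_axioms module_axioms by auto

lemma subspace_zero: "subspace K {\<zero>\<^bsub>V\<^esub>} V"
  unfolding subspace_def submodule_def using vectorspace_axioms module_axioms by auto

lemma subspaceD:
  assumes "subspace K W V"
  shows "W \<subseteq> carrier V" "\<zero>\<^bsub>V\<^esub> \<in> W"
    "\<And>u v. u \<in> W \<Longrightarrow> v \<in> W \<Longrightarrow> u \<oplus>\<^bsub>V\<^esub> v \<in> W"
    "\<And>c v. c \<in> carrier K \<Longrightarrow> v \<in> W \<Longrightarrow> c \<odot>\<^bsub>V\<^esub> v \<in> W"
    "\<And>v. v \<in> W \<Longrightarrow> \<ominus>\<^bsub>V\<^esub> v \<in> W"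
    "\<And>u v. u \<in> W \<Longrightarrow> v \<in> W \<Longrightarrow> u \<ominus>\<^bsub>V\<^esub> v \<in> W"
proof -
  interpret W: submodule K W V using assms by (simp add: subspace_def)
  show 1: "W \<subseteq> carrier V" "\<zero>\<^bsub>V\<^esub> \<in> W"
    "\<And>u v. u \<in> W \<Longrightarrow> v \<in> W \<Longrightarrow> u \<oplus>\<^bsub>V\<^esub> v \<in> W"
    "\<And>c v. c \<in> carrier K \<Longrightarrow> v \<in> W \<Longrightarrow> c \<odot>\<^bsub>V\<^esub> v \<in> W"
    using W.subset by auto
  show 2: "\<And>v. v \<in> W \<Longrightarrow> \<ominus>\<^bsub>V\<^esub> v \<in> W"
  proof -
    fix v assume v: "v \<in> W"
    then have "(\<ominus>\<^bsub>K\<^esub> \<one>\<^bsub>K\<^esub>) \<odot>\<^bsub>V\<^esub> v \<in> W" using 1(4) by simp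
    moreover have "(\<ominus>\<^bsub>K\<^esub> \<one>\<^bsub>K\<^esub>) \<odot>\<^bsub>V\<^esub> v = \<ominus>\<^bsub>V\<^esub> v" using v 1(1) smult_minus_1 by blast
    ultimately show "\<ominus>\<^bsub>V\<^esub> v \<in> W" by simp
  qed
  show "\<And>u v. u \<in> W \<Longrightarrow> v \<in> W \<Longrightarrow> u \<ominus>\<^bsub>V\<^esub> v \<in> W"
    using 1 2 by (simp add: a_minus_def)
qed

lemma subspaceI:
  assumes "W \<subseteq> carrier V" "\<zero>\<^bsub>V\<^esub> \<in> W"
    "\<And>u v. u \<in> W \<Longrightarrow> v \<in> W \<Longrightarrow> u \<oplus>\<^bsub>V\<^esub> v \<in> W"
    "\<And>c v. c \<in> carrier K \<Longrightarrow> v \<in> W \<Longrightarrow> c \<odot>\<^bsub>V\<^esub> v \<in> W"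
  shows "subspace K W V"
  unfolding subspace_def submodule_def using vectorspace_axioms module_axioms assms by auto

lemma subspace_inter:
  assumes "subspace K W V" "subspace K W' V"
  shows "subspace K (W \<inter> W') V"
  using subspaceD[OF assms(1)] subspaceD[OF assms(2)] by (intro subspaceI) auto

lemma span_le: "S \<subseteq> W \<Longrightarrow> subspace K W V \<Longrightarrow> span S \<subseteq> W"
  by (simp add: span_is_subset subspace_def)

lemma lincomb_in_span: "finite F \<Longrightarrow> F \<subseteq> S \<Longrightarrow> a \<in> F \<rightarrow> carrier K \<Longrightarrow> lincomb a F \<in> span S"
  unfolding span_def by blast

text \<open>A vanishing combination of \<open>A \<union> B\<close>, split along \<open>A\<close> and
  \<open>B\<close>, produces a vector in both spans; conversely such a vector, written in both ways,
  is a vanishing combination.\<close>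

lemma lin_indpt_Un_iff:
  assumes disj: "A \<inter> B = {}" and A: "A \<subseteq> carrier V" and B: "B \<subseteq> carrier V"
  shows "lin_indpt (A \<union> B) \<longleftrightarrow> lin_indpt A \<and> lin_indpt B \<and> span A \<inter> span B \<subseteq> {\<zero>\<^bsub>V\<^esub>}"
proof
  assume ind: "lin_indpt (A \<union> B)"
  have "z = \<zero>\<^bsub>V\<^esub>" if zA: "z \<in> span A" and zB: "z \<in> span B" for z
  proof -
    obtain a F where F: "finite F" "F \<subseteq> A" "a \<in> F \<rightarrow> carrier K" "z = lincomb a F"
      using zA by (auto simp: span_def)
    have "\<ominus>\<^bsub>V\<^esub> z \<in> span B"
      using span_neg[OF B zB] .
    then obtain b G where G: "finite G" "G \<subseteq> B" "b \<in> G \<rightarrow> carrier K" "\<ominus>\<^bsub>V\<^esub> z = lincomb b G"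
      by (auto simp: span_def)
    have zc: "z \<in> carrier V" using zA A by auto
    define c where "c = (\<lambda>v. if v \<in> F then a v else b v)"
    have FG: "F \<inter> G = {}" using F G disj by auto
    have "lincomb c (F \<union> G) = z \<oplus>\<^bsub>V\<^esub> \<ominus>\<^bsub>V\<^esub> z"
      unfolding c_def G(4)
      using lincomb_union2[of F G a b] F G subset_trans[OF F(2) A] subset_trans[OF G(2) B] FG by simp
    then have "lincomb c (F \<union> G) = \<zero>\<^bsub>V\<^esub>" using zc by (simp add: M.r_neg)
    moreover have "c \<in> F \<union> G \<rightarrow> carrier K" using F G by (auto simp: c_def)
    ultimately have "\<forall>v \<in> F \<union> G. c v = \<zero>\<^bsub>K\<^esub>"
      using lin_dep_crit[of "F \<union> G" "A \<union> B" c] ind F G by blast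
    then have "a \<in> F \<rightarrow> {\<zero>\<^bsub>K\<^esub>}" unfolding c_def by (metis Pi_I UnI1 singletonI)
    then show ?thesis using F(4) lincomb_zero F(2) A by blast
  qed
  with ind show "lin_indpt A \<and> lin_indpt B \<and> span A \<inter> span B \<subseteq> {\<zero>\<^bsub>V\<^esub>}"
    using subset_li_is_li by blast
next
  assume R: "lin_indpt A \<and> lin_indpt B \<and> span A \<inter> span B \<subseteq> {\<zero>\<^bsub>V\<^esub>}"
  show "lin_indpt (A \<union> B)"
  proof
    assume "lin_dep (A \<union> B)"
    then obtain F a v where F: "finite F" "F \<subseteq> A \<union> B" "a \<in> F \<rightarrow> carrier K"
      "lincomb a F = \<zero>\<^bsub>V\<^esub>" "v \<in> F" "a v \<noteq> \<zero>\<^bsub>K\<^esub>"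
      by (auto simp: lin_dep_def)
    have FF: "F = (F \<inter> A) \<union> (F \<inter> B)" using F by auto
    have "lincomb a F = lincomb a (F \<inter> A) \<oplus>\<^bsub>V\<^esub> lincomb a (F \<inter> B)"
      by (subst FF, rule lincomb_union) (use F disj A B in auto)
    then have s0: "lincomb a (F \<inter> A) \<oplus>\<^bsub>V\<^esub> lincomb a (F \<inter> B) = \<zero>\<^bsub>V\<^esub>" using F by simp
    have sA: "lincomb a (F \<inter> A) \<in> span A" and sB: "lincomb a (F \<inter> B) \<in> span B"
      using F by (auto intro!: lincomb_in_span)
    have c: "lincomb a (F \<inter> A) \<in> carrier V" "lincomb a (F \<inter> B) \<in> carrier V"
      using sA sB A B by auto
    have "lincomb a (F \<inter> A) = \<ominus>\<^bsub>V\<^esub> lincomb a (F \<inter> B)"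
      using s0 c by (simp add: M.minus_equality)
    then have "lincomb a (F \<inter> A) \<in> span B" using span_neg[OF B sB] by simp
    then have 1: "lincomb a (F \<inter> A) = \<zero>\<^bsub>V\<^esub>" using R sA by auto
    then have 2: "lincomb a (F \<inter> B) = \<zero>\<^bsub>V\<^esub>" using s0 c by simp
    show False
    proof (cases "v \<in> A")
      case True
      then show ?thesis using lin_dep_crit[of "F \<inter> A" A a v] F 1 R by auto
    next
      case False
      then show ?thesis using lin_dep_crit[of "F \<inter> B" B a v] F 2 R by auto
    qed
  qed
qed

definition basis_of :: "'c set \<Rightarrow> 'c set \<Rightarrow> bool" where
  "basis_of W B \<longleftrightarrow> B \<subseteq> W \<and> lin_indpt B \<and> W \<subseteq> span B"

lemma basis_of_span: "basis_of W B \<Longrightarrow> subspace K W V \<Longrightarrow> span B = W"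
  unfolding basis_of_def using span_le by blast

text \<open>A maximal independent set between \<open>B\<close> and \<open>W\<close> exists because
  independent sets have at most \<open>dim\<close> elements; a vector of \<open>W\<close> outside
  its span would enlarge it.\<close>

lemma extend_basis_of:
  assumes fd: fin_dim and W: "subspace K W V" and B: "B \<subseteq> W" "lin_indpt B"
  obtains B' where "B \<subseteq> B'" "basis_of W B'"
proof -
  let ?P = "\<lambda>S. B \<subseteq> S \<and> S \<subseteq> W \<and> lin_indpt S"
  have Wc: "W \<subseteq> carrier V" using subspaceD[OF W] by blast
  have "\<exists>A. finite A \<and> maximal A ?P"
  proof (rule maximal_exists[of ?P dim B])
    fix A assume "?P A"
    then have "A \<subseteq> carrier V" "lin_indpt A" using Wc by auto
    then show "finite A \<and> card A \<le> dim" using li_le_dim[OF fd, of A] by simp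
  qed (use B in simp)
  then obtain A where m: "maximal A ?P" by blast
  have A: "?P A" using m unfolding maximal_def by (rule conjunct1)
  have Amax: "A' = A" if "A \<subseteq> A'" "?P A'" for A'
    using m that unfolding maximal_def by simp
  have "W \<subseteq> span A"
  proof
    fix w assume w: "w \<in> W"
    show "w \<in> span A"
    proof (rule ccontr)
      assume n: "w \<notin> span A"
      then have nA: "w \<notin> A" using in_own_span A Wc by blast
      then have "lin_indpt (A \<union> {w})"
        using lin_dep_iff_in_span[of A w] A Wc w n by (metis subset_trans subsetD)
      then have "A \<union> {w} = A" using A w by (intro Amax) auto
      then show False using nA by blast
    qed
  qed
  then show thesis using that A by (auto simp: basis_of_def)
qed

text \<open>A set rather than an indexed filtration: repeated members collapse, so chains indexed by
  all integers or by all points of a ray become finite by \<open>finite_flag\<close>.\<close>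

definition flag :: "'c set set \<Rightarrow> bool" where
  "flag \<R> \<longleftrightarrow> (\<forall>R\<in>\<R>. subspace K R V) \<and> (\<forall>R\<in>\<R>. \<forall>S\<in>\<R>. R \<subseteq> S \<or> S \<subseteq> R)"

text \<open>Dimension separates the members of a chain of subspaces and is bounded by
  \<open>dim\<close>. The size of a chosen basis stands in for the dimension, and
  \<open>replacement\<close> compares it with a basis extended from a smaller member.\<close>

lemma finite_flag:
  assumes fd: fin_dim and fl: "flag \<R>"
  shows "finite \<R>"
proof -
  have "\<exists>B. basis_of R B" if "R \<in> \<R>" for R
    by (rule extend_basis_of[OF fd, of R "{}"])
      (use that fl finite_lin_indpt2[of "{}"] in \<open>auto simp: flag_def\<close>)
  then obtain b where b: "\<And>R. R \<in> \<R> \<Longrightarrow> basis_of R (b R)" by metis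
  have Rc: "R \<subseteq> carrier V" if "R \<in> \<R>" for R using fl that subspaceD(1) by (auto simp: flag_def)
  have bc: "b R \<subseteq> carrier V" "lin_indpt (b R)" "finite (b R)" "card (b R) \<le> dim" if "R \<in> \<R>" for R
  proof -
    show 1: "b R \<subseteq> carrier V" "lin_indpt (b R)" using b[OF that] Rc[OF that] by (auto simp: basis_of_def)
    show "finite (b R)" "card (b R) \<le> dim" using li_le_dim[OF fd 1] by auto
  qed
  have lt: "card (b R) < card (b S)" if R: "R \<in> \<R>" and S: "S \<in> \<R>" and RS: "R \<subset> S" for R S
  proof -
    have sS: "subspace K S V" and sR: "subspace K R V" using S R fl by (auto simp: flag_def)
    have "b R \<subseteq> S" "lin_indpt (b R)" using b[OF R] RS by (auto simp: basis_of_def)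
    from extend_basis_of[OF fd sS this] obtain B where B: "b R \<subseteq> B" "basis_of S B" by blast
    have Bc: "B \<subseteq> carrier V" "lin_indpt B" using B Rc[OF S] by (auto simp: basis_of_def)
    have "b R \<noteq> B" using basis_of_span[OF b[OF R] sR] basis_of_span[OF B(2) sS] RS by auto
    then have "card (b R) < card B" using B(1) li_le_dim[OF fd Bc] by (intro psubset_card_mono) auto
    also have "card B \<le> card (b S)"
      using replacement[of B "b S"] li_le_dim[OF fd Bc] bc[OF S] Bc B(2) basis_of_span[OF b[OF S] sS]
      by (auto simp: basis_of_def)
    finally show ?thesis .
  qed
  have "inj_on (\<lambda>R. card (b R)) \<R>"
  proof (rule inj_onI)
    fix R S assume "R \<in> \<R>" "S \<in> \<R>" "card (b R) = card (b S)"
    then show "R = S" using lt[of R S] lt[of S R] fl unfolding flag_def by fastforce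
  qed
  moreover have "(\<lambda>R. card (b R)) ` \<R> \<subseteq> {..dim}" using bc by auto
  ultimately show ?thesis using finite_imageD finite_subset by blast
qed

lemma flag_max:
  assumes "flag \<R>" "finite \<R>" "\<R> \<noteq> {}"
  obtains R where "R \<in> \<R>" "\<And>S. S \<in> \<R> \<Longrightarrow> S \<subseteq> R"
proof -
  obtain R where R: "R \<in> \<R>" "\<And>S. S \<in> \<R> \<Longrightarrow> R \<subseteq> S \<Longrightarrow> R = S"
    using finite_has_maximal[OF assms(2,3)] by metis
  have "S \<subseteq> R" if "S \<in> \<R>" for S
  proof -
    have "R \<subseteq> S \<or> S \<subseteq> R" using assms(1) R(1) that by (simp add: flag_def)
    then show ?thesis using R(2)[OF that] by auto
  qed
  then show thesis using that R(1) by blast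
qed

definition adapted :: "'c set \<Rightarrow> 'c set \<Rightarrow> bool" where
  "adapted B R \<longleftrightarrow> R \<subseteq> span (B \<inter> R)"

text \<open>The flag is handled from below: the vectors chosen for the smaller members all lie in
  the largest member \<open>R\<close>, so together with \<open>B \<inter> R\<close> they extend to a
  basis of \<open>U \<inter> R\<close>. The clause \<open>C \<subseteq> \<Union>\<R>\<close> carries
  this containment through the induction.\<close>

lemma extend_adapted_aux:
  assumes fd: fin_dim and AU: "subspace K A V" and KU: "subspace K U V" and AK: "A \<subseteq> U"
    and B: "basis_of A B" and fin: "finite \<R>" and fl: "flag \<R>"
    and ad: "\<And>R. R \<in> \<R> \<Longrightarrow> A \<inter> R \<subseteq> span (B \<inter> R)"
  shows "\<exists>C. C \<subseteq> U \<and> C \<inter> B = {} \<and> lin_indpt (B \<union> C) \<and> C \<subseteq> \<Union>\<R> \<and>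
    (\<forall>R\<in>\<R>. U \<inter> R \<subseteq> span ((B \<union> C) \<inter> R))"
  using fin fl ad
proof (induction rule: finite_psubset_induct)
  case (psubset \<R>)
  have BA: "B \<subseteq> A" "lin_indpt B" using B by (auto simp: basis_of_def)
  have Ac: "A \<subseteq> carrier V" and Uc: "U \<subseteq> carrier V" using subspaceD(1)[OF AU] subspaceD(1)[OF KU] by auto
  show ?case
  proof (cases "\<R> = {}")
    case True
    then show ?thesis using BA by (intro exI[of _ "{}"]) auto
  next
    case False
    obtain R where R: "R \<in> \<R>" "\<And>S. S \<in> \<R> \<Longrightarrow> S \<subseteq> R"
      using flag_max[OF psubset(3,1) False] by blast
    have sR: "subspace K R V" using R psubset(3) by (auto simp: flag_def)
    have Rc: "R \<subseteq> carrier V" using subspaceD(1)[OF sR] .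
    have "\<R> - {R} \<subset> \<R>" using R by auto
    moreover have "flag (\<R> - {R})" using psubset(3) by (simp add: flag_def)
    moreover have "A \<inter> S \<subseteq> span (B \<inter> S)" if "S \<in> \<R> - {R}" for S using psubset(4) that by simp
    ultimately obtain C where C: "C \<subseteq> U" "C \<inter> B = {}" "lin_indpt (B \<union> C)"
      "C \<subseteq> \<Union>(\<R> - {R})" and C5: "\<forall>S\<in>\<R> - {R}. U \<inter> S \<subseteq> span ((B \<union> C) \<inter> S)"
      using psubset(2) by metis
    have CR: "C \<subseteq> R" using C(4) R(2) by auto
    have "lin_indpt (B \<inter> R \<union> C)" by (rule subset_li_is_li[OF C(3)]) auto
    then obtain X where X: "B \<inter> R \<union> C \<subseteq> X" "basis_of (U \<inter> R) X"
      using extend_basis_of[OF fd subspace_inter[OF KU sR], of "B \<inter> R \<union> C"] BA AK C(1) CR by blast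
    have XU: "X \<subseteq> U \<inter> R" "lin_indpt X" "U \<inter> R \<subseteq> span X" using X(2) by (auto simp: basis_of_def)
    have XR: "span X \<subseteq> R" by (rule span_le[OF _ sR]) (use XU in blast)
    have Bsplit: "B = (B - R) \<union> (B \<inter> R)" by auto
    have i1: "lin_indpt (B - R)" "span (B - R) \<inter> span (B \<inter> R) \<subseteq> {\<zero>\<^bsub>V\<^esub>}"
      using lin_indpt_Un_iff[of "B - R" "B \<inter> R"] Bsplit BA Ac by auto
    have sBA: "span (B - R) \<subseteq> A" by (rule span_le[OF _ AU]) (use BA in blast)
    \<comment> \<open>A common vector lies in \<open>A\<close> and in \<open>R\<close>, hence in
      \<open>span (B \<inter> R)\<close> by the hypothesis on \<open>B\<close>, and that span meets
      \<open>span (B - R)\<close> only in zero.\<close>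
    have "span (B - R) \<inter> span X \<subseteq> {\<zero>\<^bsub>V\<^esub>}"
      using i1(2) sBA XR psubset(4)[OF R(1)] by blast
    then have ind: "lin_indpt ((B - R) \<union> X)"
      using lin_indpt_Un_iff[of "B - R" X] i1 XU Uc BA Ac by blast
    define C' where "C' = X - B"
    have BC': "B \<union> C' = (B - R) \<union> X" using X XU by (auto simp: C'_def)
    have "U \<inter> S \<subseteq> span ((B \<union> C') \<inter> S)" if S: "S \<in> \<R>" for S
    proof (cases "S = R")
      case True
      have "X \<subseteq> (B \<union> C') \<inter> S" using XU True by (auto simp: C'_def)
      then show ?thesis using XU(3) span_is_monotone True by blast
    next
      case False
      have "(B \<union> C) \<inter> S \<subseteq> (B \<union> C') \<inter> S" using X C(2) by (auto simp: C'_def)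
      then show ?thesis using C5 S False span_is_monotone by blast
    qed
    moreover have "C' \<subseteq> U" "C' \<inter> B = {}" "lin_indpt (B \<union> C')" "C' \<subseteq> \<Union>\<R>"
      using XU R ind BC' by (auto simp: C'_def)
    ultimately show ?thesis by blast
  qed
qed

text \<open>Putting the whole space on top of the flag forces the new vectors to complete a basis of
  \<open>U\<close>. None of them lies in \<open>A\<close>, because \<open>B\<close> already spans
  \<open>A\<close> and independence would fail.\<close>

lemma extend_adapted:
  assumes fd: fin_dim and A: "subspace K A V" and U: "subspace K U V" and AU: "A \<subseteq> U"
    and B: "basis_of A B" and fl: "flag \<R>"
    and ad: "\<And>R. R \<in> \<R> \<Longrightarrow> A \<inter> R \<subseteq> span (B \<inter> R)"
  obtains B' where "B \<subseteq> B'" "basis_of U B'" "B' \<inter> A = B"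
    "\<forall>R\<in>\<R>. U \<inter> R \<subseteq> span (B' \<inter> R)"
proof -
  let ?R = "insert (carrier V) \<R>"
  have sub: "R \<subseteq> carrier V" if "R \<in> \<R>" for R using that fl subspaceD(1) by (auto simp: flag_def)
  have fl': "flag ?R" using fl sub subspace_carrier unfolding flag_def by blast
  have Ac: "A \<subseteq> carrier V" using subspaceD(1)[OF A] .
  have BA: "B \<subseteq> A" using B by (auto simp: basis_of_def)
  have "A \<inter> R \<subseteq> span (B \<inter> R)" if "R \<in> ?R" for R
    using that ad B Ac BA unfolding basis_of_def by (metis Int_absorb2 insert_iff subset_trans)
  from extend_adapted_aux[OF fd A U AU B finite_flag[OF fd fl'] fl' this] obtain C
    where C: "C \<subseteq> U" "C \<inter> B = {}" "lin_indpt (B \<union> C)" "\<And>R. R \<in> ?R \<Longrightarrow> U \<inter> R \<subseteq> span ((B \<union> C) \<inter> R)"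
    by blast
  have Uc: "U \<subseteq> carrier V" using subspaceD(1)[OF U] .
  have BC: "B \<union> C \<subseteq> U" using BA AU C by auto
  have "U \<subseteq> span (B \<union> C)" using C(4)[of "carrier V"] Uc BC
    by (metis Int_absorb2 insertI1 subset_trans)
  then have bs: "basis_of U (B \<union> C)" using BC C(3) by (auto simp: basis_of_def)
  have "c \<notin> A" if c: "c \<in> C" for c
  proof
    assume "c \<in> A"
    then have "c \<in> span B" using B by (auto simp: basis_of_def)
    moreover have "c \<in> span C" using in_own_span[of C] c C(1) Uc by blast
    moreover have "span B \<inter> span C \<subseteq> {\<zero>\<^bsub>V\<^esub>}" 
      using lin_indpt_Un_iff[of B C] C BA Ac Uc by blast
    ultimately have "c = \<zero>\<^bsub>V\<^esub>" by blast
    then show False using vs_zero_lin_dep[of "B \<union> C"] C(3) c BC Uc by blast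
  qed
  then have "(B \<union> C) \<inter> A = B" using BA by auto
  then show thesis using that[of "B \<union> C"] bs C(4) by auto
qed

text \<open>The basis grows along the second flag. At each member it is extended with the first flag
  as constraint, and vectors once chosen are kept, so it stays adapted to the intersections already
  reached.\<close>

lemma adapted_to_two_flags:
  assumes fd: fin_dim and fl1: "flag \<R>" and fl2: "flag \<S>"
  obtains B where "basis B" "\<forall>R\<in>\<R> \<union> \<S>. adapted B R"
    "\<forall>R\<in>\<R>. \<forall>S\<in>\<S>. R \<inter> S \<subseteq> span (B \<inter> (R \<inter> S))"
proof -
  have Rc: "R \<subseteq> carrier V" if "R \<in> \<R>" for R using that fl1 subspaceD(1) by (auto simp: flag_def)
  have Sc: "R \<subseteq> carrier V" if "R \<in> \<S>" for R using that fl2 subspaceD(1) by (auto simp: flag_def)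
  let ?S = "insert (carrier V) \<S>" and ?R = "insert (carrier V) \<R>"
  have flS: "flag ?S" using fl2 Sc subspace_carrier unfolding flag_def by blast
  have flR: "flag ?R" using fl1 Rc subspace_carrier unfolding flag_def by blast
  \<comment> \<open>\<open>U\<close> is the largest member handled so far, or zero at the start;
    recording this gives \<open>U \<subseteq> T\<close> for the next member \<open>T\<close>. The
    last clause is the hypothesis under which \<open>extend_adapted\<close> continues.\<close>
  define Q where "Q \<T> U B \<longleftrightarrow> (\<forall>R\<in>\<T>. R \<subseteq> U) \<and> (U = {\<zero>\<^bsub>V\<^esub>} \<or> U \<in> \<T>) \<and> subspace K U V \<and> basis_of U B \<and>
      (\<forall>R\<in>\<T>. \<forall>S\<in>?R. R \<inter> S \<subseteq> span (B \<inter> (R \<inter> S))) \<and> (\<forall>S\<in>?R. U \<inter> S \<subseteq> span (B \<inter> S))" for \<T> U B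
  have claim: "\<exists>U B. Q \<T> U B"
    if "finite \<T>" "flag \<T>" for \<T>
    using that
  proof (induction rule: finite_psubset_induct)
    case (psubset \<T>)
    show ?case
    proof (cases "\<T> = {}")
      case True
      have "basis_of {\<zero>\<^bsub>V\<^esub>} {}" using finite_lin_indpt2[of "{}"] span_zero by (auto simp: basis_of_def)
      then have "Q \<T> {\<zero>\<^bsub>V\<^esub>} {}" using True subspace_zero span_zero by (auto simp: Q_def)
      then show ?thesis by blast
    next
      case False
      obtain T where T: "T \<in> \<T>" "\<And>S. S \<in> \<T> \<Longrightarrow> S \<subseteq> T"
        using flag_max[OF psubset(3,1) False] by blast
      have sT: "subspace K T V" using T psubset(3) by (auto simp: flag_def)
      have lt: "\<T> - {T} \<subset> \<T>" using T by auto
      have "flag (\<T> - {T})" using psubset(3) by (auto simp: flag_def)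
      from psubset(2)[OF lt this] obtain U B where Q: "Q (\<T> - {T}) U B" by blast
      then have U: "\<forall>R\<in>\<T> - {T}. R \<subseteq> U"
        "U = {\<zero>\<^bsub>V\<^esub>} \<or> U \<in> \<T> - {T}" "subspace K U V" "basis_of U B"
        "\<forall>R\<in>\<T> - {T}. \<forall>S\<in>?R. R \<inter> S \<subseteq> span (B \<inter> (R \<inter> S))" "\<forall>S\<in>?R. U \<inter> S \<subseteq> span (B \<inter> S)"
        unfolding Q_def by simp_all
      have UT: "U \<subseteq> T" using U(2) T(2) subspaceD(2)[OF sT] by auto
      have "U \<inter> S \<subseteq> span (B \<inter> S)" if "S \<in> ?R" for S using U(6) that by blast
      from extend_adapted[OF fd U(3) sT UT U(4) flR this]
      obtain B' where B': "B \<subseteq> B'" "basis_of T B'" "\<forall>S\<in>?R. T \<inter> S \<subseteq> span (B' \<inter> S)"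
        by blast
      have "R \<inter> S \<subseteq> span (B' \<inter> (R \<inter> S))" if "R \<in> \<T>" "S \<in> ?R" for R S
      proof (cases "R = T")
        case True
        have "B' \<inter> S = B' \<inter> (R \<inter> S)" using B'(2) True by (auto simp: basis_of_def)
        then show ?thesis using B'(3) that(2) True by metis
      next
        case False
        have "span (B \<inter> (R \<inter> S)) \<subseteq> span (B' \<inter> (R \<inter> S))" using B'(1) by (intro span_is_monotone) auto
        then show ?thesis using U(5) that False by blast
      qed
      then have "Q \<T> T B'" using T sT B' unfolding Q_def by simp
      then show ?thesis by blast
    qed
  qed
  obtain U B where Q: "Q ?S U B" using claim[OF finite_flag[OF fd flS] flS] by blast
  have U: "\<forall>R\<in>?S. R \<subseteq> U" "subspace K U V" "basis_of U B" using Q unfolding Q_def by simp_all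
  have ad: "R \<inter> S \<subseteq> span (B \<inter> (R \<inter> S))" if "R \<in> ?S" "S \<in> ?R" for R S
    using Q that unfolding Q_def by blast
  have "U = carrier V" using U subspaceD(1)[OF U(2)] by auto
  then have "basis B" using U basis_of_span[OF U(3,2)] by (auto simp: basis_def basis_of_def)
  moreover have "adapted B R" if "R \<in> \<R>" for R
    using ad[of "carrier V" R] that Rc[OF that] by (simp add: adapted_def Int_absorb1)
  moreover have "adapted B R" if "R \<in> \<S>" for R
    using ad[of R "carrier V"] that Sc[OF that] by (simp add: adapted_def Int_absorb2)
  moreover have "R \<inter> S \<subseteq> span (B \<inter> (R \<inter> S))" if "R \<in> \<R>" "S \<in> \<S>" for R S
    using ad[of S R] that by (simp add: Int_commute)
  ultimately show thesis by (intro that) blast+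
qed

end

section \<open>Linear maps and adapted bases\<close>

context vectorspace begin

lemma eq_of_minus:
  assumes "u \<in> carrier V" "v \<in> carrier V" "u \<ominus>\<^bsub>V\<^esub> v = \<zero>\<^bsub>V\<^esub>"
  shows "u = v"
  using assms by (metis M.add.inv_closed M.minus_equality M.minus_minus a_minus_def)

lemma span_minus_zero:
  assumes "S \<subseteq> carrier V"
  shows "span (S - {\<zero>\<^bsub>V\<^esub>}) = span S"
proof
  show "span (S - {\<zero>\<^bsub>V\<^esub>}) \<subseteq> span S" by (rule span_is_monotone) auto
  have "S - {\<zero>\<^bsub>V\<^esub>} \<subseteq> carrier V" using assms by auto
  moreover have "S \<subseteq> span (S - {\<zero>\<^bsub>V\<^esub>})"
    using in_own_span[OF calculation] span_zero by blast
  ultimately show "span S \<subseteq> span (S - {\<zero>\<^bsub>V\<^esub>})" using span_le span_is_subspace by blast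
qed

end

context linear_map begin

lemma image_subspace:
  assumes "subspace K R V"
  shows "subspace K (T ` R) W"
proof (rule W.subspaceI)
  note R = V.subspaceD[OF assms]
  show "T ` R \<subseteq> carrier W" using R(1) by auto
  show "\<zero>\<^bsub>W\<^esub> \<in> T ` R" using R(2) T0_is_0 by (metis imageI)
  show "u \<oplus>\<^bsub>W\<^esub> v \<in> T ` R" if uv: "u \<in> T ` R" "v \<in> T ` R" for u v
  proof -
    obtain x y where xy: "x \<in> R" "y \<in> R" "u = T x" "v = T y" using uv by blast
    then have "u \<oplus>\<^bsub>W\<^esub> v = T (x \<oplus>\<^bsub>V\<^esub> y)" using R(1) by (simp add: subsetD)
    then show ?thesis using R(3)[OF xy(1,2)] by simp
  qed
  show "c \<odot>\<^bsub>W\<^esub> u \<in> T ` R" if cu: "c \<in> carrier K" "u \<in> T ` R" for c u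
  proof -
    obtain x where x: "x \<in> R" "u = T x" using cu by blast
    then have "c \<odot>\<^bsub>W\<^esub> u = T (c \<odot>\<^bsub>V\<^esub> x)" using R(1) cu by (simp add: subsetD)
    then show ?thesis using R(4)[OF cu(1) x(1)] by simp
  qed
qed

lemma preimage_subspace:
  assumes "subspace K R W"
  shows "subspace K {v \<in> carrier V. T v \<in> R} V"
proof (rule V.subspaceI)
  note R = W.subspaceD[OF assms]
  show "{v \<in> carrier V. T v \<in> R} \<subseteq> carrier V" by auto
  show "\<zero>\<^bsub>V\<^esub> \<in> {v \<in> carrier V. T v \<in> R}" using R(2) by simp
  show "u \<oplus>\<^bsub>V\<^esub> v \<in> {v \<in> carrier V. T v \<in> R}"
    if "u \<in> {v \<in> carrier V. T v \<in> R}" "v \<in> {v \<in> carrier V. T v \<in> R}" for u v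
    using that R(3) by simp
  show "c \<odot>\<^bsub>V\<^esub> u \<in> {v \<in> carrier V. T v \<in> R}"
    if "c \<in> carrier K" "u \<in> {v \<in> carrier V. T v \<in> R}" for c u
    using that R(4) by simp
qed

lemma image_span:
  assumes A: "A \<subseteq> carrier V"
  shows "T ` V.module.span A = W.module.span (T ` A)"
proof
  have TA: "T ` A \<subseteq> carrier W" using A by auto
  have "A \<subseteq> {v \<in> carrier V. T v \<in> W.module.span (T ` A)}" using A W.module.in_own_span[OF TA] by auto
  then have "V.module.span A \<subseteq> {v \<in> carrier V. T v \<in> W.module.span (T ` A)}"
    using V.span_le preimage_subspace W.span_is_subspace[OF TA] by blast
  then show "T ` V.module.span A \<subseteq> W.module.span (T ` A)" by auto
  have "T ` A \<subseteq> T ` V.module.span A" using V.module.in_own_span[OF A] by auto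
  then show "W.module.span (T ` A) \<subseteq> T ` V.module.span A"
    using W.span_le image_subspace V.span_is_subspace[OF A] by blast
qed

lemma lincomb_image:
  assumes F: "finite F" "F \<subseteq> carrier V" "inj_on T F" and a: "a \<in> T ` F \<rightarrow> carrier K"
  shows "W.module.lincomb a (T ` F) = T (V.module.lincomb (a \<circ> T) F)"
proof -
  have "W.module.lincomb a (T ` F) = (\<Oplus>\<^bsub>W\<^esub> v\<in>F. a (T v) \<odot>\<^bsub>W\<^esub> T v)"
    unfolding W.module.lincomb_def
    by (rule W.module.M.add.finprod_reindex[OF _ F(3)]) (use F a in \<open>auto intro!: W.module.smult_closed\<close>)
  also have "\<dots> = (\<Oplus>\<^bsub>W\<^esub> v\<in>F. T (a (T v) \<odot>\<^bsub>V\<^esub> v))"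
    by (rule W.module.M.add.finprod_cong') (use F a in \<open>auto intro!: W.module.smult_closed simp: Pi_iff subset_iff\<close>)
  also have "\<dots> = T (\<Oplus>\<^bsub>V\<^esub> v\<in>F. a (T v) \<odot>\<^bsub>V\<^esub> v)"
    by (rule hom_sum[symmetric]) (use F a in \<open>auto intro!: V.module.smult_closed\<close>)
  finally show ?thesis by (simp add: V.module.lincomb_def)
qed

lemma indpt_image:
  assumes L: "L \<subseteq> carrier V" "V.module.lin_indpt L"
    and ker: "\<And>v. v \<in> V.module.span L \<Longrightarrow> T v = \<zero>\<^bsub>W\<^esub> \<Longrightarrow> v = \<zero>\<^bsub>V\<^esub>"
  shows "inj_on T L" "W.module.lin_indpt (T ` L)"
proof -
  show inj: "inj_on T L"
  proof (rule inj_onI)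
    fix u v assume uv: "u \<in> L" "v \<in> L" "T u = T v"
    have s: "u \<in> V.module.span L" "v \<in> V.module.span L" using V.module.in_own_span[OF L(1)] uv by auto
    then have "u \<ominus>\<^bsub>V\<^esub> v \<in> V.module.span L"
      using V.subspaceD(6)[OF V.span_is_subspace[OF L(1)]] by blast
    moreover have c: "u \<in> carrier V" "v \<in> carrier V" using uv L by auto
    moreover have "T (u \<ominus>\<^bsub>V\<^esub> v) = \<zero>\<^bsub>W\<^esub>" using c uv(3) by (simp add: W.module.M.r_neg a_minus_def)
    ultimately show "u = v" using ker V.eq_of_minus by blast
  qed
  show "W.module.lin_indpt (T ` L)"
  proof
    assume "W.module.lin_dep (T ` L)"
    then obtain G a w where G: "finite G" "G \<subseteq> T ` L" "a \<in> G \<rightarrow> carrier K" "W.module.lincomb a G = \<zero>\<^bsub>W\<^esub>"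
      "w \<in> G" "a w \<noteq> \<zero>\<^bsub>K\<^esub>" unfolding W.module.lin_dep_def by blast
    obtain F where F: "F \<subseteq> L" "finite F" "G = T ` F" using finite_subset_image[OF G(1,2)] by blast
    have Fc: "F \<subseteq> carrier V" using F L by auto
    have "T (V.module.lincomb (a \<circ> T) F) = \<zero>\<^bsub>W\<^esub>"
      using lincomb_image[OF F(2) Fc inj_on_subset[OF inj F(1)], of a] G F by simp
    moreover have aT: "a \<circ> T \<in> F \<rightarrow> carrier K" using G(3) F(3) by auto
    moreover have "V.module.lincomb (a \<circ> T) F \<in> V.module.span L" using V.lincomb_in_span F aT by blast
    ultimately have 0: "V.module.lincomb (a \<circ> T) F = \<zero>\<^bsub>V\<^esub>" using ker by blast
    obtain v where v: "v \<in> F" "w = T v" using G(5) F(3) by auto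
    then show False using V.module.lin_dep_crit[OF F(2,1) aT v(1) _ 0] G(6) L(2) by simp
  qed
qed

lemma indpt_lift:
  assumes L: "L \<subseteq> carrier V" and inj: "inj_on T L" and ind: "W.module.lin_indpt (T ` L)"
  shows "V.module.lin_indpt L" "\<And>v. v \<in> V.module.span L \<Longrightarrow> T v = \<zero>\<^bsub>W\<^esub> \<Longrightarrow> v = \<zero>\<^bsub>V\<^esub>"
proof -
  have *: "a v = \<zero>\<^bsub>K\<^esub>" if F: "finite F" "F \<subseteq> L" "a \<in> F \<rightarrow> carrier K" "T (V.module.lincomb a F) = \<zero>\<^bsub>W\<^esub>"
    and v: "v \<in> F" for F a v
  proof -
    have inF: "inj_on T F" using inj_on_subset[OF inj F(2)] .
    have Fc: "F \<subseteq> carrier V" using F(2) L by auto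
    define b where "b = a \<circ> the_inv_into F T"
    have bT: "(b \<circ> T) u = a u" if "u \<in> F" for u
      using that the_inv_into_f_f[OF inF] by (simp add: b_def)
    have bF: "b \<in> T ` F \<rightarrow> carrier K" using bT F(3) by (auto simp: Pi_iff)
    have "V.module.lincomb (b \<circ> T) F = V.module.lincomb a F"
      by (rule V.module.lincomb_cong[OF refl Fc bT F(3)])
    then have "W.module.lincomb b (T ` F) = \<zero>\<^bsub>W\<^esub>" using lincomb_image[OF F(1) Fc inF bF] F(4) by simp
    then have "b (T v) = \<zero>\<^bsub>K\<^esub>"
      using W.module.lin_dep_crit[of "T ` F" "T ` L" b "T v"] ind F v bF by blast
    then show ?thesis using bT[OF v] by simp
  qed
  show "V.module.lin_indpt L"
  proof
    assume "V.module.lin_dep L"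
    then obtain F a v where F: "finite F" "F \<subseteq> L" "a \<in> F \<rightarrow> carrier K" "V.module.lincomb a F = \<zero>\<^bsub>V\<^esub>"
      "v \<in> F" "a v \<noteq> \<zero>\<^bsub>K\<^esub>" unfolding V.module.lin_dep_def by blast
    then show False using *[OF F(1-3) _ F(5)] by simp
  qed
  show "v = \<zero>\<^bsub>V\<^esub>" if v: "v \<in> V.module.span L" "T v = \<zero>\<^bsub>W\<^esub>" for v
  proof -
    obtain F a where F: "finite F" "F \<subseteq> L" "a \<in> F \<rightarrow> carrier K" "v = V.module.lincomb a F"
      using v(1) unfolding V.module.span_def by blast
    then have "a \<in> F \<rightarrow> {\<zero>\<^bsub>K\<^esub>}" using *[OF F(1-3)] v(2) by auto
    then show ?thesis using V.lincomb_zero[of F a] F L by auto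
  qed
qed

text \<open>Adaptedness to the kernel makes the basis elements outside it span a complement, on
  which \<open>T\<close> is injective. So the nonzero images are distinct and independent, whereas
  for an arbitrary basis they could coincide.\<close>

lemma image_basis:
  assumes B: "V.basis B" and ad: "V.adapted B {v \<in> carrier V. T v = \<zero>\<^bsub>W\<^esub>}"
  shows "W.basis_of (T ` carrier V) (T ` B - {\<zero>\<^bsub>W\<^esub>})"
    and "inj_on T {b \<in> B. T b \<noteq> \<zero>\<^bsub>W\<^esub>}"
    and "\<And>R. V.adapted B {v \<in> carrier V. T v \<in> R} \<Longrightarrow>
      T ` carrier V \<inter> R \<subseteq> W.module.span ((T ` B - {\<zero>\<^bsub>W\<^esub>}) \<inter> R)"
proof -
  have Bc: "B \<subseteq> carrier V" "V.module.lin_indpt B" "V.module.span B = carrier V" using B by (auto simp: V.basis_def)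
  let ?L = "{b \<in> B. T b \<noteq> \<zero>\<^bsub>W\<^esub>}" and ?N = "B \<inter> {v \<in> carrier V. T v = \<zero>\<^bsub>W\<^esub>}"
  have LN: "?L \<union> ?N = B" "?L \<inter> ?N = {}" using Bc by auto
  have Lc: "?L \<subseteq> carrier V" and Nc: "?N \<subseteq> carrier V" using Bc by auto
  have "V.module.lin_indpt (?L \<union> ?N)" unfolding LN(1) by (rule Bc(2))
  then have s: "V.module.lin_indpt ?L" "V.module.span ?L \<inter> V.module.span ?N \<subseteq> {\<zero>\<^bsub>V\<^esub>}"
    unfolding V.lin_indpt_Un_iff[OF LN(2) Lc Nc] by simp_all
  have k: "v = \<zero>\<^bsub>V\<^esub>" if "v \<in> V.module.span ?L" "T v = \<zero>\<^bsub>W\<^esub>" for v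
  proof -
    have "v \<in> carrier V" using that(1) V.span_closed[OF Lc] by blast
    then have "v \<in> V.module.span ?N" using ad that(2) unfolding V.adapted_def by blast
    then show ?thesis using s(2) that(1) by blast
  qed
  show "inj_on T ?L" using indpt_image(1)[OF Lc s(1) k] .
  have TL: "T ` ?L = T ` B - {\<zero>\<^bsub>W\<^esub>}" by auto
  have ind: "W.module.lin_indpt (T ` B - {\<zero>\<^bsub>W\<^esub>})" using indpt_image(2)[OF Lc s(1) k] TL by simp
  have TBc: "T ` B \<subseteq> carrier W" using Bc by auto
  have "T ` carrier V = W.module.span (T ` B - {\<zero>\<^bsub>W\<^esub>})"
    using image_span[OF Bc(1)] Bc(3) W.span_minus_zero[OF TBc] by simp
  then show "W.basis_of (T ` carrier V) (T ` B - {\<zero>\<^bsub>W\<^esub>})"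
    unfolding W.basis_of_def using ind Bc by auto
  show "T ` carrier V \<inter> R \<subseteq> W.module.span ((T ` B - {\<zero>\<^bsub>W\<^esub>}) \<inter> R)"
    if "V.adapted B {v \<in> carrier V. T v \<in> R}" for R
  proof
    fix w assume "w \<in> T ` carrier V \<inter> R"
    then obtain v where v: "v \<in> carrier V" "w = T v" "T v \<in> R" by auto
    let ?P = "B \<inter> {v \<in> carrier V. T v \<in> R}"
    have Pc: "?P \<subseteq> carrier V" by auto
    have "v \<in> V.module.span ?P" using that v unfolding V.adapted_def by blast
    then have "w \<in> W.module.span (T ` ?P)" using image_span[OF Pc] v(2) by blast
    moreover have "T ` ?P \<subseteq> carrier W" by auto
    moreover have "T ` ?P - {\<zero>\<^bsub>W\<^esub>} \<subseteq> (T ` B - {\<zero>\<^bsub>W\<^esub>}) \<inter> R" by auto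
    ultimately have "w \<in> W.module.span (T ` ?P - {\<zero>\<^bsub>W\<^esub>})"
      and "T ` ?P - {\<zero>\<^bsub>W\<^esub>} \<subseteq> (T ` B - {\<zero>\<^bsub>W\<^esub>}) \<inter> R"
      using W.span_minus_zero[of "T ` ?P"] by simp_all
    then show "w \<in> W.module.span ((T ` B - {\<zero>\<^bsub>W\<^esub>}) \<inter> R)"
      using W.module.span_is_monotone by (meson subsetD)
  qed
qed

end

text \<open>In the sweep \<open>T1\<close> is \<open>x\<close> into the new point and
  \<open>T2\<close> is \<open>y\<close> out of it. The nonzero images of \<open>B1\<close> are
  extended to a basis of the kernel of \<open>T2\<close>, and the members of \<open>B2\<close> in
  the image of \<open>T2\<close> are lifted. The lifts span a complement of the kernel, so the bases
  at both neighbours are respected.\<close>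

lemma adapted_basis_step:
  assumes l1: "linear_map K V1 V T1" and l2: "linear_map K V V2 T2"
    and T21: "\<And>v. v \<in> carrier V1 \<Longrightarrow> T2 (T1 v) = \<zero>\<^bsub>V2\<^esub>"
    and fd: "vectorspace.fin_dim K V" and fl: "vectorspace.flag K V \<R>"
    and B1: "vectorspace.basis K V1 B1" "vectorspace.adapted K V1 B1 {v \<in> carrier V1. T1 v = \<zero>\<^bsub>V\<^esub>}"
      "\<And>R. R \<in> \<R> \<Longrightarrow> vectorspace.adapted K V1 B1 {v \<in> carrier V1. T1 v \<in> R}"
    and B2: "vectorspace.basis K V2 B2" "vectorspace.adapted K V2 B2 (T2 ` carrier V)"
      "\<And>R. R \<in> \<R> \<Longrightarrow> vectorspace.adapted K V2 B2 (T2 ` R)"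
  obtains B where "vectorspace.basis K V B" "\<And>R. R \<in> \<R> \<Longrightarrow> vectorspace.adapted K V B R"
    "\<And>b. b \<in> B1 \<Longrightarrow> T1 b \<noteq> \<zero>\<^bsub>V\<^esub> \<Longrightarrow> T1 b \<in> B" "inj_on T1 {b \<in> B1. T1 b \<noteq> \<zero>\<^bsub>V\<^esub>}"
    "\<And>b. b \<in> B \<Longrightarrow> T2 b \<noteq> \<zero>\<^bsub>V2\<^esub> \<Longrightarrow> T2 b \<in> B2" "inj_on T2 {b \<in> B. T2 b \<noteq> \<zero>\<^bsub>V2\<^esub>}"
proof -
  interpret V: vectorspace K V using l2 by (simp add: linear_map_def)
  interpret V1: vectorspace K V1 using l1 by (simp add: linear_map_def)
  interpret V2: vectorspace K V2 using l2 by (simp add: linear_map_def)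
  interpret T1: linear_map K V1 V T1 by (rule l1)
  interpret T2: linear_map K V V2 T2 by (rule l2)
  let ?A = "T1 ` carrier V1" and ?U = "{v \<in> carrier V. T2 v = \<zero>\<^bsub>V2\<^esub>}"
  have A: "subspace K ?A V" by (rule T1.image_subspace[OF V1.subspace_carrier])
  have U: "subspace K ?U V" using T2.preimage_subspace[OF V2.subspace_zero] by simp
  have AU: "?A \<subseteq> ?U" using T21 by auto
  have "?A \<inter> R \<subseteq> V.module.span ((T1 ` B1 - {\<zero>\<^bsub>V\<^esub>}) \<inter> R)" if "R \<in> \<R>" for R
    using T1.image_basis(3)[OF B1(1,2) B1(3)[OF that]] .
  note ext = V.extend_adapted[OF fd A U AU T1.image_basis(1)[OF B1(1,2)] fl this]
  obtain BK where BK: "T1 ` B1 - {\<zero>\<^bsub>V\<^esub>} \<subseteq> BK" "V.basis_of ?U BK"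
      "\<forall>R\<in>\<R>. ?U \<inter> R \<subseteq> V.module.span (BK \<inter> R)"
  proof (rule ext)
    fix B' assume B': "T1 ` B1 - {\<zero>\<^bsub>V\<^esub>} \<subseteq> B'" "V.basis_of ?U B'"
      "\<forall>R\<in>\<R>. ?U \<inter> R \<subseteq> V.module.span (B' \<inter> R)"
    show thesis by (rule that[OF B'])
  qed
  have BKU: "BK \<subseteq> ?U" "V.module.lin_indpt BK" "?U \<subseteq> V.module.span BK" using BK(2) by (auto simp: V.basis_of_def)
  have sBK: "V.module.span BK = ?U" using V.basis_of_span[OF BK(2) U] .
  \<comment> \<open>As \<open>B2\<close> is adapted to the image of \<open>T2\<close>, these
    elements form a basis of it, and their lifts complete a basis of the kernel to one of
    \<open>V\<close>.\<close>
  define D where "D = B2 \<inter> T2 ` carrier V"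
  have B2c: "B2 \<subseteq> carrier V2" "V2.module.lin_indpt B2" using B2(1) by (auto simp: V2.basis_def)
  have z: "\<zero>\<^bsub>V2\<^esub> \<notin> D" using V2.vs_zero_lin_dep[OF B2c] by (auto simp: D_def)
  have finR: "finite \<R>" using V.finite_flag[OF fd fl] .
  have Rc: "R \<subseteq> carrier V" "subspace K R V" if "R \<in> \<R>" for R
    using fl that V.subspaceD(1) by (auto simp: V.flag_def)
  \<comment> \<open>The lift is taken from the smallest member whose image contains
    \<open>d\<close>; since the members form a chain, it then lies in every member whose image
    contains \<open>d\<close>.\<close>
  have "\<exists>v. v \<in> carrier V \<and> T2 v = d \<and> (\<forall>R\<in>\<R>. d \<in> T2 ` R \<longrightarrow> v \<in> R)" if d: "d \<in> D" for d
  proof (cases "{R \<in> \<R>. d \<in> T2 ` R} = {}")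
    case True
    then show ?thesis using d by (auto simp: D_def)
  next
    case False
    obtain R where R: "R \<in> \<R>" "d \<in> T2 ` R" "\<And>S. S \<in> \<R> \<Longrightarrow> d \<in> T2 ` S \<Longrightarrow> S \<subseteq> R \<Longrightarrow> R = S"
      using finite_has_minimal[OF _ False] finR by auto
    obtain v where v: "v \<in> R" "T2 v = d" using R(2) by auto
    have "v \<in> S" if S: "S \<in> \<R>" "d \<in> T2 ` S" for S
    proof -
      have "R \<subseteq> S \<or> S \<subseteq> R" using fl R(1) S(1) by (simp add: V.flag_def)
      then show ?thesis using R(3)[OF S] v(1) by auto
    qed
    then show ?thesis using v Rc(1)[OF R(1)] by auto
  qed
  then obtain l where l: "\<And>d. d \<in> D \<Longrightarrow> l d \<in> carrier V" "\<And>d. d \<in> D \<Longrightarrow> T2 (l d) = d"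
    "\<And>d R. d \<in> D \<Longrightarrow> R \<in> \<R> \<Longrightarrow> d \<in> T2 ` R \<Longrightarrow> l d \<in> R" by metis
  define L where "L = l ` D"
  have Lc: "L \<subseteq> carrier V" using l by (auto simp: L_def)
  have inj: "inj_on T2 L" unfolding L_def inj_on_def using l(2) by auto
  have TL: "T2 ` L = D" unfolding L_def image_image using l(2) by simp
  have "V2.module.lin_indpt D" by (rule V2.module.subset_li_is_li[OF B2c(2)]) (simp add: D_def)
  then have indTL: "V2.module.lin_indpt (T2 ` L)" unfolding TL .
  note L = T2.indpt_lift[OF Lc inj indTL]
  have "T2 v \<noteq> \<zero>\<^bsub>V2\<^esub>" if "v \<in> L" for v using that TL z by (metis imageI)
  then have disj: "BK \<inter> L = {}" using BKU(1) by auto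
  have BKc: "BK \<subseteq> carrier V" using BKU by auto
  have "V.module.span BK \<inter> V.module.span L \<subseteq> {\<zero>\<^bsub>V\<^esub>}" unfolding sBK using L(2) by blast
  then have ind: "V.module.lin_indpt (BK \<union> L)" using V.lin_indpt_Un_iff[OF disj BKc Lc] BKU(2) L(1) by simp
  \<comment> \<open>A vector of \<open>R\<close> is corrected by a combination of lifts in
    \<open>R\<close> with the same image; the difference lies in the kernel and in \<open>R\<close>,
    where \<open>BK\<close> suffices. Taking the whole space for \<open>R\<close> later gives
    spanning.\<close>
  have ad: "V.adapted (BK \<union> L) R" if R: "subspace K R V" and KR: "?U \<inter> R \<subseteq> V.module.span (BK \<inter> R)"
    and ad2: "V2.adapted B2 (T2 ` R)" and lR: "\<And>d. d \<in> D \<Longrightarrow> d \<in> T2 ` R \<Longrightarrow> l d \<in> R" for R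
    unfolding V.adapted_def
  proof
    fix r assume r: "r \<in> R"
    note RD = V.subspaceD[OF R]
    have rc: "r \<in> carrier V" using r RD(1) by auto
    have "T2 r \<in> V2.module.span (B2 \<inter> T2 ` R)" using ad2 r unfolding V2.adapted_def by blast
    moreover have "B2 \<inter> T2 ` R \<subseteq> T2 ` (L \<inter> R)"
    proof
      fix d assume d: "d \<in> B2 \<inter> T2 ` R"
      then have "d \<in> D" using RD(1) by (auto simp: D_def)
      then have "l d \<in> L \<inter> R" "T2 (l d) = d" using lR[of d] d l(2)[of d] by (auto simp: L_def)
      then show "d \<in> T2 ` (L \<inter> R)" by (metis imageI)
    qed
    moreover have LRc: "L \<inter> R \<subseteq> carrier V" using Lc by auto
    ultimately have "T2 r \<in> V2.module.span (T2 ` (L \<inter> R))"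
      using V2.module.span_is_monotone by (meson subsetD)
    then have "T2 r \<in> T2 ` V.module.span (L \<inter> R)" unfolding T2.image_span[OF LRc] .
    then obtain s where s: "s \<in> V.module.span (L \<inter> R)" "T2 r = T2 s" by auto
    have sR: "s \<in> R" using V.span_le[OF Int_lower2 R] s(1) by blast
    then have sc: "s \<in> carrier V" using RD(1) by auto
    have "T2 (r \<ominus>\<^bsub>V\<^esub> s) = \<zero>\<^bsub>V2\<^esub>" using s(2) rc sc by (simp add: V2.module.M.r_neg a_minus_def)
    then have "r \<ominus>\<^bsub>V\<^esub> s \<in> ?U \<inter> R" using RD(6)[OF r sR] rc sc by simp
    then have "r \<ominus>\<^bsub>V\<^esub> s \<in> V.module.span (BK \<inter> R)" using KR by blast
    then have 1: "r \<ominus>\<^bsub>V\<^esub> s \<in> V.module.span ((BK \<union> L) \<inter> R)"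
      using V.module.span_is_monotone[of "BK \<inter> R" "(BK \<union> L) \<inter> R"] by blast
    have 2: "s \<in> V.module.span ((BK \<union> L) \<inter> R)"
      using s(1) V.module.span_is_monotone[of "L \<inter> R" "(BK \<union> L) \<inter> R"] by blast
    have "(BK \<union> L) \<inter> R \<subseteq> carrier V" using RD(1) by auto
    from V.span_add1[OF this 1 2] show "r \<in> V.module.span ((BK \<union> L) \<inter> R)"
      using rc sc by (simp add: V.module.M.minus_eq V.module.M.a_assoc V.module.M.l_neg)
  qed
  have "V.adapted (BK \<union> L) (carrier V)"
  proof (rule ad[OF V.subspace_carrier _ B2(2)])
    show "?U \<inter> carrier V \<subseteq> V.module.span (BK \<inter> carrier V)" using BKU(3) Int_absorb2[OF BKc] by auto
    show "l d \<in> carrier V" if "d \<in> D" for d using l(1)[OF that] .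
  qed
  moreover have "(BK \<union> L) \<inter> carrier V = BK \<union> L" using BKc Lc by auto
  ultimately have "V.module.span (BK \<union> L) = carrier V"
    using V.module.span_is_subset2[of "BK \<union> L"] BKc Lc by (auto simp: V.adapted_def)
  then have bas: "V.basis (BK \<union> L)" using ind BKc Lc by (auto simp: V.basis_def)
  have nz: "b \<in> L" if "b \<in> BK \<union> L" "T2 b \<noteq> \<zero>\<^bsub>V2\<^esub>" for b using that BKU by auto
  show thesis
  proof (rule that[OF bas])
    show "V.adapted (BK \<union> L) R" if "R \<in> \<R>" for R
      using ad[OF Rc(2)[OF that] BK(3)[rule_format, OF that] B2(3)[OF that]] l(3)[OF _ that] by blast
    show "T1 b \<in> BK \<union> L" if "b \<in> B1" "T1 b \<noteq> \<zero>\<^bsub>V\<^esub>" for b using that BK(1) by auto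
    show "inj_on T1 {b \<in> B1. T1 b \<noteq> \<zero>\<^bsub>V\<^esub>}" using T1.image_basis(2)[OF B1(1,2)] .
    show "T2 b \<in> B2" if "b \<in> BK \<union> L" "T2 b \<noteq> \<zero>\<^bsub>V2\<^esub>" for b
      using nz[OF that] TL by (auto simp: D_def)
    show "inj_on T2 {b \<in> BK \<union> L. T2 b \<noteq> \<zero>\<^bsub>V2\<^esub>}"
      by (rule inj_on_subset[OF inj]) (use nz in auto)
  qed
qed

section \<open>Representations annihilated by \<open>xy\<close>\<close>

context vectorspace begin

lemma basis_of_carrier: "basis_of (carrier V) B \<longleftrightarrow> basis B"
proof -
  have "B \<subseteq> carrier V \<Longrightarrow> carrier V \<subseteq> span B \<longleftrightarrow> span B = carrier V"
    using span_is_subset2 by auto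
  then show ?thesis by (auto simp: basis_of_def basis_def)
qed

lemma flag_insert_zero: "flag \<R> \<Longrightarrow> flag (insert {\<zero>\<^bsub>V\<^esub>} \<R>)"
  using subspace_zero subspaceD(2) unfolding flag_def by simp

lemma flag_insert_carrier: "flag \<R> \<Longrightarrow> flag (insert (carrier V) \<R>)"
  using subspace_carrier subspaceD(1) unfolding flag_def by simp

end

text \<open>Images under \<open>T0\<close> lie in the kernel of \<open>T\<close>, and preimages
  under \<open>T\<close> contain that kernel, so one chain lies entirely below the other.\<close>

lemma flag_preimage_image:
  assumes l0: "linear_map K V0 V T0" and l: "linear_map K V W T"
    and null: "\<And>v. v \<in> carrier V0 \<Longrightarrow> T (T0 v) = \<zero>\<^bsub>W\<^esub>"
    and fl0: "vectorspace.flag K V0 \<A>" and fl: "vectorspace.flag K W \<B>"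
  shows "vectorspace.flag K V ((\<lambda>R. {v \<in> carrier V. T v \<in> R}) ` \<B> \<union> (\<lambda>R. T0 ` R) ` \<A>)"
proof -
  interpret V: vectorspace K V using l by (simp add: linear_map_def)
  interpret V0: vectorspace K V0 using l0 by (simp add: linear_map_def)
  interpret W: vectorspace K W using l by (simp add: linear_map_def)
  interpret T0: linear_map K V0 V T0 by (rule l0)
  interpret T: linear_map K V W T by (rule l)
  let ?B = "(\<lambda>R. {v \<in> carrier V. T v \<in> R}) ` \<B>" and ?A = "(\<lambda>R. T0 ` R) ` \<A>"
  have sub: "subspace K R V" if R: "R \<in> ?B \<union> ?A" for R
  proof (cases "R \<in> ?B")
    case True
    then obtain R0 where "R0 \<in> \<B>" "R = {v \<in> carrier V. T v \<in> R0}" by blast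
    then show ?thesis using T.preimage_subspace fl by (simp add: W.flag_def)
  next
    case False
    then obtain R0 where "R0 \<in> \<A>" "R = T0 ` R0" using R by blast
    then show ?thesis using T0.image_subspace fl0 by (simp add: V0.flag_def)
  qed
  have AB: "R \<subseteq> S" if asm: "R \<in> ?A" "S \<in> ?B" for R S
  proof -
    obtain R0 S0 where RS: "R0 \<in> \<A>" "R = T0 ` R0" "S0 \<in> \<B>" "S = {v \<in> carrier V. T v \<in> S0}"
      using asm by blast
    have "subspace K R0 V0" "subspace K S0 W" using RS fl0 fl by (auto simp: V0.flag_def W.flag_def)
    then have "R0 \<subseteq> carrier V0" "\<zero>\<^bsub>W\<^esub> \<in> S0" using V0.subspaceD(1) W.subspaceD(2) by blast+
    then show ?thesis unfolding RS using null by auto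
  qed
  have AA: "R \<subseteq> S \<or> S \<subseteq> R" if asm: "R \<in> ?A" "S \<in> ?A" for R S
  proof -
    obtain R0 S0 where RS: "R0 \<in> \<A>" "R = T0 ` R0" "S0 \<in> \<A>" "S = T0 ` S0"
      using asm by blast
    have "R0 \<subseteq> S0 \<or> S0 \<subseteq> R0" using RS fl0 by (simp add: V0.flag_def)
    then show ?thesis unfolding RS by auto
  qed
  have BB: "R \<subseteq> S \<or> S \<subseteq> R" if asm: "R \<in> ?B" "S \<in> ?B" for R S
  proof -
    obtain R0 S0 where RS: "R0 \<in> \<B>" "R = {v \<in> carrier V. T v \<in> R0}" "S0 \<in> \<B>" "S = {v \<in> carrier V. T v \<in> S0}"
      using asm by blast
    have "R0 \<subseteq> S0 \<or> S0 \<subseteq> R0" using RS fl by (simp add: W.flag_def)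
    then show ?thesis unfolding RS by auto
  qed
  show ?thesis unfolding V.flag_def
  proof (intro conjI ballI)
    fix R S assume RS: "R \<in> ?B \<union> ?A" "S \<in> ?B \<union> ?A"
    show "R \<subseteq> S \<or> S \<subseteq> R"
    proof (cases "R \<in> ?B")
      case R: True
      show ?thesis
      proof (cases "S \<in> ?B")
        case True
        then show ?thesis by (rule BB[OF R])
      next
        case False
        then have "S \<in> ?A" using RS(2) by (meson UnE)
        then show ?thesis using AB[OF \<open>S \<in> ?A\<close> R] by (intro disjI2)
      qed
    next
      case False
      then have R: "R \<in> ?A" using RS(1) by (meson UnE)
      show ?thesis
      proof (cases "S \<in> ?B")
        case True
        then show ?thesis using AB[OF R True] by (intro disjI1)
      next
        case False
        then have "S \<in> ?A" using RS(2) by (meson UnE)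
        then show ?thesis by (rule AA[OF R])
      qed
    qed
  qed (rule sub)
qed

declare split_paired_All [simp del] split_paired_Ex [simp del]

text \<open>Constant along diagonals: by convexity and the condition on \<open>p + (1,1)\<close>, a
  spread curve meets each level at most once.\<close>

abbreviation lev :: "int \<times> int \<Rightarrow> int" where "lev p \<equiv> fst p - snd p"

section \<open>Pointwise finite dimensional representations and string bases\<close>

locale pfd_rep =
  fixes k :: "('a, 'b) ring_scheme" and C :: "('a, 'v) rep"
  assumes rep: "rep2 k C"
begin

abbreviation "S \<equiv> Space C"
abbreviation "ker p q \<equiv> {v \<in> carrier (S p). smap C p q v = \<zero>\<^bsub>S q\<^esub>}"

lemma vs: "vectorspace k (S p)" and fd: "vectorspace.fin_dim k (S p)"
  using rep[unfolded rep2_def, THEN conjunct1, rule_format, of p] by simp_all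

lemma smap_hom: "p \<le> q \<Longrightarrow> smap C p q \<in> module_hom k (S p) (S q)"
  using rep[unfolded rep2_def, THEN conjunct2, THEN conjunct1, rule_format] .

lemma lin: "p \<le> q \<Longrightarrow> linear_map k (S p) (S q) (smap C p q)"
  using smap_hom[of p q] vs[of p] vs[of q] vectorspace.axioms(1)[OF vs]
  by (simp add: linear_map_def mod_hom_def mod_hom_axioms_def)

lemma smap_closed: "p \<le> q \<Longrightarrow> v \<in> carrier (S p) \<Longrightarrow> smap C p q v \<in> carrier (S q)"
  using module_hom_closed[OF smap_hom[of p q]] by blast

lemma smap_id: "v \<in> carrier (S p) \<Longrightarrow> smap C p p v = v"
  using rep[unfolded rep2_def, THEN conjunct2, THEN conjunct2, THEN conjunct1, rule_format] .

lemma smap_comp: "p \<le> q \<Longrightarrow> q \<le> r \<Longrightarrow> v \<in> carrier (S p) \<Longrightarrow> smap C q r (smap C p q v) = smap C p r v"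
  using rep[unfolded rep2_def, THEN conjunct2, THEN conjunct2, THEN conjunct2, rule_format] .

lemma smap_zero: "p \<le> q \<Longrightarrow> smap C p q \<zero>\<^bsub>S p\<^esub> = \<zero>\<^bsub>S q\<^esub>"
  using mod_hom.f0_is_0 lin linear_map.axioms(3) by blast

text \<open>Maps to farther points factor through nearer ones, so kernels grow along a chain of
  targets.\<close>

lemma kernel_flag:
  assumes ge: "\<And>q. q \<in> Q \<Longrightarrow> p \<le> q" and tot: "\<And>q r. q \<in> Q \<Longrightarrow> r \<in> Q \<Longrightarrow> q \<le> r \<or> r \<le> q"
  shows "vectorspace.flag k (S p) (ker p ` Q)"
proof -
  have sub: "subspace k (ker p q) (S p)" if "q \<in> Q" for q
    using linear_map.preimage_subspace[OF lin[OF ge[OF that]] vectorspace.subspace_zero[OF vs]] by simp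
  have mono: "ker p q \<subseteq> ker p r" if "q \<in> Q" "q \<le> r" for q r
    using smap_comp[OF ge[OF that(1)] that(2)] smap_zero[OF that(2)] by (smt (verit) Collect_mono)
  show ?thesis unfolding vectorspace.flag_def[OF vs]
  proof (intro conjI ballI)
    show "subspace k R (S p)" if "R \<in> ker p ` Q" for R using that sub by blast
    fix R R' assume "R \<in> ker p ` Q" "R' \<in> ker p ` Q"
    then obtain q r where qr: "q \<in> Q" "R = ker p q" "r \<in> Q" "R' = ker p r" by blast
    show "R \<subseteq> R' \<or> R' \<subseteq> R"
      using tot[OF qr(1,3)] mono[OF qr(1), of r] mono[OF qr(3), of q] unfolding qr(2,4) by blast
  qed
qed

text \<open>Points on a ray are compared through its origin \<open>p\<close>: injectivity from
  \<open>q\<close> to \<open>r\<close> on surviving images follows from injectivity from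
  \<open>p\<close> to \<open>r\<close> on surviving basis elements.\<close>

lemma ray_basis:
  assumes le: "p \<le> q" "q \<le> r" and B: "vectorspace.basis k (S p) B"
    and ad: "vectorspace.adapted k (S p) B (ker p r)"
  shows "b \<in> smap C p q ` B - {\<zero>\<^bsub>S q\<^esub>} \<Longrightarrow> smap C q r b \<noteq> \<zero>\<^bsub>S r\<^esub> \<Longrightarrow>
      smap C q r b \<in> smap C p r ` B - {\<zero>\<^bsub>S r\<^esub>}"
    and "inj_on (smap C q r) {b \<in> smap C p q ` B - {\<zero>\<^bsub>S q\<^esub>}. smap C q r b \<noteq> \<zero>\<^bsub>S r\<^esub>}"
proof -
  have pr: "p \<le> r" using le by order
  have Bc: "B \<subseteq> carrier (S p)" using B by (simp add: vectorspace.basis_def[OF vs])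
  have c: "smap C q r (smap C p q a) = smap C p r a" if "a \<in> B" for a
    using smap_comp[OF le] Bc that by auto
  show "b \<in> smap C p q ` B - {\<zero>\<^bsub>S q\<^esub>} \<Longrightarrow> smap C q r b \<noteq> \<zero>\<^bsub>S r\<^esub> \<Longrightarrow>
      smap C q r b \<in> smap C p r ` B - {\<zero>\<^bsub>S r\<^esub>}"
    using c by auto
  have inj: "inj_on (smap C p r) {b \<in> B. smap C p r b \<noteq> \<zero>\<^bsub>S r\<^esub>}"
    using linear_map.image_basis(2)[OF lin[OF pr] B ad] .
  show "inj_on (smap C q r) {b \<in> smap C p q ` B - {\<zero>\<^bsub>S q\<^esub>}. smap C q r b \<noteq> \<zero>\<^bsub>S r\<^esub>}"
  proof (rule inj_onI)
    fix b b' assume b: "b \<in> {b \<in> smap C p q ` B - {\<zero>\<^bsub>S q\<^esub>}. smap C q r b \<noteq> \<zero>\<^bsub>S r\<^esub>}"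
      "b' \<in> {b \<in> smap C p q ` B - {\<zero>\<^bsub>S q\<^esub>}. smap C q r b \<noteq> \<zero>\<^bsub>S r\<^esub>}" and eq: "smap C q r b = smap C q r b'"
    then obtain a a' where a: "a \<in> B" "b = smap C p q a" "a' \<in> B" "b' = smap C p q a'" by blast
    have "smap C q r b \<noteq> \<zero>\<^bsub>S r\<^esub>" "smap C q r b' \<noteq> \<zero>\<^bsub>S r\<^esub>" using b by simp_all
    then have "smap C p r a = smap C p r a'" "smap C p r a \<noteq> \<zero>\<^bsub>S r\<^esub>" "smap C p r a' \<noteq> \<zero>\<^bsub>S r\<^esub>"
      using eq unfolding a(2,4) c[OF a(1)] c[OF a(3)] by blast+
    then have "a = a'" using inj_onD[OF inj, of a a'] a(1,3) by simp
    then show "b = b'" using a by simp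
  qed
qed

text \<open>\<open>x\<close> and \<open>y\<close> act on the basis elements as partial injections,
  as in a string module. Steps that leave \<open>P\<close> are unconstrained, so such a basis can be
  built up level by level.\<close>

definition string_basis_on :: "(int \<times> int) set \<Rightarrow> (int \<times> int \<Rightarrow> 'v set) \<Rightarrow> bool" where
  "string_basis_on P B \<longleftrightarrow> (\<forall>p\<in>P. vectorspace.basis k (S p) (B p)) \<and>
    (\<forall>p\<in>P. \<forall>e\<in>{(1,0), (0,1)}. p + e \<in> P \<longrightarrow>
      (\<forall>b\<in>B p. smap C p (p + e) b \<noteq> \<zero>\<^bsub>S (p + e)\<^esub> \<longrightarrow> smap C p (p + e) b \<in> B (p + e)) \<and>
      inj_on (smap C p (p + e)) {b \<in> B p. smap C p (p + e) b \<noteq> \<zero>\<^bsub>S (p + e)\<^esub>})"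

end

text \<open>\<open>D\<close> stands for a strict bound on the absolute levels of the generators:
  beyond it nothing new is born, which is the source of the two surjectivity conditions.
  \<open>D \<ge> 1\<close> keeps the border levels \<open>- D\<close> and \<open>D\<close>
  apart.\<close>

locale xy_null_rep = pfd_rep k C for k :: "('a, 'b) ring_scheme" and C :: "('a, 'v) rep" +
  fixes D :: int
  assumes xy_null: "\<And>p v. v \<in> carrier (S p) \<Longrightarrow> smap C p (p + (1, 1)) v = \<zero>\<^bsub>S (p + (1, 1))\<^esub>"
    and D_pos: "D \<ge> 1"
    and x_surj: "\<And>p. lev p \<ge> D \<Longrightarrow> smap C p (p + (1, 0)) ` carrier (S p) = carrier (S (p + (1, 0)))"
    and y_surj: "\<And>p. lev p \<le> - D \<Longrightarrow> smap C p (p + (0, 1)) ` carrier (S p) = carrier (S (p + (0, 1)))"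
begin

lemma yx_null:
  assumes "v \<in> carrier (S (p - (1, 0)))"
  shows "smap C p (p + (0, 1)) (smap C (p - (1, 0)) p v) = \<zero>\<^bsub>S (p + (0, 1))\<^esub>"
proof -
  have e: "p - (1, 0) + (1, 1) = p + (0, 1)" by (cases p) simp
  have "p - (1, 0) \<le> p" "p \<le> p + (0, 1)" by (cases p; simp)+
  then show ?thesis using xy_null[OF assms] assms unfolding e by (simp add: smap_comp)
qed

lemma xy_null':
  assumes "v \<in> carrier (S (p - (0, 1)))"
  shows "smap C p (p + (1, 0)) (smap C (p - (0, 1)) p v) = \<zero>\<^bsub>S (p + (1, 0))\<^esub>"
proof -
  have e: "p - (0, 1) + (1, 1) = p + (1, 0)" by (cases p) simp
  have "p - (0, 1) \<le> p" "p \<le> p + (1, 0)" by (cases p; simp)+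
  then show ?thesis using xy_null[OF assms] assms unfolding e by (simp add: smap_comp)
qed

section \<open>The sweep through a bounded range of levels\<close>

definition window :: "nat \<Rightarrow> (int \<times> int) set" where
  "window n = {p. - D \<le> lev p \<and> lev p \<le> - D + int n}"

text \<open>The induction lets \<open>\<R>\<close> vary, because the step replaces it by other
  flags. \<open>\<L>\<close> concerns only the first level, whose bases the step leaves alone. For
  \<open>n = 0\<close> both fall on the same level, and two flags have to be served at once.\<close>

lemma window_basis:
  assumes flL: "\<And>p. vectorspace.flag k (S p) (\<L> p)"
  shows "(\<And>p. vectorspace.flag k (S p) (\<R> p)) \<Longrightarrow> \<exists>B. string_basis_on (window n) B \<and>
    (\<forall>p. lev p = - D + int n \<longrightarrow> (\<forall>R\<in>\<R> p. vectorspace.adapted k (S p) (B p) R)) \<and>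
    (\<forall>p. lev p = - D \<longrightarrow> (\<forall>R\<in>\<L> p. vectorspace.adapted k (S p) (B p) R))"
proof (induction n arbitrary: \<R>)
  case 0
  have "\<exists>B. vectorspace.basis k (S p) B \<and> (\<forall>R\<in>\<R> p \<union> \<L> p. vectorspace.adapted k (S p) B R)" for p
  proof (rule vectorspace.adapted_to_two_flags[OF vs fd 0[of p] flL[of p]])
    fix B assume "vectorspace.basis k (S p) B" "\<forall>R\<in>\<R> p \<union> \<L> p. vectorspace.adapted k (S p) B R"
    then show ?thesis by blast
  qed
  then obtain B where B: "\<And>p. vectorspace.basis k (S p) (B p)"
      "\<And>p R. R \<in> \<R> p \<union> \<L> p \<Longrightarrow> vectorspace.adapted k (S p) (B p) R"
    by metis
  have "string_basis_on (window 0) B"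
    unfolding string_basis_on_def window_def using B(1) by auto
  then show ?case using B(2) by blast
next
  case (Suc n)
  \<comment> \<open>The flags requested one level below. Adding zero yields the kernel of
    \<open>x\<close>, adding the whole space yields the image of \<open>y\<close>: the two further
    conditions of \<open>adapted_basis_step\<close>.\<close>
  define \<Q> where "\<Q> p = (\<lambda>R. {v \<in> carrier (S p). smap C p (p + (1,0)) v \<in> R}) ` insert {\<zero>\<^bsub>S (p + (1,0))\<^esub>} (\<R> (p + (1,0)))
    \<union> (\<lambda>R. smap C (p - (0,1)) p ` R) ` insert (carrier (S (p - (0,1)))) (\<R> (p - (0,1)))" for p
  have le: "p - (1,0) \<le> p" "p - (0,1) \<le> p" "p \<le> p + (0,1)" "p \<le> p + (1,0)" for p :: "int \<times> int"
    by (cases p; simp)+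
  have "vectorspace.flag k (S p) (\<Q> p)" for p
    unfolding \<Q>_def
    by (rule flag_preimage_image[OF lin[OF le(2)] lin[OF le(4)] xy_null'])
      (auto intro!: vectorspace.flag_insert_zero[OF vs] vectorspace.flag_insert_carrier[OF vs] Suc.prems)
  from Suc.IH[OF this] obtain B where B: "string_basis_on (window n) B"
    "\<forall>p. lev p = - D + int n \<longrightarrow> (\<forall>R\<in>\<Q> p. vectorspace.adapted k (S p) (B p) R)"
    "\<forall>p. lev p = - D \<longrightarrow> (\<forall>R\<in>\<L> p. vectorspace.adapted k (S p) (B p) R)" by blast
  then have adB: "vectorspace.adapted k (S p) (B p) R" if "lev p = - D + int n" "R \<in> \<Q> p" for p R
    using that by blast
  \<comment> \<open>The neighbours \<open>p - (1,0)\<close> and \<open>p + (0,1)\<close> both lie on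
    the level below. Neither \<open>x\<close> nor \<open>y\<close> joins two points of the new
    level, so the new bases can be chosen point by point.\<close>
  define good where "good p B' \<longleftrightarrow> vectorspace.basis k (S p) B' \<and> (\<forall>R\<in>\<R> p. vectorspace.adapted k (S p) B' R) \<and>
    (\<forall>b\<in>B (p - (1,0)). smap C (p - (1,0)) p b \<noteq> \<zero>\<^bsub>S p\<^esub> \<longrightarrow> smap C (p - (1,0)) p b \<in> B') \<and>
    inj_on (smap C (p - (1,0)) p) {b \<in> B (p - (1,0)). smap C (p - (1,0)) p b \<noteq> \<zero>\<^bsub>S p\<^esub>} \<and>
    (\<forall>b\<in>B'. smap C p (p + (0,1)) b \<noteq> \<zero>\<^bsub>S (p + (0,1))\<^esub> \<longrightarrow> smap C p (p + (0,1)) b \<in> B (p + (0,1))) \<and>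
    inj_on (smap C p (p + (0,1))) {b \<in> B'. smap C p (p + (0,1)) b \<noteq> \<zero>\<^bsub>S (p + (0,1))\<^esub>}" for p B'
  have "\<exists>B'. good p B'" if p: "lev p = - D + int (Suc n)" for p
  proof -
    let ?l = "p - (1,0)" and ?u = "p + (0,1)"
    have lev: "lev ?l = - D + int n" "lev ?u = - D + int n" using p by auto
    have e: "?l + (1,0) = p" "?u - (0,1) = p" by simp_all
    have win: "?l \<in> window n" "?u \<in> window n" using lev by (auto simp: window_def)
    have Ql: "{v \<in> carrier (S ?l). smap C ?l p v \<in> R} \<in> \<Q> ?l" if "R = {\<zero>\<^bsub>S p\<^esub>} \<or> R \<in> \<R> p" for R
      using that unfolding \<Q>_def e by blast
    have Qu: "smap C p ?u ` R \<in> \<Q> ?u" if "R = carrier (S p) \<or> R \<in> \<R> p" for R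
      using that unfolding \<Q>_def e by blast
    have b: "vectorspace.basis k (S ?l) (B ?l)" "vectorspace.basis k (S ?u) (B ?u)"
      using B(1) win by (auto simp: string_basis_on_def)
    have a1: "vectorspace.adapted k (S ?l) (B ?l) {v \<in> carrier (S ?l). smap C ?l p v = \<zero>\<^bsub>S p\<^esub>}"
      using adB[OF lev(1) Ql[of "{\<zero>\<^bsub>S p\<^esub>}"]] by simp
    have a2: "vectorspace.adapted k (S ?l) (B ?l) {v \<in> carrier (S ?l). smap C ?l p v \<in> R}" if "R \<in> \<R> p" for R
      using adB[OF lev(1) Ql] that by blast
    have a3: "vectorspace.adapted k (S ?u) (B ?u) (smap C p ?u ` carrier (S p))"
      using adB[OF lev(2) Qu] by blast
    have a4: "vectorspace.adapted k (S ?u) (B ?u) (smap C p ?u ` R)" if "R \<in> \<R> p" for R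
      using adB[OF lev(2) Qu] that by blast
    show ?thesis
    proof (rule adapted_basis_step[OF lin[OF le(1)] lin[OF le(3)] yx_null fd Suc.prems b(1) a1 a2 b(2) a3 a4])
      fix B' assume "vectorspace.basis k (S p) B'" "\<And>R. R \<in> \<R> p \<Longrightarrow> vectorspace.adapted k (S p) B' R"
        "\<And>b. b \<in> B ?l \<Longrightarrow> smap C ?l p b \<noteq> \<zero>\<^bsub>S p\<^esub> \<Longrightarrow> smap C ?l p b \<in> B'"
        "inj_on (smap C ?l p) {b \<in> B ?l. smap C ?l p b \<noteq> \<zero>\<^bsub>S p\<^esub>}"
        "\<And>b. b \<in> B' \<Longrightarrow> smap C p ?u b \<noteq> \<zero>\<^bsub>S ?u\<^esub> \<Longrightarrow> smap C p ?u b \<in> B ?u"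
        "inj_on (smap C p ?u) {b \<in> B'. smap C p ?u b \<noteq> \<zero>\<^bsub>S ?u\<^esub>}"
      then have "good p B'" unfolding good_def by simp
      then show ?thesis by blast
    qed
  qed
  then obtain N where N: "\<And>p. lev p = - D + int (Suc n) \<Longrightarrow> good p (N p)" by metis
  define B' where "B' p = (if lev p = - D + int (Suc n) then N p else B p)" for p
  have sb: "string_basis_on (window (Suc n)) B'"
    unfolding string_basis_on_def
  proof (intro conjI ballI impI)
    fix p assume p: "p \<in> window (Suc n)"
    show "vectorspace.basis k (S p) (B' p)"
    proof (cases "lev p = - D + int (Suc n)")
      case True
      then show ?thesis using N[OF True] by (simp add: B'_def good_def)
    next
      case False
      then have "p \<in> window n" using p by (auto simp: window_def)
      then show ?thesis using B(1) False by (simp add: B'_def string_basis_on_def)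
    qed
    fix e :: "int \<times> int" assume e: "e \<in> {(1,0), (0,1)}" and pe: "p + e \<in> window (Suc n)"
    have "(\<forall>b\<in>B' p. smap C p (p + e) b \<noteq> \<zero>\<^bsub>S (p + e)\<^esub> \<longrightarrow> smap C p (p + e) b \<in> B' (p + e)) \<and>
      inj_on (smap C p (p + e)) {b \<in> B' p. smap C p (p + e) b \<noteq> \<zero>\<^bsub>S (p + e)\<^esub>}"
    proof (cases "p \<in> window n \<and> p + e \<in> window n")
      case True
      have B'B: "B' q = B q" if "q \<in> window n" for q using that by (simp add: B'_def window_def)
      show ?thesis
        unfolding B'B[OF conjunct1[OF True]] B'B[OF conjunct2[OF True]]
        using B(1) True e unfolding string_basis_on_def by blast
    next
      \<comment> \<open>A step outside the old window has exactly one end on the new level: the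
        target for \<open>x\<close>, the source for \<open>y\<close>.\<close>
      case False
      from e consider (1) "e = (1,0)" | (2) "e = (0,1)" by blast
      then show ?thesis
      proof cases
        case e: 1
        have "lev (p + e) = - D + int (Suc n)" using e p pe False by (auto simp: window_def)
        note 1 = e this
        have "B' (p + e) = N (p + e)" using 1(2) unfolding B'_def by (rule if_P)
        moreover have "B' p = B p" using 1 by (auto simp: B'_def)
        moreover have "p + e - (1,0) = p" using 1 by simp
        ultimately show ?thesis using N[OF 1(2)] 1(1) unfolding good_def by simp
      next
        case e: 2
        have "lev p = - D + int (Suc n)" using e p pe False by (auto simp: window_def)
        note 2 = e this
        have "B' p = N p" using 2(2) unfolding B'_def by (rule if_P)
        moreover have "B' (p + e) = B (p + e)" using 2 by (auto simp: B'_def)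
        ultimately show ?thesis using N[OF 2(2)] 2(1) unfolding good_def by simp
      qed
    qed
    then show "inj_on (smap C p (p + e)) {b \<in> B' p. smap C p (p + e) b \<noteq> \<zero>\<^bsub>S (p + e)\<^esub>}"
      and "\<And>b. b \<in> B' p \<Longrightarrow> smap C p (p + e) b \<noteq> \<zero>\<^bsub>S (p + e)\<^esub> \<Longrightarrow> smap C p (p + e) b \<in> B' (p + e)"
      by blast+
  qed
  have ad1: "vectorspace.adapted k (S p) (B' p) R" if "lev p = - D + int (Suc n)" "R \<in> \<R> p" for p R
    using N[OF that(1)] that by (simp add: B'_def good_def)
  have ad2: "vectorspace.adapted k (S p) (B' p) R" if "lev p = - D" "R \<in> \<L> p" for p R
    using B(3) that by (simp add: B'_def)
  show ?case using sb ad1 ad2 by (intro exI[of _ B'] conjI allI impI ballI)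
qed

lemma x_surj_iter:
  "lev p \<ge> D \<Longrightarrow> smap C p (p + (int m, 0)) ` carrier (S p) = carrier (S (p + (int m, 0)))"
proof (induction m)
  case 0
  have [simp]: "p + (0, 0) = p" by (cases p) simp
  show ?case by (simp add: smap_id)
next
  case (Suc m)
  let ?q = "p + (int m, 0)"
  have e: "?q + (1, 0) = p + (int (Suc m), 0)" by (cases p) simp
  have le: "p \<le> ?q" "?q \<le> p + (int (Suc m), 0)" by (cases p; simp)+
  have "smap C p (p + (int (Suc m), 0)) ` carrier (S p) = smap C ?q (p + (int (Suc m), 0)) ` smap C p ?q ` carrier (S p)"
    using smap_comp[OF le] by (simp add: image_image)
  then show ?case using Suc x_surj[of ?q] unfolding e by simp
qed

lemma y_surj_iter:
  "lev p \<le> - D \<Longrightarrow> smap C p (p + (0, int m)) ` carrier (S p) = carrier (S (p + (0, int m)))"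
proof (induction m)
  case 0
  have [simp]: "p + (0, 0) = p" by (cases p) simp
  show ?case by (simp add: smap_id)
next
  case (Suc m)
  let ?q = "p + (0, int m)"
  have e: "?q + (0, 1) = p + (0, int (Suc m))" by (cases p) simp
  have le: "p \<le> ?q" "?q \<le> p + (0, int (Suc m))" by (cases p; simp)+
  have "smap C p (p + (0, int (Suc m))) ` carrier (S p) = smap C ?q (p + (0, int (Suc m))) ` smap C p ?q ` carrier (S p)"
    using smap_comp[OF le] by (simp add: image_image)
  then show ?case using Suc y_surj[of ?q] unfolding e by simp
qed

end

section \<open>Extension to the whole plane along rays\<close>

context xy_null_rep begin

lemma string_basis_exists: "\<exists>B. string_basis_on UNIV B"
proof -
  \<comment> \<open>\<open>r p\<close> is the point of level \<open>D\<close> in the row of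
    \<open>p\<close>, and \<open>u p\<close> is the point of level \<open>- D\<close> in its column:
    the origins of the rays.\<close>
  define r where "r p = p - (lev p - D, 0)" for p :: "int \<times> int"
  define u where "u p = p - (0, - D - lev p)" for p :: "int \<times> int"
  have lev_r: "lev (r p) = D" and lev_u: "lev (u p) = - D" for p by (simp_all add: r_def u_def)
  have r_le: "r p \<le> p" if "lev p \<ge> D" for p using that by (cases p) (simp add: r_def)
  have u_le: "u p \<le> p" if "lev p \<le> - D" for p using that by (cases p) (simp add: u_def)
  have r_step: "r (p + (1,0)) = r p" and u_step: "u (p + (0,1)) = u p" for p
    by (cases p; simp add: r_def u_def)+
  have r_eq: "p = r p + (int (nat (lev p - D)), 0)" if "lev p \<ge> D" for p
    using that by (cases p) (simp add: r_def)
  have u_eq: "p = u p + (0, int (nat (- D - lev p)))" if "lev p \<le> - D" for p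
    using that by (cases p) (simp add: u_def)
  \<comment> \<open>Adaptedness to the kernels of the maps to all points of a ray lets one basis at
    its origin serve the whole ray.\<close>
  define R where "R p = ker p ` range (\<lambda>m. p + (int m, 0))" for p
  define L where "L p = ker p ` range (\<lambda>m. p + (0, int m))" for p
  have flR: "vectorspace.flag k (S p) (R p)" for p
    unfolding R_def
  proof (rule kernel_flag)
    show "p \<le> q" if "q \<in> range (\<lambda>m. p + (int m, 0))" for q using that by (cases p) auto
    fix q q' assume "q \<in> range (\<lambda>m. p + (int m, 0))" "q' \<in> range (\<lambda>m. p + (int m, 0))"
    then obtain m m' where "q = p + (int m, 0)" "q' = p + (int m', 0)" by blast
    then show "q \<le> q' \<or> q' \<le> q" by (cases p) auto
  qed
  have flL: "vectorspace.flag k (S p) (L p)" for p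
    unfolding L_def
  proof (rule kernel_flag)
    show "p \<le> q" if "q \<in> range (\<lambda>m. p + (0, int m))" for q using that by (cases p) auto
    fix q q' assume "q \<in> range (\<lambda>m. p + (0, int m))" "q' \<in> range (\<lambda>m. p + (0, int m))"
    then obtain m m' where "q = p + (0, int m)" "q' = p + (0, int m')" by blast
    then show "q \<le> q' \<or> q' \<le> q" by (cases p) auto
  qed
  \<comment> \<open>With this length the window reaches exactly from level \<open>- D\<close> to
    level \<open>D\<close>.\<close>
  define n where "n = nat (2 * D)"
  have n: "- D + int n = D" using D_pos by (simp add: n_def)
  obtain B where B: "string_basis_on (window n) B"
    and adR: "\<forall>p. lev p = D \<longrightarrow> (\<forall>A\<in>R p. vectorspace.adapted k (S p) (B p) A)"
    and adL: "\<forall>p. lev p = - D \<longrightarrow> (\<forall>A\<in>L p. vectorspace.adapted k (S p) (B p) A)"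
    using window_basis[OF flL flR, of n] unfolding n by (elim exE conjE)
  have win: "p \<in> window n \<longleftrightarrow> - D \<le> lev p \<and> lev p \<le> D" for p using n by (simp add: window_def)
  have basB: "vectorspace.basis k (S p) (B p)" if "p \<in> window n" for p
    using B that by (simp add: string_basis_on_def)
  have stepB: "(\<forall>b\<in>B p. smap C p (p + e) b \<noteq> \<zero>\<^bsub>S (p + e)\<^esub> \<longrightarrow> smap C p (p + e) b \<in> B (p + e)) \<and>
      inj_on (smap C p (p + e)) {b \<in> B p. smap C p (p + e) b \<noteq> \<zero>\<^bsub>S (p + e)\<^esub>}"
    if "p \<in> window n" "p + e \<in> window n" "e = (1,0) \<or> e = (0,1)" for p e
    using B that unfolding string_basis_on_def by blast
  have r_win: "r p \<in> window n" and u_win: "u p \<in> window n" for p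
    using lev_r[of p] lev_u[of p] D_pos by (simp_all add: win)
  have adr: "vectorspace.adapted k (S (r p)) (B (r p)) (ker (r p) p)" if "lev p \<ge> D" for p
  proof -
    have "ker (r p) p \<in> R (r p)" unfolding R_def using r_eq[OF that] by blast
    then show ?thesis using adR lev_r[of p] by blast
  qed
  have adu: "vectorspace.adapted k (S (u p)) (B (u p)) (ker (u p) p)" if "lev p \<le> - D" for p
  proof -
    have "ker (u p) p \<in> L (u p)" unfolding L_def using u_eq[OF that] by blast
    then show ?thesis using adL lev_u[of p] by blast
  qed
  define N where "N p = (if lev p \<ge> D then smap C (r p) p ` B (r p) - {\<zero>\<^bsub>S p\<^esub>}
     else if lev p \<le> - D then smap C (u p) p ` B (u p) - {\<zero>\<^bsub>S p\<^esub>} else B p)" for p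
  have N_r: "N p = smap C (r p) p ` B (r p) - {\<zero>\<^bsub>S p\<^esub>}" if "lev p \<ge> D" for p using that by (simp add: N_def)
  have N_u: "N p = smap C (u p) p ` B (u p) - {\<zero>\<^bsub>S p\<^esub>}" if "lev p \<le> - D" for p
    using that D_pos by (simp add: N_def)
  have id_image: "smap C p p ` B p - {\<zero>\<^bsub>S p\<^esub>} = B p" if "p \<in> window n" for p
  proof -
    have bb: "B p \<subseteq> carrier (S p)" "module.lin_indpt k (S p) (B p)"
      using basB[OF that] by (simp_all add: vectorspace.basis_def[OF vs])
    then have "smap C p p ` B p = (\<lambda>b. b) ` B p" using smap_id by (intro image_cong refl) blast
    then have "smap C p p ` B p = B p" by simp
    then show ?thesis using vectorspace.vs_zero_lin_dep[OF vs bb] by simp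
  qed
  \<comment> \<open>On the border levels the pushed basis and the window basis agree, because the
    map from a point to itself is the identity.\<close>
  have N_win: "N p = B p" if "p \<in> window n" for p
  proof -
    have z: "p - (0, 0) = p" by (cases p) simp
    have "- D \<le> lev p \<and> lev p \<le> D" using that win by simp
    then consider "lev p = D" | "lev p = - D" | "\<not> lev p \<ge> D" "\<not> lev p \<le> - D" by linarith
    then show ?thesis
    proof cases
      case 1
      then have "r p = p" using z by (simp add: r_def)
      then show ?thesis using N_r[of p] id_image[OF that] 1 by simp
    next
      case 2
      then have "u p = p" using z by (simp add: u_def)
      then show ?thesis using N_u[of p] id_image[OF that] 2 by simp
    next
      case 3
      then show ?thesis by (simp add: N_def)
    qed
  qed
  have basN: "vectorspace.basis k (S p) (N p)" for p
  proof -
    consider "lev p \<ge> D" | "lev p \<le> - D" | "p \<in> window n" unfolding win by linarith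
    then show ?thesis
    proof cases
      case 1
      have "smap C (r p) p ` carrier (S (r p)) = carrier (S p)"
        using x_surj_iter[of "r p" "nat (lev p - D)"] lev_r[of p] unfolding r_eq[OF 1, symmetric] by simp
      then show ?thesis
        using linear_map.image_basis(1)[OF lin[OF r_le[OF 1]] basB[OF r_win] adr[OF 1]]
        unfolding N_r[OF 1] by (simp add: vectorspace.basis_of_carrier[OF vs])
    next
      case 2
      have "smap C (u p) p ` carrier (S (u p)) = carrier (S p)"
        using y_surj_iter[of "u p" "nat (- D - lev p)"] lev_u[of p] unfolding u_eq[OF 2, symmetric] by simp
      then show ?thesis
        using linear_map.image_basis(1)[OF lin[OF u_le[OF 2]] basB[OF u_win] adu[OF 2]]
        unfolding N_u[OF 2] by (simp add: vectorspace.basis_of_carrier[OF vs])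
    next
      case 3
      then show ?thesis using basB N_win by simp
    qed
  qed
  have Nc: "b \<in> carrier (S p)" if "b \<in> N p" for p b
    using basN[of p] that by (auto simp: vectorspace.basis_def[OF vs])
  have x_step: "(\<forall>b\<in>N p. smap C p (p + (1,0)) b \<noteq> \<zero>\<^bsub>S (p + (1,0))\<^esub> \<longrightarrow> smap C p (p + (1,0)) b \<in> N (p + (1,0))) \<and>
      inj_on (smap C p (p + (1,0))) {b \<in> N p. smap C p (p + (1,0)) b \<noteq> \<zero>\<^bsub>S (p + (1,0))\<^esub>}" for p
  proof -
    consider "lev p \<ge> D" | "- D \<le> lev p" "lev p < D" | "lev p < - D" by linarith
    then show ?thesis
    proof cases
      case 1
      have le: "p \<le> p + (1,0)" by (cases p) simp
      have 2: "lev (p + (1,0)) \<ge> D" using 1 by simp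
      note ray = ray_basis[OF r_le[OF 1] le basB[OF r_win] adr[OF 2, unfolded r_step]]
      show ?thesis unfolding N_r[OF 1] N_r[OF 2] r_step using ray by blast
    next
      case 2
      then have w: "p \<in> window n" "p + (1,0) \<in> window n" by (simp_all add: win)
      show ?thesis unfolding N_win[OF w(1)] N_win[OF w(2)] using stepB[OF w] by blast
    next
      case 3
      \<comment> \<open>Below level \<open>- D\<close> every element is a \<open>y\<close>-image, so
        \<open>x\<close> kills it. The case of \<open>y\<close> above level \<open>D\<close> is
        symmetric.\<close>
      have "smap C p (p + (1,0)) b = \<zero>\<^bsub>S (p + (1,0))\<^esub>" if bN: "b \<in> N p" for b
      proof -
        have "smap C (p - (0,1)) p ` carrier (S (p - (0,1))) = carrier (S p)"
          using y_surj[of "p - (0,1)"] 3 by simp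
        then obtain a where "a \<in> carrier (S (p - (0,1)))" "b = smap C (p - (0,1)) p a" using Nc[OF bN] by blast
        then show ?thesis using xy_null' by simp
      qed
      then have "{b \<in> N p. smap C p (p + (1,0)) b \<noteq> \<zero>\<^bsub>S (p + (1,0))\<^esub>} = {}" by blast
      then show ?thesis by (metis (mono_tags, lifting) empty_iff inj_on_empty mem_Collect_eq)
    qed
  qed
  have y_step: "(\<forall>b\<in>N p. smap C p (p + (0,1)) b \<noteq> \<zero>\<^bsub>S (p + (0,1))\<^esub> \<longrightarrow> smap C p (p + (0,1)) b \<in> N (p + (0,1))) \<and>
      inj_on (smap C p (p + (0,1))) {b \<in> N p. smap C p (p + (0,1)) b \<noteq> \<zero>\<^bsub>S (p + (0,1))\<^esub>}" for p
  proof -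
    consider "lev p \<le> - D" | "- D < lev p" "lev p \<le> D" | "lev p > D" by linarith
    then show ?thesis
    proof cases
      case 1
      have le: "p \<le> p + (0,1)" by (cases p) simp
      have 2: "lev (p + (0,1)) \<le> - D" using 1 by simp
      note ray = ray_basis[OF u_le[OF 1] le basB[OF u_win] adu[OF 2, unfolded u_step]]
      show ?thesis unfolding N_u[OF 1] N_u[OF 2] u_step using ray by blast
    next
      case 2
      then have w: "p \<in> window n" "p + (0,1) \<in> window n" by (simp_all add: win)
      show ?thesis unfolding N_win[OF w(1)] N_win[OF w(2)] using stepB[OF w] by blast
    next
      case 3
      have "smap C p (p + (0,1)) b = \<zero>\<^bsub>S (p + (0,1))\<^esub>" if bN: "b \<in> N p" for b
      proof -
        have "smap C (p - (1,0)) p ` carrier (S (p - (1,0))) = carrier (S p)"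
          using x_surj[of "p - (1,0)"] 3 by simp
        then obtain a where "a \<in> carrier (S (p - (1,0)))" "b = smap C (p - (1,0)) p a" using Nc[OF bN] by blast
        then show ?thesis using yx_null by simp
      qed
      then have "{b \<in> N p. smap C p (p + (0,1)) b \<noteq> \<zero>\<^bsub>S (p + (0,1))\<^esub>} = {}" by blast
      then show ?thesis by (metis (mono_tags, lifting) empty_iff inj_on_empty mem_Collect_eq)
    qed
  qed
  have "string_basis_on UNIV N"
    unfolding string_basis_on_def
  proof (intro conjI ballI impI)
    show "vectorspace.basis k (S p) (N p)" for p by (rule basN)
    fix p e :: "int \<times> int" assume e: "e \<in> {(1,0), (0,1)}"
    have "(\<forall>b\<in>N p. smap C p (p + e) b \<noteq> \<zero>\<^bsub>S (p + e)\<^esub> \<longrightarrow> smap C p (p + e) b \<in> N (p + e)) \<and>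
      inj_on (smap C p (p + e)) {b \<in> N p. smap C p (p + e) b \<noteq> \<zero>\<^bsub>S (p + e)\<^esub>}"
    proof (cases "e = (1,0)")
      case True
      show ?thesis unfolding True by (rule x_step)
    next
      case False
      then have e: "e = (0,1)" using e by blast
      show ?thesis unfolding e by (rule y_step)
    qed
    then show "inj_on (smap C p (p + e)) {b \<in> N p. smap C p (p + e) b \<noteq> \<zero>\<^bsub>S (p + e)\<^esub>}"
      and "\<And>b. b \<in> N p \<Longrightarrow> smap C p (p + e) b \<noteq> \<zero>\<^bsub>S (p + e)\<^esub> \<Longrightarrow> smap C p (p + e) b \<in> N (p + e)"
      by blast+
  qed
  then show ?thesis by blast
qed

end

text \<open>A direct sum decomposition in coordinates: \<open>e j p\<close> is the element of degree
  \<open>p\<close> that corresponds to 1 in the summand of \<open>I j\<close>.\<close>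

definition (in pfd_rep) decomposes ::
  "'j set \<Rightarrow> ('j \<Rightarrow> (int \<times> int) set) \<Rightarrow> ('j \<Rightarrow> int \<times> int \<Rightarrow> 'v) \<Rightarrow> bool" where
  "decomposes J I e \<longleftrightarrow> (\<forall>j\<in>J. spread_curve (I j)) \<and>
    (\<forall>p. inj_on (\<lambda>j. e j p) {j \<in> J. p \<in> I j} \<and>
      vectorspace.basis k (S p) ((\<lambda>j. e j p) ` {j \<in> J. p \<in> I j})) \<and>
    (\<forall>p q. p \<le> q \<longrightarrow> (\<forall>j\<in>J. p \<in> I j \<longrightarrow>
      smap C p q (e j p) = (if q \<in> I j then e j q else \<zero>\<^bsub>S q\<^esub>)))"

section \<open>Components of the graph on basis elements\<close>

locale string_basis = xy_null_rep k C D
  for k :: "('a, 'b) ring_scheme" and C :: "('a, 'v) rep" and D +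
  fixes B :: "int \<times> int \<Rightarrow> 'v set"
  assumes string_basis: "string_basis_on UNIV B"
begin

lemma basis_B: "vectorspace.basis k (S p) (B p)"
  using string_basis by (simp add: string_basis_on_def)

lemma B_carrier: "b \<in> B p \<Longrightarrow> b \<in> carrier (S p)"
  using basis_B[of p] by (auto simp: vectorspace.basis_def[OF vs])

lemma B_nonzero: "b \<in> B p \<Longrightarrow> b \<noteq> \<zero>\<^bsub>S p\<^esub>"
  using vectorspace.vs_zero_lin_dep[OF vs, of "B p" p] basis_B[of p]
  by (auto simp: vectorspace.basis_def[OF vs])

lemma B_step:
  assumes "e = (1,0) \<or> e = (0,1)"
  shows "b \<in> B p \<Longrightarrow> smap C p (p + e) b \<noteq> \<zero>\<^bsub>S (p + e)\<^esub> \<Longrightarrow> smap C p (p + e) b \<in> B (p + e)"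
    and "b \<in> B p \<Longrightarrow> b' \<in> B p \<Longrightarrow> smap C p (p + e) b = smap C p (p + e) b' \<Longrightarrow>
      smap C p (p + e) b \<noteq> \<zero>\<^bsub>S (p + e)\<^esub> \<Longrightarrow> b = b'"
proof -
  have *: "(\<forall>b\<in>B p. smap C p (p + e) b \<noteq> \<zero>\<^bsub>S (p + e)\<^esub> \<longrightarrow> smap C p (p + e) b \<in> B (p + e)) \<and>
      inj_on (smap C p (p + e)) {b \<in> B p. smap C p (p + e) b \<noteq> \<zero>\<^bsub>S (p + e)\<^esub>}"
    using string_basis assms unfolding string_basis_on_def by blast
  then show "b \<in> B p \<Longrightarrow> smap C p (p + e) b \<noteq> \<zero>\<^bsub>S (p + e)\<^esub> \<Longrightarrow> smap C p (p + e) b \<in> B (p + e)" by blast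
  show "b = b'" if h: "b \<in> B p" "b' \<in> B p" "smap C p (p + e) b = smap C p (p + e) b'"
      "smap C p (p + e) b \<noteq> \<zero>\<^bsub>S (p + e)\<^esub>"
    by (rule inj_onD[OF conjunct2[OF *] h(3)]) (use h in simp_all)
qed

text \<open>
  Edges point in the direction of increasing level, that is, along \<open>x\<close> and against \<open>y\<close>; as a
  consequence every basis element has at most one successor and at most one predecessor.
\<close>

definition E :: "(((int \<times> int) \<times> 'v) \<times> ((int \<times> int) \<times> 'v)) set" where
  "E = {(s, t). snd s \<in> B (fst s) \<and> snd t \<in> B (fst t) \<and>
     (fst t = fst s + (1,0) \<and> snd t = smap C (fst s) (fst s + (1,0)) (snd s) \<or>
      fst s = fst t + (0,1) \<and> snd s = smap C (fst t) (fst t + (0,1)) (snd t))}"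

lemma EI_x: "b \<in> B p \<Longrightarrow> smap C p (p + (1,0)) b \<noteq> \<zero>\<^bsub>S (p + (1,0))\<^esub> \<Longrightarrow>
    ((p, b), (p + (1,0), smap C p (p + (1,0)) b)) \<in> E"
  using B_step(1)[of "(1,0)" b p] by (simp add: E_def)

lemma EI_y: "b \<in> B p \<Longrightarrow> smap C p (p + (0,1)) b \<noteq> \<zero>\<^bsub>S (p + (0,1))\<^esub> \<Longrightarrow>
    ((p + (0,1), smap C p (p + (0,1)) b), (p, b)) \<in> E"
  using B_step(1)[of "(0,1)" b p] by (simp add: E_def)

lemma E_cases:
  assumes "(s, t) \<in> E"
  obtains (x) p b where "s = (p, b)" "t = (p + (1,0), smap C p (p + (1,0)) b)" "b \<in> B p"
      "smap C p (p + (1,0)) b \<in> B (p + (1,0))"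
    | (y) p b where "t = (p, b)" "s = (p + (0,1), smap C p (p + (0,1)) b)" "b \<in> B p"
      "smap C p (p + (0,1)) b \<in> B (p + (0,1))"
  using assms unfolding E_def by (cases s; cases t) fastforce

lemma xy_B: "b \<in> B p \<Longrightarrow> smap C (p + (0,1)) (p + (0,1) + (1,0)) (smap C p (p + (0,1)) b) = \<zero>\<^bsub>S (p + (0,1) + (1,0))\<^esub>"
  using xy_null'[of b "p + (0,1)"] B_carrier[of b p] by simp

lemma yx_B: "b \<in> B p \<Longrightarrow> smap C (p + (1,0)) (p + (1,0) + (0,1)) (smap C p (p + (1,0)) b) = \<zero>\<^bsub>S (p + (1,0) + (0,1))\<^esub>"
  using yx_null[of b "p + (1,0)"] B_carrier[of b p] by simp

text \<open>Two outgoing \<open>x\<close>-edges have the same target by definition, two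
  \<open>y\<close>-edges by injectivity of \<open>y\<close> on surviving basis elements. With one
  edge of each kind, \<open>s\<close> would be a \<open>y\<close>-image that \<open>x\<close> does
  not kill.\<close>

lemma E_single_valued: "single_valued E"
proof (rule single_valuedI)
  fix s t t' assume "(s, t) \<in> E" "(s, t') \<in> E"
  from this(1) show "t = t'"
  proof (cases rule: E_cases)
    case st: (x p b)
    from \<open>(s, t') \<in> E\<close> show ?thesis
    proof (cases rule: E_cases)
      case (x p' b')
      then show ?thesis using st by simp
    next
      case (y p' b')
      note eq = trans[OF st(1)[symmetric] y(2)]
      have "p = p' + (0,1)" "b = smap C p' (p' + (0,1)) b'" using eq by (blast elim: Pair_inject)+
      then have "smap C p (p + (1,0)) b = \<zero>\<^bsub>S (p + (1,0))\<^esub>" using xy_B[OF y(3)] by simp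
      then show ?thesis using st(4) B_nonzero by metis
    qed
  next
    case st: (y p b)
    from \<open>(s, t') \<in> E\<close> show ?thesis
    proof (cases rule: E_cases)
      case (x p' b')
      note eq = trans[OF x(1)[symmetric] st(2)]
      have "p' = p + (0,1)" "b' = smap C p (p + (0,1)) b" using eq by (blast elim: Pair_inject)+
      then have "smap C p' (p' + (1,0)) b' = \<zero>\<^bsub>S (p' + (1,0))\<^esub>" using xy_B[OF st(3)] by simp
      then show ?thesis using x(4) B_nonzero by metis
    next
      case (y p' b')
      then have p: "p' = p" using st by simp
      have "smap C p (p + (0,1)) b = smap C p (p + (0,1)) b'" using y(2) st(2) p by simp
      then have "b = b'" using B_step(2)[of "(0,1)" b p b'] st(3) y(3) B_nonzero[OF st(4)] p by simp
      then show ?thesis using st y p by simp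
    qed
  qed
qed

text \<open>Dually, two incoming edges of different kinds would make \<open>t\<close> an
  \<open>x\<close>-image that \<open>y\<close> does not kill.\<close>

lemma E_converse_single_valued: "single_valued (E\<inverse>)"
proof (rule single_valuedI)
  fix t s s' assume "(t, s) \<in> E\<inverse>" "(t, s') \<in> E\<inverse>"
  then have st: "(s, t) \<in> E" and st': "(s', t) \<in> E" by simp_all
  from st show "s = s'"
  proof (cases rule: E_cases)
    case st: (x p b)
    from st' show ?thesis
    proof (cases rule: E_cases)
      case (x p' b')
      then have p: "p' = p" using st by simp
      have "smap C p (p + (1,0)) b = smap C p (p + (1,0)) b'" using x(2) st(2) p by simp
      then have "b = b'" using B_step(2)[of "(1,0)" b p b'] st(3) x(3) B_nonzero[OF st(4)] p by simp
      then show ?thesis using st x p by simp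
    next
      case (y p' b')
      note eq = trans[OF y(1)[symmetric] st(2)]
      have "p' = p + (1,0)" "b' = smap C p (p + (1,0)) b" using eq by (blast elim: Pair_inject)+
      then have "smap C p' (p' + (0,1)) b' = \<zero>\<^bsub>S (p' + (0,1))\<^esub>" using yx_B[OF st(3)] by simp
      then show ?thesis using y(4) B_nonzero by metis
    qed
  next
    case st: (y p b)
    from st' show ?thesis
    proof (cases rule: E_cases)
      case (x p' b')
      note eq = trans[OF st(1)[symmetric] x(2)]
      have "p = p' + (1,0)" "b = smap C p' (p' + (1,0)) b'" using eq by (blast elim: Pair_inject)+
      then have "smap C p (p + (0,1)) b = \<zero>\<^bsub>S (p + (0,1))\<^esub>" using yx_B[OF x(3)] by simp
      then show ?thesis using st(4) B_nonzero by metis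
    next
      case (y p' b')
      then show ?thesis using st by simp
    qed
  qed
qed

lemma E_pos:
  assumes "(s, t) \<in> E"
  shows "fst t = fst s + (1,0) \<or> fst s = fst t + (0,1)"
  using assms unfolding E_def by blast

text \<open>Every edge goes one step right or one step down, so the level increases strictly along a
  path.\<close>

lemma rtrancl_E_pos:
  assumes "(s, t) \<in> E\<^sup>*"
  shows "fst (fst s) \<le> fst (fst t)" "snd (fst t) \<le> snd (fst s)" "lev (fst s) = lev (fst t) \<Longrightarrow> s = t"
proof -
  have "fst (fst s) \<le> fst (fst t) \<and> snd (fst t) \<le> snd (fst s) \<and> (s = t \<or> lev (fst s) < lev (fst t))"
    using assms
  proof (induction rule: rtrancl_induct)
    case base
    then show ?case by simp
  next
    case (step t u)
    from E_pos[OF step(2)] show ?case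
    proof
      assume "fst u = fst t + (1,0)"
      then have "fst (fst u) = fst (fst t) + 1" "snd (fst u) = snd (fst t)" by simp_all
      then show ?thesis using step(3) by auto
    next
      assume "fst t = fst u + (0,1)"
      then have "fst (fst t) = fst (fst u)" "snd (fst t) = snd (fst u) + 1" by simp_all
      then show ?thesis using step(3) by auto
    qed
  qed
  then show "fst (fst s) \<le> fst (fst t)" "snd (fst t) \<le> snd (fst s)" "lev (fst s) = lev (fst t) \<Longrightarrow> s = t"
    by auto
qed

text \<open>Since the graph is a disjoint union of directed paths, being joined by a directed path
  in one of the two directions is already the relation of lying in the same component.\<close>

definition cls :: "(int \<times> int) \<times> 'v \<Rightarrow> ((int \<times> int) \<times> 'v) set" where
  "cls s = {t. (s, t) \<in> E\<^sup>* \<or> (t, s) \<in> E\<^sup>*}"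

text \<open>Forks, forward or backward, are excluded by single-valuedness in that direction.\<close>

lemma cls_comparable:
  assumes "t \<in> cls s" "u \<in> cls s"
  shows "u \<in> cls t"
proof -
  have out: "(b, c) \<in> E\<^sup>* \<or> (c, b) \<in> E\<^sup>*" if "(a, b) \<in> E\<^sup>*" "(a, c) \<in> E\<^sup>*" for a b c
    using single_valued_confluent[OF E_single_valued that] .
  have inn: "(b, c) \<in> E\<^sup>* \<or> (c, b) \<in> E\<^sup>*" if "(b, a) \<in> E\<^sup>*" "(c, a) \<in> E\<^sup>*" for a b c
    using single_valued_confluent[OF E_converse_single_valued, of a b c] that
    by (auto simp: rtrancl_converse)
  from assms have "((s, t) \<in> E\<^sup>* \<or> (t, s) \<in> E\<^sup>*) \<and> ((s, u) \<in> E\<^sup>* \<or> (u, s) \<in> E\<^sup>*)" by (simp add: cls_def)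
  then show ?thesis
    unfolding cls_def using out[of s t u] inn[of t s u] rtrancl_trans[of t s E u] rtrancl_trans[of u s E t]
    by blast
qed

lemma cls_self: "s \<in> cls s"
  by (simp add: cls_def)

lemma cls_sym: "t \<in> cls s \<Longrightarrow> s \<in> cls t"
  by (auto simp: cls_def)

lemma cls_eq: "t \<in> cls s \<Longrightarrow> cls t = cls s"
  using cls_comparable cls_sym by (metis cls_self subsetI subset_antisym)

lemma cls_B:
  assumes "t \<in> cls s" "snd s \<in> B (fst s)"
  shows "snd t \<in> B (fst t)"
proof -
  have "(s, t) \<in> E\<^sup>* \<or> (t, s) \<in> E\<^sup>*" using assms(1) by (simp add: cls_def)
  then show ?thesis
  proof
    assume "(s, t) \<in> E\<^sup>*"
    then show ?thesis using assms(2) by (cases rule: rtranclE) (auto simp: E_def)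
  next
    assume "(t, s) \<in> E\<^sup>*"
    then show ?thesis using assms(2) by (cases rule: converse_rtranclE) (auto simp: E_def)
  qed
qed

lemma cls_lev_unique:
  assumes "t \<in> cls s" "u \<in> cls s" "lev (fst t) = lev (fst u)"
  shows "t = u"
proof -
  have "(t, u) \<in> E\<^sup>* \<or> (u, t) \<in> E\<^sup>*" using cls_comparable[OF assms(1,2)] by (simp add: cls_def)
  then show ?thesis using rtrancl_E_pos(3)[of t u] rtrancl_E_pos(3)[of u t] assms(3) by auto
qed

text \<open>Serves convexity: a path moves right and down by single steps, so one that ends in its
  starting row never leaves it and visits every point in between.\<close>

lemma horizontal_path:
  assumes "(s, t) \<in> E\<^sup>*" "snd (fst t) = snd (fst s)" "fst (fst s) \<le> i" "i \<le> fst (fst t)"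
  shows "\<exists>v. (s, ((i, snd (fst s)), v)) \<in> E\<^sup>*"
  using assms
proof (induction rule: rtrancl_induct)
  case base
  then have "(i, snd (fst s)) = fst s" by (simp add: prod_eq_iff)
  then show ?case by (metis prod.collapse rtrancl.rtrancl_refl)
next
  case (step t u)
  have t: "snd (fst t) \<le> snd (fst s)" using rtrancl_E_pos(2)[OF step(1)] .
  from E_pos[OF step(2)] have pos: "fst (fst u) \<le> fst (fst t) + 1" "snd (fst u) \<le> snd (fst t)"
    by auto
  then have t': "snd (fst t) = snd (fst s)" using t step(4) by simp
  show ?case
  proof (cases "i \<le> fst (fst t)")
    case True
    then show ?thesis using step(3)[OF t' step(5)] by simp
  next
    case False
    then have "i = fst (fst u)" using pos step(6) by simp
    then have "(i, snd (fst s)) = fst u" using step(4) by (simp add: prod_eq_iff)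
    moreover have "(s, u) \<in> E\<^sup>*" using step(1,2) by simp
    ultimately show ?thesis by (metis prod.collapse)
  qed
qed

lemma vertical_path:
  assumes "(s, t) \<in> E\<^sup>*" "fst (fst t) = fst (fst s)" "snd (fst t) \<le> i" "i \<le> snd (fst s)"
  shows "\<exists>v. (s, ((fst (fst s), i), v)) \<in> E\<^sup>*"
  using assms
proof (induction rule: rtrancl_induct)
  case base
  then have "(fst (fst s), i) = fst s" by (simp add: prod_eq_iff)
  then show ?case by (metis prod.collapse rtrancl.rtrancl_refl)
next
  case (step t u)
  have t: "fst (fst s) \<le> fst (fst t)" using rtrancl_E_pos(1)[OF step(1)] .
  from E_pos[OF step(2)] have pos: "snd (fst t) \<le> snd (fst u) + 1" "fst (fst t) \<le> fst (fst u)"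
    by auto
  then have t': "fst (fst t) = fst (fst s)" using t step(4) by simp
  show ?case
  proof (cases "snd (fst t) \<le> i")
    case True
    then show ?thesis using step(3)[OF t' _ step(6)] by simp
  next
    case False
    then have "i = snd (fst u)" using pos step(5) by simp
    then have "(fst (fst s), i) = fst u" using step(4) by (simp add: prod_eq_iff)
    moreover have "(s, u) \<in> E\<^sup>*" using step(1,2) by simp
    ultimately show ?thesis by (metis prod.collapse)
  qed
qed

text \<open>The ends of an edge have comparable degrees, which gives connectedness. Paths go right
  and down, so two nodes of a component with degrees \<open>p \<le> r\<close> share a row or a
  column, and convexity becomes a statement about straight paths. The diagonal condition holds
  because a component meets each level once.\<close>

lemma spread_curve_cls: "spread_curve (fst ` cls s)"
  unfolding spread_curve_def
proof (intro conjI ballI allI impI)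
  show "fst ` cls s \<noteq> {}" using cls_self by blast
next
  fix p q assume "p \<in> fst ` cls s" "q \<in> fst ` cls s"
  then obtain t u where tu: "t \<in> cls s" "p = fst t" "u \<in> cls s" "q = fst u" by blast
  define P where "P = {(a, b). a \<in> fst ` cls s \<and> b \<in> fst ` cls s \<and> (a \<le> b \<or> b \<le> a)}"
  have symP: "sym P" by (auto simp: P_def sym_def)
  have *: "(fst t, fst u) \<in> P\<^sup>* \<and> u \<in> cls s" if "(t, u) \<in> E\<^sup>*" "t \<in> cls s" for t u
    using that
  proof (induction rule: rtrancl_induct)
    case base
    then show ?case by simp
  next
    case (step u w)
    have u: "u \<in> cls s" using step by simp
    have "w \<in> cls u" using step(2) by (auto simp: cls_def)
    then have w: "w \<in> cls s" using cls_eq[OF u] by simp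
    have "fst u \<le> fst w \<or> fst w \<le> fst u"
      using E_pos[OF step(2)] by (auto simp: less_eq_prod_def)
    then have "(fst u, fst w) \<in> P" using u w by (auto simp: P_def)
    then show ?case using step w by (meson rtrancl.rtrancl_into_rtrancl)
  qed
  have "(t, u) \<in> E\<^sup>* \<or> (u, t) \<in> E\<^sup>*" using cls_comparable[OF tu(1,3)] by (simp add: cls_def)
  then have "(p, q) \<in> P\<^sup>*"
  proof
    assume "(t, u) \<in> E\<^sup>*"
    then show ?thesis using *[OF _ tu(1)] tu by simp
  next
    assume "(u, t) \<in> E\<^sup>*"
    then have "(q, p) \<in> P\<^sup>*" using *[OF _ tu(3)] tu by simp
    then show ?thesis using sym_rtrancl[OF symP] by (meson symD)
  qed
  then show "(p, q) \<in> {(a, b). a \<in> fst ` cls s \<and> b \<in> fst ` cls s \<and> (a \<le> b \<or> b \<le> a)}\<^sup>*"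
    unfolding P_def .
next
  fix p r q assume "p \<in> fst ` cls s" "r \<in> fst ` cls s" and le: "p \<le> q" "q \<le> r"
  then obtain t u where tu: "t \<in> cls s" "p = fst t" "u \<in> cls s" "r = fst u" by blast
  have le': "fst (fst t) \<le> fst q" "snd (fst t) \<le> snd q" "fst q \<le> fst (fst u)" "snd q \<le> snd (fst u)"
    using le tu by (simp_all add: less_eq_prod_def)
  have "(t, u) \<in> E\<^sup>* \<or> (u, t) \<in> E\<^sup>*" using cls_comparable[OF tu(1,3)] by (simp add: cls_def)
  then show "q \<in> fst ` cls s"
  proof
    assume tE: "(t, u) \<in> E\<^sup>*"
    have eq: "snd (fst u) = snd (fst t)" "snd q = snd (fst t)" using rtrancl_E_pos(2)[OF tE] le' by simp_all
    obtain v where "(t, ((fst q, snd (fst t)), v)) \<in> E\<^sup>*"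
      using horizontal_path[OF tE eq(1) le'(1,3)] by blast
    then have "(q, v) \<in> cls t" unfolding eq(2)[symmetric] by (simp add: cls_def)
    then have "(q, v) \<in> cls s" using cls_eq[OF tu(1)] by simp
    then show ?thesis by force
  next
    assume uE: "(u, t) \<in> E\<^sup>*"
    have eq: "fst (fst t) = fst (fst u)" "fst q = fst (fst u)" using rtrancl_E_pos(1)[OF uE] le' by simp_all
    obtain v where "(u, ((fst (fst u), snd q), v)) \<in> E\<^sup>*"
      using vertical_path[OF uE eq(1) le'(2,4)] by blast
    then have "(q, v) \<in> cls u" unfolding eq(2)[symmetric] by (simp add: cls_def)
    then have "(q, v) \<in> cls s" using cls_eq[OF tu(3)] by simp
    then show ?thesis by force
  qed
next
  fix p assume "p \<in> fst ` cls s"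
  then obtain t where t: "t \<in> cls s" "p = fst t" by blast
  show "p + (1, 1) \<notin> fst ` cls s"
  proof
    assume "p + (1, 1) \<in> fst ` cls s"
    then obtain u where u: "u \<in> cls s" "p + (1, 1) = fst u" by blast
    have "lev (fst t) = lev (fst u)" unfolding u(2)[symmetric] t(2)[symmetric] by simp
    then have "t = u" using cls_lev_unique[OF t(1) u(1)] by simp
    then have "fst (p + (1, 1)) = fst p" using t(2) u(2) by simp
    then show False by simp
  qed
qed

text \<open>For the second part: each edge raises the level by exactly one, so members of a
  component on consecutive levels are adjacent, and their positions decide whether the edge is an
  \<open>x\<close> or a \<open>y\<close>.\<close>

lemma cls_step:
  assumes e: "e = (1,0) \<or> e = (0,1)" and b: "(p, b) \<in> cls s" "b \<in> B p"
  shows "smap C p (p + e) b \<noteq> \<zero>\<^bsub>S (p + e)\<^esub> \<Longrightarrow> (p + e, smap C p (p + e) b) \<in> cls s"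
    and "(p + e, c) \<in> cls s \<Longrightarrow> smap C p (p + e) b = c"
proof -
  have E_cls: "t \<in> cls s" if "(t', t) \<in> E \<or> (t, t') \<in> E" "t' \<in> cls s" for t t'
  proof -
    have "t \<in> cls t'" using that(1) by (auto simp: cls_def)
    then show ?thesis using cls_eq[OF that(2)] by simp
  qed
  show "(p + e, smap C p (p + e) b) \<in> cls s" if nz: "smap C p (p + e) b \<noteq> \<zero>\<^bsub>S (p + e)\<^esub>"
  proof (cases "e = (1,0)")
    case True
    then show ?thesis using E_cls[OF disjI1[OF EI_x[OF b(2)]] b(1)] nz by simp
  next
    case False
    then have "e = (0,1)" using e by simp
    then show ?thesis using E_cls[OF disjI2[OF EI_y[OF b(2)]] b(1)] nz by simp
  qed
  assume c: "(p + e, c) \<in> cls s"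
  have adj: "(t, u) \<in> E" if tu: "t \<in> cls s" "u \<in> cls s" "lev (fst u) = lev (fst t) + 1" for t u
  proof -
    have "(t, u) \<in> E\<^sup>* \<or> (u, t) \<in> E\<^sup>*" using cls_comparable[OF tu(1,2)] by (simp add: cls_def)
    moreover have "(u, t) \<notin> E\<^sup>*" using rtrancl_E_pos(1,2)[of u t] tu(3) by linarith
    ultimately have "(t, u) \<in> E\<^sup>*" by blast
    then show ?thesis
    proof (cases rule: converse_rtranclE)
      case base
      then show ?thesis using tu(3) by simp
    next
      case (step w)
      have "lev (fst w) = lev (fst t) + 1" using E_pos[OF step(1)]
      proof
        assume h: "fst w = fst t + (1,0)"
        show ?thesis unfolding h by simp
      next
        assume h: "fst t = fst w + (0,1)"
        show ?thesis unfolding h by simp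
      qed
      then have "w = u" using rtrancl_E_pos(3)[OF step(2)] tu(3) by simp
      then show ?thesis using step(1) by simp
    qed
  qed
  show "smap C p (p + e) b = c"
  proof (cases "e = (1,0)")
    case True
    have "((p, b), (p + e, c)) \<in> E" using adj[OF b(1) c] True by simp
    then show ?thesis
    proof (cases rule: E_cases)
      case (x p' b')
      then show ?thesis using True by simp
    next
      case (y p' b')
      then have "p = p + (1,0) + (0,1)" using True by simp
      then have "fst p = fst (p + (1,0) + (0,1))" by (rule arg_cong)
      then show ?thesis by simp
    qed
  next
    case False
    then have e: "e = (0,1)" using e by simp
    have "((p + e, c), (p, b)) \<in> E" using adj[OF c b(1)] e by simp
    then show ?thesis
    proof (cases rule: E_cases)
      case (x p' b')
      then have "p = p + (0,1) + (1,0)" using e by simp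
      then have "fst p = fst (p + (0,1) + (1,0))" by (rule arg_cong)
      then show ?thesis by simp
    next
      case (y p' b')
      then show ?thesis using e by simp
    qed
  qed
qed

definition nodes :: "((int \<times> int) \<times> 'v) set" where
  "nodes = {s. snd s \<in> B (fst s)}"

text \<open>Well defined because a component meets each level, hence each degree, at most
  once.\<close>

definition elt :: "((int \<times> int) \<times> 'v) set \<Rightarrow> int \<times> int \<Rightarrow> 'v" where
  "elt j p = (THE v. (p, v) \<in> j)"

lemma elt_eq:
  assumes "j \<in> cls ` nodes" "(p, v) \<in> j"
  shows "elt j p = v"
proof -
  obtain s where s: "s \<in> nodes" "j = cls s" using assms(1) by blast
  show ?thesis unfolding elt_def
  proof (rule the_equality[where P = "\<lambda>v. (p, v) \<in> j", OF assms(2)])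
    fix w assume "(p, w) \<in> j"
    then have "(p, w) = (p, v)" using cls_lev_unique[of "(p, w)" s "(p, v)"] assms(2) s(2) by simp
    then show "w = v" by simp
  qed
qed

lemma elt_mem:
  assumes "j \<in> cls ` nodes" "p \<in> fst ` j"
  shows "(p, elt j p) \<in> j" "elt j p \<in> B p"
proof -
  obtain v where v: "(p, v) \<in> j" using assms(2) by force
  then show 1: "(p, elt j p) \<in> j" using elt_eq[OF assms(1)] by simp
  obtain s where s: "s \<in> nodes" "j = cls s" using assms(1) by blast
  show "elt j p \<in> B p" using cls_B[of "(p, elt j p)" s] 1 s by (simp add: nodes_def)
qed

lemma decomposes_cls: "decomposes (cls ` nodes) (\<lambda>j. fst ` j) elt"
  unfolding decomposes_def
proof (intro conjI ballI allI impI)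
  show "spread_curve (fst ` j)" if "j \<in> cls ` nodes" for j
    using that spread_curve_cls by blast
next
  fix p
  show "inj_on (\<lambda>j. elt j p) {j \<in> cls ` nodes. p \<in> fst ` j}"
  proof (rule inj_onI)
    fix j j' assume j: "j \<in> {j \<in> cls ` nodes. p \<in> fst ` j}" and j': "j' \<in> {j \<in> cls ` nodes. p \<in> fst ` j}"
      and eq: "elt j p = elt j' p"
    have m: "(p, elt j p) \<in> j" "(p, elt j p) \<in> j'" using elt_mem(1)[of j p] elt_mem(1)[of j' p] j j' eq by simp_all
    obtain s s' where s: "j = cls s" "j' = cls s'" using j j' by blast
    show "j = j'" using cls_eq[of "(p, elt j p)" s] cls_eq[of "(p, elt j p)" s'] m unfolding s by simp
  qed
  have "(\<lambda>j. elt j p) ` {j \<in> cls ` nodes. p \<in> fst ` j} = B p"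
  proof
    show "(\<lambda>j. elt j p) ` {j \<in> cls ` nodes. p \<in> fst ` j} \<subseteq> B p" using elt_mem(2) by blast
    show "B p \<subseteq> (\<lambda>j. elt j p) ` {j \<in> cls ` nodes. p \<in> fst ` j}"
    proof
      fix b assume b: "b \<in> B p"
      have n: "cls (p, b) \<in> cls ` nodes" using b by (simp add: nodes_def)
      have m: "(p, b) \<in> cls (p, b)" by (rule cls_self)
      then have "p \<in> fst ` cls (p, b)" by force
      then show "b \<in> (\<lambda>j. elt j p) ` {j \<in> cls ` nodes. p \<in> fst ` j}"
        using elt_eq[OF n m, symmetric] n by blast
    qed
  qed
  then show "vectorspace.basis k (S p) ((\<lambda>j. elt j p) ` {j \<in> cls ` nodes. p \<in> fst ` j})"
    using basis_B by simp
next
  fix p q :: "int \<times> int" and j assume le: "p \<le> q" and j: "j \<in> cls ` nodes" and p: "p \<in> fst ` j"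
  let ?I = "fst ` j"
  obtain s where s: "j = cls s" using j by blast
  note sc = spread_curve_cls[of s, folded s, unfolded spread_curve_def]
  have conv: "r \<in> ?I" if "r0 \<in> ?I" "r1 \<in> ?I" "r0 \<le> r" "r \<le> r1" for r r0 r1
    using sc[THEN conjunct2, THEN conjunct2, THEN conjunct1, rule_format, OF that(1,2,3,4)] .
  have no11: "r + (1,1) \<notin> ?I" if "r \<in> ?I" for r
    using sc[THEN conjunct2, THEN conjunct2, THEN conjunct2, rule_format, OF that] .
  have one: "smap C r (r + e) (elt j r) = (if r + e \<in> ?I then elt j (r + e) else \<zero>\<^bsub>S (r + e)\<^esub>)"
    if r: "r \<in> ?I" and e: "e = (1,0) \<or> e = (0,1)" for r e
  proof (cases "r + e \<in> ?I")
    case True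
    then show ?thesis
      using cls_step(2)[OF e, of r "elt j r" s "elt j (r + e)"] elt_mem[OF j r] elt_mem[OF j True] s by simp
  next
    case False
    have "(r + e, smap C r (r + e) (elt j r)) \<notin> j" using False by force
    then show ?thesis using cls_step(1)[OF e, of r "elt j r" s] elt_mem[OF j r] s False by auto
  qed
  \<comment> \<open>By convexity a row or column that has left the curve does not return to it, so
    an image that has become zero is the right value from then on.\<close>
  have iter: "smap C p (p + (int m * fst e, int m * snd e)) (elt j p) =
      (if p + (int m * fst e, int m * snd e) \<in> ?I then elt j (p + (int m * fst e, int m * snd e))
       else \<zero>\<^bsub>S (p + (int m * fst e, int m * snd e))\<^esub>)" if e: "e = (1,0) \<or> e = (0,1)" for m e
  proof (induction m)
    case 0
    have z: "p + (0, 0) = p" by (cases p) simp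
    have "elt j p \<in> carrier (S p)" using elt_mem(2)[OF j p] B_carrier by blast
    then show ?case using p by (simp add: z smap_id)
  next
    case (Suc m)
    let ?q = "p + (int m * fst e, int m * snd e)" and ?q' = "p + (int (Suc m) * fst e, int (Suc m) * snd e)"
    have q': "?q' = ?q + e" by (cases p; cases e) (simp add: algebra_simps)
    have le: "p \<le> ?q" "?q \<le> ?q + e" using e by (cases p; auto)+
    have ec: "elt j p \<in> carrier (S p)" using elt_mem(2)[OF j p] B_carrier by blast
    have c: "smap C p ?q' (elt j p) = smap C ?q (?q + e) (smap C p ?q (elt j p))"
      unfolding q' using smap_comp[OF le ec] by simp
    show ?case
    proof (cases "?q \<in> ?I")
      case True
      show ?thesis unfolding c using Suc.IH True one[OF True e] unfolding q' by simp
    next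
      case False
      then have "?q + e \<notin> ?I" using conv[OF p _ le] by blast
      then show ?thesis unfolding c using Suc.IH False smap_zero[OF le(2)] unfolding q' by simp
    qed
  qed
  \<comment> \<open>A point above \<open>p\<close> is in the same row, in the same column, or beyond
    \<open>p + (1,1)\<close>; in the last case the map is zero, and convexity keeps \<open>q\<close>
    out of the curve.\<close>
  have "snd q = snd p \<or> fst q = fst p \<or> p + (1,1) \<le> q" using le by (auto simp: less_eq_prod_def)
  then consider (x) "snd q = snd p" | (y) "fst q = fst p" | (xy) "p + (1,1) \<le> q" by blast
  then show "smap C p q (elt j p) = (if q \<in> ?I then elt j q else \<zero>\<^bsub>S q\<^esub>)"
  proof cases
    case x
    then have "q = p + (int (nat (fst q - fst p)) * fst (1::int, 0::int), int (nat (fst q - fst p)) * snd (1::int, 0::int))"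
      using le by (cases p; cases q) simp
    then show ?thesis using iter[of "(1,0)" "nat (fst q - fst p)"] by metis
  next
    case y
    then have "q = p + (int (nat (snd q - snd p)) * fst (0::int, 1::int), int (nat (snd q - snd p)) * snd (0::int, 1::int))"
      using le by (cases p; cases q) simp
    then show ?thesis using iter[of "(0,1)" "nat (snd q - snd p)"] by metis
  next
    case xy
    have p1: "p \<le> p + (1,1)" by (cases p) simp
    have ec: "elt j p \<in> carrier (S p)" using elt_mem(2)[OF j p] B_carrier by blast
    have "smap C p q (elt j p) = \<zero>\<^bsub>S q\<^esub>"
      using smap_comp[OF p1 xy ec] xy_null[OF ec] smap_zero[OF xy] by simp
    moreover have "q \<notin> ?I" using conv[OF p _ p1 xy] no11[OF p] by blast
    ultimately show ?thesis by simp
  qed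
qed

end

theorem (in xy_null_rep) decomposition_exists:
  "\<exists>(J :: ((int \<times> int) \<times> 'v) set set) I e. decomposes J I e"
proof -
  obtain B where B: "string_basis_on UNIV B" using string_basis_exists by blast
  interpret string_basis k C D B by unfold_locales (rule B)
  show ?thesis using decomposes_cls by blast
qed

section \<open>Coordinates along a decomposition\<close>

context vectorspace begin

definition coord :: "'c set \<Rightarrow> 'c \<Rightarrow> 'c \<Rightarrow> 'a" where
  "coord B v = (THE a. a \<in> B \<rightarrow>\<^sub>E carrier K \<and> lincomb a B = v)"

lemma coord:
  assumes "basis B" "finite B" "v \<in> carrier V"
  shows "coord B v \<in> B \<rightarrow> carrier K" "lincomb (coord B v) B = v"
proof -
  have Bc: "B \<subseteq> carrier V" using assms(1) by (simp add: basis_def)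
  have "\<exists>!a. a \<in> B \<rightarrow>\<^sub>E carrier K \<and> lincomb a B = v"
    using basis_criterion[OF assms(2) Bc] assms(1,3) by blast
  from theI'[OF this] show "coord B v \<in> B \<rightarrow> carrier K" "lincomb (coord B v) B = v"
    unfolding coord_def by (auto simp: PiE_def)
qed

lemma coord_unique:
  assumes "basis B" "finite B" "v \<in> carrier V" "a \<in> B \<rightarrow> carrier K" "lincomb a B = v" "b \<in> B"
  shows "coord B v b = a b"
proof -
  have Bc: "B \<subseteq> carrier V" using assms(1) by (simp add: basis_def)
  have ex: "\<exists>!a. a \<in> B \<rightarrow>\<^sub>E carrier K \<and> lincomb a B = v"
    using basis_criterion[OF assms(2) Bc] assms(1,3) by blast
  have "lincomb (restrict a B) B = lincomb a B"
    by (rule lincomb_cong[OF refl Bc _ assms(4)]) simp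
  then have "restrict a B \<in> B \<rightarrow>\<^sub>E carrier K \<and> lincomb (restrict a B) B = v" using assms(4,5) by auto
  then have "coord B v = restrict a B" unfolding coord_def by (rule the1_equality[where P = "\<lambda>a. a \<in> B \<rightarrow>\<^sub>E carrier K \<and> lincomb a B = v", OF ex])
  then show ?thesis using assms(6) by simp
qed

lemma lincomb_reindex:
  assumes "inj_on f A" "f ` A \<subseteq> carrier V" "a \<in> f ` A \<rightarrow> carrier K"
  shows "lincomb a (f ` A) = (\<Oplus>\<^bsub>V\<^esub> i\<in>A. a (f i) \<odot>\<^bsub>V\<^esub> f i)"
  unfolding lincomb_def
  by (rule M.add.finprod_reindex[OF _ assms(1)]) (use assms(2,3) in auto)

end

lemma (in linear_map) hom_finsum:
  assumes "finite A" "g \<in> A \<rightarrow> carrier V"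
  shows "T (\<Oplus>\<^bsub>V\<^esub> a\<in>A. g a) = (\<Oplus>\<^bsub>W\<^esub> a\<in>A. T (g a))"
  using assms
proof (induction A rule: finite_induct)
  case empty
  then show ?case by simp
next
  case (insert a A)
  have "(\<Oplus>\<^bsub>V\<^esub> a\<in>insert a A. g a) = g a \<oplus>\<^bsub>V\<^esub> (\<Oplus>\<^bsub>V\<^esub> a\<in>A. g a)"
    using insert by (intro V.module.M.finsum_insert) auto
  moreover have "(\<Oplus>\<^bsub>W\<^esub> a\<in>insert a A. T (g a)) = T (g a) \<oplus>\<^bsub>W\<^esub> (\<Oplus>\<^bsub>W\<^esub> a\<in>A. T (g a))"
    using insert by (intro W.module.M.finsum_insert) auto
  moreover have "(\<Oplus>\<^bsub>V\<^esub> a\<in>A. g a) \<in> carrier V" using insert by (intro V.module.M.finsum_closed) auto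
  ultimately show ?case using insert by simp
qed

context pfd_rep begin

text \<open>The isomorphism sends a vector to its coordinates, with zero at the curves that miss its
  degree.\<close>

lemma decomposes_rep_iso:
  fixes J :: "'j set"
  assumes dec: "decomposes J I e"
  shows "rep_iso k C (direct_sum_rep J (\<lambda>j. spread_rep k (I j)))"
proof -
  let ?D = "direct_sum_rep J (\<lambda>j. spread_rep k (I j))"
  define Q where "Q p = {j \<in> J. p \<in> I j}" for p
  define B where "B p = (\<lambda>j. e j p) ` Q p" for p
  have inj: "inj_on (\<lambda>j. e j p) (Q p)" and bas: "vectorspace.basis k (S p) (B p)" for p
    using dec unfolding decomposes_def B_def Q_def by blast+
  have step: "smap C p q (e j p) = (if q \<in> I j then e j q else \<zero>\<^bsub>S q\<^esub>)" if "p \<le> q" "j \<in> Q p" for p q j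
    using dec that unfolding decomposes_def Q_def by blast
  have Bc: "B p \<subseteq> carrier (S p)" and Bi: "module.lin_indpt k (S p) (B p)" for p
    using bas[of p] by (simp_all add: vectorspace.basis_def[OF vs])
  have finB: "finite (B p)" for p by (rule vectorspace.fin_dim_li_fin[OF vs fd Bi Bc])
  have finQ: "finite (Q p)" for p using finB[of p] finite_imageD[OF _ inj] by (simp add: B_def)
  have eB: "e j p \<in> B p" if "j \<in> Q p" for j p using that by (simp add: B_def)
  have ec: "e j p \<in> carrier (S p)" if "j \<in> Q p" for j p using eB[OF that] Bc by blast
  interpret field k using vs[of undefined] by (simp add: vectorspace_def)
  \<comment> \<open>The support is finite even for infinite \<open>J\<close>: by finite dimension
    only finitely many curves pass through \<open>p\<close>.\<close>
  have D_carrier: "u \<in> carrier (Space ?D p) \<longleftrightarrow> u \<in> extensional J \<and>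
      (\<forall>j\<in>J. if p \<in> I j then u j \<in> carrier k else u j = \<zero>\<^bsub>k\<^esub>)" for u p
  proof -
    have "finite {j \<in> J. u j \<noteq> \<zero>\<^bsub>k\<^esub>}" if h: "\<forall>j\<in>J. if p \<in> I j then u j \<in> carrier k else u j = \<zero>\<^bsub>k\<^esub>"
    proof (rule finite_subset[OF _ finQ[of p]])
      show "{j \<in> J. u j \<noteq> \<zero>\<^bsub>k\<^esub>} \<subseteq> Q p" unfolding Q_def using h by (metis (mono_tags, lifting) Collect_mono)
    qed
    then show ?thesis
      by (auto simp: direct_sum_rep_def spread_rep_def PiE_iff split: if_splits)
  qed
  define \<phi> where "\<phi> p v = (\<lambda>j\<in>J. if p \<in> I j then vectorspace.coord k (S p) (B p) v (e j p) else \<zero>\<^bsub>k\<^esub>)" for p v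
  note co = vectorspace.coord[OF vs bas finB]
  note co_unique = vectorspace.coord_unique[OF vs bas finB]
  have \<phi>_val: "\<phi> p v j = vectorspace.coord k (S p) (B p) v (e j p)" if "j \<in> Q p" for p v j
    using that by (simp add: \<phi>_def Q_def)
  have \<phi>_out: "\<phi> p v j = \<zero>\<^bsub>k\<^esub>" if "j \<in> J" "j \<notin> Q p" for p v j
    using that by (simp add: \<phi>_def Q_def)
  have \<phi>_ext: "\<phi> p v \<in> extensional J" for p v by (simp add: \<phi>_def)
  have eqI: "u = w" if "u \<in> extensional J" "w \<in> extensional J" "\<And>j. j \<in> J \<Longrightarrow> u j = w j" for u w :: "'j \<Rightarrow> 'a"
    using extensionalityI[OF that(1,2)] that(3) by blast
  have closed: "\<phi> p v \<in> carrier (Space ?D p)" if "v \<in> carrier (S p)" for p v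
    unfolding D_carrier
  proof (intro conjI ballI)
    fix j assume "j \<in> J"
    then show "if p \<in> I j then \<phi> p v j \<in> carrier k else \<phi> p v j = \<zero>\<^bsub>k\<^esub>"
      using \<phi>_val[of j p v] \<phi>_out[of j p v] co(1)[OF that] eB[of j p] by (auto simp: Q_def)
  qed (rule \<phi>_ext)
  have hom: "\<phi> p \<in> module_hom k (S p) (Space ?D p)" for p
  proof -
    interpret V: vectorspace k "S p" by (rule vs)
    have add: "\<phi> p (v \<oplus>\<^bsub>S p\<^esub> w) = \<phi> p v \<oplus>\<^bsub>Space ?D p\<^esub> \<phi> p w" if vw: "v \<in> carrier (S p)" "w \<in> carrier (S p)" for v w
    proof (rule eqI)
      let ?a = "\<lambda>b. V.coord (B p) v b \<oplus>\<^bsub>k\<^esub> V.coord (B p) w b"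
      have l: "V.lincomb ?a (B p) = v \<oplus>\<^bsub>S p\<^esub> w"
        using V.module.lincomb_sum[OF finB Bc co(1)[OF vw(1)] co(1)[OF vw(2)]] co(2) vw by simp
      have a: "?a \<in> B p \<rightarrow> carrier k" using co(1)[OF vw(1)] co(1)[OF vw(2)] by auto
      have c: "V.coord (B p) (v \<oplus>\<^bsub>S p\<^esub> w) b = ?a b" if "b \<in> B p" for b
        by (rule co_unique[OF _ a l that]) (use vw in simp)
      show "\<phi> p (v \<oplus>\<^bsub>S p\<^esub> w) j = (\<phi> p v \<oplus>\<^bsub>Space ?D p\<^esub> \<phi> p w) j" if j: "j \<in> J" for j
      proof (cases "j \<in> Q p")
        case True
        then show ?thesis using j c[OF eB[OF True]] \<phi>_val[OF True]
          by (simp add: direct_sum_rep_def spread_rep_def)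
      next
        case False
        then show ?thesis using j \<phi>_out[OF j False] by (simp add: direct_sum_rep_def spread_rep_def)
      qed
    qed (simp_all add: \<phi>_ext direct_sum_rep_def)
    have smult: "\<phi> p (r \<odot>\<^bsub>S p\<^esub> v) = r \<odot>\<^bsub>Space ?D p\<^esub> \<phi> p v" if rv: "r \<in> carrier k" "v \<in> carrier (S p)" for r v
    proof (rule eqI)
      let ?a = "\<lambda>b. r \<otimes>\<^bsub>k\<^esub> V.coord (B p) v b"
      have l: "V.lincomb ?a (B p) = r \<odot>\<^bsub>S p\<^esub> v"
        using V.module.lincomb_smult[OF Bc co(1)[OF rv(2)] rv(1)] co(2) rv by simp
      have a: "?a \<in> B p \<rightarrow> carrier k" using co(1)[OF rv(2)] rv(1) by auto
      have c: "V.coord (B p) (r \<odot>\<^bsub>S p\<^esub> v) b = ?a b" if "b \<in> B p" for b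
        by (rule co_unique[OF _ a l that]) (use rv in simp)
      show "\<phi> p (r \<odot>\<^bsub>S p\<^esub> v) j = (r \<odot>\<^bsub>Space ?D p\<^esub> \<phi> p v) j" if j: "j \<in> J" for j
      proof (cases "j \<in> Q p")
        case True
        then show ?thesis using j c[OF eB[OF True]] \<phi>_val[OF True]
          by (simp add: direct_sum_rep_def spread_rep_def)
      next
        case False
        then show ?thesis using j rv(1) \<phi>_out[OF j False] by (simp add: direct_sum_rep_def spread_rep_def)
      qed
    qed (simp_all add: \<phi>_ext direct_sum_rep_def)
    show ?thesis unfolding module_hom_def using closed add smult by blast
  qed
  have bij: "bij_betw (\<phi> p) (carrier (S p)) (carrier (Space ?D p))" for p
  proof -
    interpret V: vectorspace k "S p" by (rule vs)
    show ?thesis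
      unfolding bij_betw_def
    proof
      show "inj_on (\<phi> p) (carrier (S p))"
      proof (rule inj_onI)
        fix v w assume vw: "v \<in> carrier (S p)" "w \<in> carrier (S p)" and eq: "\<phi> p v = \<phi> p w"
        have c: "V.coord (B p) v b = V.coord (B p) w b" if b: "b \<in> B p" for b
        proof -
          obtain j where j: "j \<in> Q p" "b = e j p" using b by (auto simp: B_def)
          have "\<phi> p v j = \<phi> p w j" using eq by simp
          then show ?thesis unfolding \<phi>_val[OF j(1)] j(2) .
        qed
        have "V.lincomb (V.coord (B p) v) (B p) = V.lincomb (V.coord (B p) w) (B p)"
          by (rule V.module.lincomb_cong[OF refl Bc c co(1)[OF vw(2)]])
        then show "v = w" using co(2) vw by simp
      qed
      show "\<phi> p ` carrier (S p) = carrier (Space ?D p)"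
      proof
        show "\<phi> p ` carrier (S p) \<subseteq> carrier (Space ?D p)" using closed by blast
        show "carrier (Space ?D p) \<subseteq> \<phi> p ` carrier (S p)"
        proof
          fix u assume "u \<in> carrier (Space ?D p)"
          then have u: "u \<in> extensional J" and uj: "\<And>j. j \<in> J \<Longrightarrow> if p \<in> I j then u j \<in> carrier k else u j = \<zero>\<^bsub>k\<^esub>"
            unfolding D_carrier by blast+
          define a where "a = u \<circ> the_inv_into (Q p) (\<lambda>j. e j p)"
          have ae: "a (e j p) = u j" if "j \<in> Q p" for j
            using the_inv_into_f_f[OF inj that] by (simp add: a_def)
          have a: "a \<in> B p \<rightarrow> carrier k"
          proof
            fix b assume "b \<in> B p"
            then obtain j where j: "j \<in> Q p" "b = e j p" by (auto simp: B_def)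
            have "u j \<in> carrier k" using uj[of j] j(1) by (simp add: Q_def)
            then show "a b \<in> carrier k" using ae[OF j(1)] j(2) by simp
          qed
          define v where "v = V.lincomb a (B p)"
          have v: "v \<in> carrier (S p)" unfolding v_def by (rule V.module.lincomb_closed[OF Bc a])
          have "\<phi> p v = u"
          proof (rule eqI)
            show "u \<in> extensional J" by (rule u)
            fix j assume j: "j \<in> J"
            show "\<phi> p v j = u j"
            proof (cases "j \<in> Q p")
              case True
              then show ?thesis
                using \<phi>_val[OF True] co_unique[OF v a v_def[symmetric] eB[OF True]] ae[OF True] by simp
            next
              case False
              then have "u j = \<zero>\<^bsub>k\<^esub>" using uj[OF j] j by (simp add: Q_def)
              then show ?thesis using \<phi>_out[OF j False] by simp
            qed
          qed (rule \<phi>_ext)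
          then show "u \<in> \<phi> p ` carrier (S p)" using v by blast
        qed
      qed
    qed
  qed
  have comm: "\<phi> q (smap C p q v) = smap ?D p q (\<phi> p v)" if le: "p \<le> q" and v: "v \<in> carrier (S p)" for p q v
  proof (rule eqI)
    interpret V: vectorspace k "S p" by (rule vs)
    interpret W: vectorspace k "S q" by (rule vs)
    interpret T: linear_map k "S p" "S q" "smap C p q" by (rule lin[OF le])
    let ?c = "V.coord (B p) v"
    have cc: "?c (e j p) \<in> carrier k" if "j \<in> Q p" for j using co(1)[OF v] eB[OF that] by blast
    \<comment> \<open>The coordinates of \<open>v\<close>, extended by zero; on the curves through
      \<open>q\<close> they are the coordinates of its image. \<open>a\<close> below is the same
      family indexed by basis vectors at \<open>q\<close>.\<close>
    define x where "x j = (if j \<in> Q p then ?c (e j p) else \<zero>\<^bsub>k\<^esub>)" for j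
    have xc: "x j \<in> carrier k" for j using cc by (simp add: x_def)
    define a where "a = x \<circ> the_inv_into (Q q) (\<lambda>j. e j q)"
    have ae: "a (e j q) = x j" if "j \<in> Q q" for j
      using the_inv_into_f_f[OF inj that] by (simp add: a_def)
    have a: "a \<in> B q \<rightarrow> carrier k" using xc by (simp add: a_def)
    have "v = V.lincomb ?c (B p)" using co(2)[OF v] by simp
    also have "\<dots> = (\<Oplus>\<^bsub>S p\<^esub> j\<in>Q p. ?c (e j p) \<odot>\<^bsub>S p\<^esub> e j p)"
      unfolding B_def by (rule V.lincomb_reindex[OF inj]) (use Bc[of p] co(1)[OF v] in \<open>simp_all add: B_def\<close>)
    finally have "smap C p q v = smap C p q (\<Oplus>\<^bsub>S p\<^esub> j\<in>Q p. ?c (e j p) \<odot>\<^bsub>S p\<^esub> e j p)" by simp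
    also have "\<dots> = (\<Oplus>\<^bsub>S q\<^esub> j\<in>Q p. smap C p q (?c (e j p) \<odot>\<^bsub>S p\<^esub> e j p))"
      by (rule T.hom_finsum[OF finQ]) (use cc ec in auto)
    \<comment> \<open>The two index sets differ by harmless terms: a curve that misses
      \<open>p\<close> has \<open>x j\<close> equal to zero, and a curve that misses
      \<open>q\<close> has its basis vector killed.\<close>
    also have "\<dots> = (\<Oplus>\<^bsub>S q\<^esub> j\<in>Q q. x j \<odot>\<^bsub>S q\<^esub> e j q)"
    proof (rule W.module.M.add.finprod_mono_neutral_cong[OF finQ finQ])
      fix j assume "j \<in> Q q - Q p"
      then show "x j \<odot>\<^bsub>S q\<^esub> e j q = \<zero>\<^bsub>S q\<^esub>" using ec[of j q] by (simp add: x_def W.module.lmult_0)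
    next
      fix j assume "j \<in> Q p - Q q"
      then have j: "j \<in> Q p" "j \<notin> Q q" by simp_all
      then have "smap C p q (e j p) = \<zero>\<^bsub>S q\<^esub>" using step[OF le j(1)] by (auto simp: Q_def)
      then show "smap C p q (?c (e j p) \<odot>\<^bsub>S p\<^esub> e j p) = \<zero>\<^bsub>S q\<^esub>"
        using cc[OF j(1)] ec[OF j(1)] by simp
    next
      fix j assume "j \<in> Q p \<inter> Q q"
      then have j: "j \<in> Q p \<and> j \<in> Q q" by simp
      then have "smap C p q (e j p) = e j q" using step[OF le, of j] by (auto simp: Q_def)
      then show "smap C p q (?c (e j p) \<odot>\<^bsub>S p\<^esub> e j p) = x j \<odot>\<^bsub>S q\<^esub> e j q"
        using cc[of j] ec[of j p] j by (simp add: x_def)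
    next
      show "(\<lambda>j. smap C p q (?c (e j p) \<odot>\<^bsub>S p\<^esub> e j p)) \<in> Q p \<rightarrow> carrier (S q)"
        using cc ec smap_closed[OF le] by simp
      show "(\<lambda>j. x j \<odot>\<^bsub>S q\<^esub> e j q) \<in> Q q \<rightarrow> carrier (S q)" using xc ec by simp
    qed
    also have "\<dots> = (\<Oplus>\<^bsub>S q\<^esub> j\<in>Q q. a (e j q) \<odot>\<^bsub>S q\<^esub> e j q)"
      by (rule W.module.M.add.finprod_cong') (use ae xc ec in simp_all)
    also have "\<dots> = W.lincomb a (B q)"
      unfolding B_def by (rule W.lincomb_reindex[OF inj, symmetric]) (use Bc[of q] a in \<open>simp_all add: B_def\<close>)
    finally have Tv: "W.lincomb a (B q) = smap C p q v" by simp
    show "\<phi> q (smap C p q v) j = smap ?D p q (\<phi> p v) j" if j: "j \<in> J" for j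
    proof (cases "j \<in> Q q")
      case True
      have "\<phi> q (smap C p q v) j = x j"
        using \<phi>_val[OF True] co_unique[OF smap_closed[OF le v] a Tv eB[OF True]] ae[OF True] by simp
      then show ?thesis using True j \<phi>_val[of j p v]
        by (auto simp: direct_sum_rep_def spread_rep_def x_def Q_def)
    next
      case False
      then show ?thesis using \<phi>_out[OF j False] j
        by (auto simp: direct_sum_rep_def spread_rep_def Q_def)
    qed
  qed (simp_all add: \<phi>_ext direct_sum_rep_def)
  show ?thesis
    unfolding rep_iso_def using hom bij comm by blast
qed

end

section \<open>Quotients of representations\<close>

text \<open>A structure whose elements and operations are images of those of a vector space inherits
  the axioms; this is how the records of cosets become vector spaces.\<close>

lemma linear_map_onto:
  assumes V: "vectorspace K V" and car: "carrier Q = f ` carrier V" and zero: "\<zero>\<^bsub>Q\<^esub> = f \<zero>\<^bsub>V\<^esub>"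
    and add: "\<And>u v. u \<in> carrier V \<Longrightarrow> v \<in> carrier V \<Longrightarrow> f u \<oplus>\<^bsub>Q\<^esub> f v = f (u \<oplus>\<^bsub>V\<^esub> v)"
    and smult: "\<And>a v. a \<in> carrier K \<Longrightarrow> v \<in> carrier V \<Longrightarrow> a \<odot>\<^bsub>Q\<^esub> f v = f (a \<odot>\<^bsub>V\<^esub> v)"
  shows "linear_map K V Q f"
proof -
  interpret V: vectorspace K V by (rule V)
  have f: "field K" ..
  have VQ: "vectorspace K Q"
  proof (rule vs_criteria[OF f])
    show "\<forall>v\<in>carrier Q. \<exists>w\<in>carrier Q. v \<oplus>\<^bsub>Q\<^esub> w = \<zero>\<^bsub>Q\<^esub>"
    proof
      fix v assume "v \<in> carrier Q"
      then obtain u where u: "u \<in> carrier V" "v = f u" unfolding car by blast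
      then have "v \<oplus>\<^bsub>Q\<^esub> f (\<ominus>\<^bsub>V\<^esub> u) = \<zero>\<^bsub>Q\<^esub>" using add[of u "\<ominus>\<^bsub>V\<^esub> u"] zero by (simp add: V.module.M.r_neg)
      then show "\<exists>w\<in>carrier Q. v \<oplus>\<^bsub>Q\<^esub> w = \<zero>\<^bsub>Q\<^esub>" using u(1) car by blast
    qed
  qed (auto simp: car zero add smult V.module.M.a_ac V.module.smult_assoc1
      V.module.smult_l_distr V.module.smult_r_distr)
  then show ?thesis
    using V VQ vectorspace.axioms(1)[OF V] vectorspace.axioms(1)[OF VQ] add smult car
    by (auto simp: linear_map_def mod_hom_def mod_hom_axioms_def module_hom_def)
qed

lemma (in vectorspace) subspace_fin_dim:
  assumes "fin_dim" "subspace K Z V"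
  shows "vectorspace.fin_dim K (V\<lparr>carrier := Z\<rparr>)"
proof -
  obtain B where B: "basis_of Z B"
    using extend_basis_of[OF assms, of "{}"] finite_lin_indpt2[of "{}"] by auto
  then have Bc: "B \<subseteq> carrier V" "lin_indpt B" "B \<subseteq> Z"
    using subspaceD(1)[OF assms(2)] by (auto simp: basis_of_def)
  have "LinearCombinations.module.span K (V\<lparr>carrier := Z\<rparr>) B = Z"
    using span_li_not_depend(1)[OF Bc(3) is_module[OF assms(2)]] basis_of_span[OF B assms(2)] by simp
  moreover have "finite B" using li_le_dim[OF assms(1) Bc(1,2)] by simp
  ultimately show ?thesis
    unfolding vectorspace.fin_dim_def[OF subspace_is_vs[OF assms(2)]] using Bc(3) by auto
qed

definition proj :: "('a, 'v) module \<Rightarrow> 'v set \<Rightarrow> 'v \<Rightarrow> 'v set" where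
  "proj V W v = (\<lambda>w. w \<oplus>\<^bsub>V\<^esub> v) ` W"

lemma set_add_mem:
  "x \<in> X <+>\<^bsub>V\<^esub> Y \<longleftrightarrow> (\<exists>u\<in>X. \<exists>v\<in>Y. x = u \<oplus>\<^bsub>V\<^esub> v)"
  unfolding set_add_def' by auto

lemma set_add_carrier_update: "set_add (V\<lparr>carrier := Z\<rparr>) = set_add V"
  by (intro ext) (simp add: set_add_def')

lemma proj_add:
  assumes V: "vectorspace K V" and W: "subspace K W V" and uv: "u \<in> carrier V" "v \<in> carrier V"
  shows "proj V W u <+>\<^bsub>V\<^esub> proj V W v = proj V W (u \<oplus>\<^bsub>V\<^esub> v)"
proof -
  interpret V: vectorspace K V by (rule V)
  note W' = V.subspaceD[OF W]
  have eq: "(w \<oplus>\<^bsub>V\<^esub> u) \<oplus>\<^bsub>V\<^esub> (w' \<oplus>\<^bsub>V\<^esub> v) = (w \<oplus>\<^bsub>V\<^esub> w') \<oplus>\<^bsub>V\<^esub> (u \<oplus>\<^bsub>V\<^esub> v)" if "w \<in> W" "w' \<in> W" for w w'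
    using that W'(1) uv by (simp add: subset_iff V.module.M.a_ac)
  show ?thesis
  proof (intro equalityI subsetI)
    fix x assume "x \<in> proj V W u <+>\<^bsub>V\<^esub> proj V W v"
    then obtain w w' where "w \<in> W" "w' \<in> W" "x = (w \<oplus>\<^bsub>V\<^esub> u) \<oplus>\<^bsub>V\<^esub> (w' \<oplus>\<^bsub>V\<^esub> v)"
      by (auto simp: set_add_mem proj_def)
    then show "x \<in> proj V W (u \<oplus>\<^bsub>V\<^esub> v)" using eq W'(3) by (auto simp: proj_def)
  next
    fix x assume "x \<in> proj V W (u \<oplus>\<^bsub>V\<^esub> v)"
    then obtain w where w: "w \<in> W" "x = w \<oplus>\<^bsub>V\<^esub> (u \<oplus>\<^bsub>V\<^esub> v)" by (auto simp: proj_def)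
    then have "x = (w \<oplus>\<^bsub>V\<^esub> u) \<oplus>\<^bsub>V\<^esub> (\<zero>\<^bsub>V\<^esub> \<oplus>\<^bsub>V\<^esub> v)" using eq[OF w(1) W'(2)] W'(1) by (simp add: subset_iff)
    then show "x \<in> proj V W u <+>\<^bsub>V\<^esub> proj V W v" using w(1) W'(2) by (auto simp: set_add_mem proj_def)
  qed
qed

lemma proj_eq_self_iff:
  assumes V: "vectorspace K V" and W: "subspace K W V" and v: "v \<in> carrier V"
  shows "proj V W v = W \<longleftrightarrow> v \<in> W"
proof
  interpret V: vectorspace K V by (rule V)
  note W' = V.subspaceD[OF W]
  show "v \<in> W" if "proj V W v = W"
  proof -
    have "\<zero>\<^bsub>V\<^esub> \<oplus>\<^bsub>V\<^esub> v \<in> proj V W v" unfolding proj_def using W'(2) by (rule imageI)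
    then show ?thesis using that v by simp
  qed
  assume vW: "v \<in> W"
  show "proj V W v = W"
  proof
    show "proj V W v \<subseteq> W" using W'(3) vW by (auto simp: proj_def)
    show "W \<subseteq> proj V W v"
    proof
      fix w assume w: "w \<in> W"
      have "w = (w \<ominus>\<^bsub>V\<^esub> v) \<oplus>\<^bsub>V\<^esub> v"
        using w v W'(1) by (simp add: subset_iff a_minus_def V.module.M.a_assoc V.module.M.l_neg)
      then show "w \<in> proj V W v" unfolding proj_def using W'(6)[OF w vW] by (rule image_eqI)
    qed
  qed
qed

text \<open>One formula for two uses: the map induced between quotients and, with \<open>g\<close> a
  scalar multiplication, the \<open>smult\<close> field of \<open>quot_space\<close>.\<close>

lemma quot_map_proj:
  assumes l: "linear_map K V U g" and W: "subspace K W V" and W': "subspace K W' U"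
    and g: "g ` W \<subseteq> W'" and v: "v \<in> carrier V"
  shows "(g ` proj V W v) <+>\<^bsub>U\<^esub> W' = proj U W' (g v)"
proof -
  interpret V: vectorspace K V using l by (simp add: linear_map_def)
  interpret U: vectorspace K U using l by (simp add: linear_map_def)
  interpret g: linear_map K V U g by (rule l)
  note WD = V.subspaceD[OF W] and WD' = U.subspaceD[OF W']
  have gv: "g v \<in> carrier U" using v by simp
  show ?thesis
  proof (intro equalityI subsetI)
    fix x assume "x \<in> (g ` proj V W v) <+>\<^bsub>U\<^esub> W'"
    then obtain w w' where w: "w \<in> W" "w' \<in> W'" "x = g (w \<oplus>\<^bsub>V\<^esub> v) \<oplus>\<^bsub>U\<^esub> w'"
      by (auto simp: set_add_mem proj_def)
    have c: "w \<in> carrier V" "w' \<in> carrier U" "g w \<in> W'" using w WD(1) WD'(1) g by auto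
    then have "x = (g w \<oplus>\<^bsub>U\<^esub> w') \<oplus>\<^bsub>U\<^esub> g v"
      using w(3) v gv by (simp add: U.module.M.a_ac)
    then show "x \<in> proj U W' (g v)" unfolding proj_def using WD'(3)[OF c(3) w(2)] by (rule image_eqI)
  next
    fix x assume "x \<in> proj U W' (g v)"
    then obtain w' where w': "w' \<in> W'" "x = w' \<oplus>\<^bsub>U\<^esub> g v" by (auto simp: proj_def)
    have c: "w' \<in> carrier U" using w'(1) WD'(1) by auto
    have "x = g (\<zero>\<^bsub>V\<^esub> \<oplus>\<^bsub>V\<^esub> v) \<oplus>\<^bsub>U\<^esub> w'" using w'(2) v gv c by (simp add: U.module.M.a_comm)
    moreover have "\<zero>\<^bsub>V\<^esub> \<oplus>\<^bsub>V\<^esub> v \<in> proj V W v" unfolding proj_def using WD(2) by (rule imageI)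
    ultimately show "x \<in> (g ` proj V W v) <+>\<^bsub>U\<^esub> W'" using w'(1) by (auto simp: set_add_mem)
  qed
qed

lemma linear_map_smult:
  assumes V: "vectorspace K V" and a: "a \<in> carrier K"
  shows "linear_map K V V (\<lambda>v. a \<odot>\<^bsub>V\<^esub> v)"
proof -
  interpret V: vectorspace K V by (rule V)
  have "a \<odot>\<^bsub>V\<^esub> (r \<odot>\<^bsub>V\<^esub> m) = r \<odot>\<^bsub>V\<^esub> (a \<odot>\<^bsub>V\<^esub> m)" if "r \<in> carrier K" "m \<in> carrier V" for r m
    using that a V.module.smult_assoc1[of a r m] V.module.smult_assoc1[of r a m] V.module.R.m_comm[of a r] by simp
  then show ?thesis
    using V vectorspace.axioms(1)[OF V] a
    by (auto simp: linear_map_def mod_hom_def mod_hom_axioms_def module_hom_def V.module.smult_r_distr)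
qed

text \<open>
  \<open>W\<close> need not be contained in \<open>Z\<close>; the quotient is then \<open>(Z + W) / W\<close>. This makes it
  unnecessary to know that boundaries are cycles.
\<close>

lemma quot_space_proj:
  assumes V: "vectorspace K V" and Z: "subspace K Z V" and W: "subspace K W V"
  shows "linear_map K (V\<lparr>carrier := Z\<rparr>) (quot_space (V\<lparr>carrier := Z\<rparr>) W) (proj V W)"
    and "carrier (quot_space (V\<lparr>carrier := Z\<rparr>) W) = proj V W ` Z"
    and "\<zero>\<^bsub>quot_space (V\<lparr>carrier := Z\<rparr>) W\<^esub> = W"
proof -
  interpret V: vectorspace K V by (rule V)
  note ZD = V.subspaceD[OF Z] and WD = V.subspaceD[OF W]
  let ?Q = "quot_space (V\<lparr>carrier := Z\<rparr>) W"
  show car: "carrier ?Q = proj V W ` Z"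
    unfolding quot_space_def A_RCOSETS_def' a_r_coset_def' proj_def by (auto simp: image_def)
  show zero: "\<zero>\<^bsub>?Q\<^esub> = W" by (simp add: quot_space_def)
  show "linear_map K (V\<lparr>carrier := Z\<rparr>) ?Q (proj V W)"
  proof (rule linear_map_onto[OF V.subspace_is_vs[OF Z]])
    show "carrier ?Q = proj V W ` carrier (V\<lparr>carrier := Z\<rparr>)" using car by simp
    show "\<zero>\<^bsub>?Q\<^esub> = proj V W \<zero>\<^bsub>V\<lparr>carrier := Z\<rparr>\<^esub>"
      using zero proj_eq_self_iff[OF V W, of "\<zero>\<^bsub>V\<^esub>"] WD(2) by simp
    show "proj V W u \<oplus>\<^bsub>?Q\<^esub> proj V W v = proj V W (u \<oplus>\<^bsub>V\<lparr>carrier := Z\<rparr>\<^esub> v)"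
      if "u \<in> carrier (V\<lparr>carrier := Z\<rparr>)" "v \<in> carrier (V\<lparr>carrier := Z\<rparr>)" for u v
      using that ZD(1) proj_add[OF V W, of u v] by (auto simp: quot_space_def set_add_carrier_update)
    show "a \<odot>\<^bsub>?Q\<^esub> proj V W v = proj V W (a \<odot>\<^bsub>V\<lparr>carrier := Z\<rparr>\<^esub> v)"
      if av: "a \<in> carrier K" "v \<in> carrier (V\<lparr>carrier := Z\<rparr>)" for a v
    proof -
      have "(\<lambda>v. a \<odot>\<^bsub>V\<^esub> v) ` W \<subseteq> W" using WD(4) av(1) by auto
      then show ?thesis
        using quot_map_proj[OF linear_map_smult[OF V av(1)] W W, of v] av ZD(1)
        by (auto simp: quot_space_def set_add_carrier_update)
    qed
  qed
qed

text \<open>Common shape of the two quotients at hand: the cokernel of \<open>xy\<close>, where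
  \<open>Z\<close> is everything, and homology, where \<open>Z\<close> consists of the cycles and
  \<open>W\<close> of the boundaries.\<close>

definition quot_rep :: "('a, 'v) rep \<Rightarrow> (int \<times> int \<Rightarrow> 'v set) \<Rightarrow> (int \<times> int \<Rightarrow> 'v set) \<Rightarrow> ('a, 'v set) rep" where
  "quot_rep M Z W = \<lparr>Space = (\<lambda>p. quot_space (Space M p\<lparr>carrier := Z p\<rparr>) (W p)),
     smap = (\<lambda>p q. quot_map (Space M q\<lparr>carrier := Z q\<rparr>) (W q) (smap M p q))\<rparr>"

locale quotient_rep = pfd_rep k M for k :: "('a, 'b) ring_scheme" and M :: "('a, 'v) rep" +
  fixes Z W :: "int \<times> int \<Rightarrow> 'v set"
  assumes Z_sub: "subspace k (Z p) (S p)" and W_sub: "subspace k (W p) (S p)"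
    and Z_map: "p \<le> q \<Longrightarrow> smap M p q ` Z p \<subseteq> Z q"
    and W_map: "p \<le> q \<Longrightarrow> smap M p q ` W p \<subseteq> W q"
begin

abbreviation "QR \<equiv> quot_rep M Z W"
abbreviation "QS p \<equiv> Space QR p"
abbreviation "pr p \<equiv> proj (S p) (W p)"
abbreviation "SZ p \<equiv> S p\<lparr>carrier := Z p\<rparr>"

lemma Z_carrier: "v \<in> Z p \<Longrightarrow> v \<in> carrier (S p)"
  using vectorspace.subspaceD(1)[OF vs Z_sub] by blast

lemma QS_eq: "QS p = quot_space (SZ p) (W p)"
  by (simp add: quot_rep_def)

lemma pr_linear: "linear_map k (SZ p) (QS p) (pr p)"
  unfolding QS_eq by (rule quot_space_proj(1)[OF vs Z_sub W_sub])

lemma QS_carrier: "carrier (QS p) = pr p ` Z p"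
  unfolding QS_eq by (rule quot_space_proj(2)[OF vs Z_sub W_sub])

lemma pr_zero_iff: "v \<in> carrier (S p) \<Longrightarrow> pr p v = \<zero>\<^bsub>QS p\<^esub> \<longleftrightarrow> v \<in> W p"
  unfolding QS_eq quot_space_proj(3)[OF vs Z_sub W_sub] by (rule proj_eq_self_iff[OF vs W_sub])

lemma QR_smap: "p \<le> q \<Longrightarrow> v \<in> carrier (S p) \<Longrightarrow> smap QR p q (pr p v) = pr q (smap M p q v)"
  using quot_map_proj[OF lin W_sub W_sub W_map]
  by (simp add: quot_rep_def quot_map_def set_add_carrier_update)

lemma rep2_QR: "rep2 k QR"
proof -
  have V: "vectorspace k (QS p)" for p using pr_linear[of p] by (simp add: linear_map_def)
  have F: "vectorspace.fin_dim k (QS p)" for p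
    using linear_map.surj_fin_dim[OF pr_linear vectorspace.subspace_fin_dim[OF vs fd Z_sub]] QS_carrier[of p]
    by simp
  have Zm: "smap M p q v \<in> Z q" if "p \<le> q" "v \<in> Z p" for p q v using Z_map[OF that(1)] that(2) by blast
  have H: "smap QR p q \<in> module_hom k (QS p) (QS q)" if le: "p \<le> q" for p q
    unfolding module_hom_def
  proof (intro CollectI conjI allI impI)
    interpret P: linear_map k "SZ p" "QS p" "pr p" by (rule pr_linear)
    interpret Q: linear_map k "SZ q" "QS q" "pr q" by (rule pr_linear)
    interpret T: linear_map k "S p" "S q" "smap M p q" by (rule lin[OF le])
    show "smap QR p q \<in> carrier (QS p) \<rightarrow> carrier (QS q)"
    proof
      fix X assume "X \<in> carrier (QS p)"
      then obtain v where v: "v \<in> Z p" "X = pr p v" unfolding QS_carrier by blast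
      then show "smap QR p q X \<in> carrier (QS q)"
        using QR_smap[OF le Z_carrier[OF v(1)]] Zm[OF le v(1)] QS_carrier[of q] by simp
    qed
    fix X Y assume "X \<in> carrier (QS p) \<and> Y \<in> carrier (QS p)"
    then obtain u v where uv: "u \<in> Z p" "X = pr p u" "v \<in> Z p" "Y = pr p v" unfolding QS_carrier by blast
    have c: "u \<in> carrier (S p)" "v \<in> carrier (S p)" using uv Z_carrier by auto
    have s: "u \<oplus>\<^bsub>S p\<^esub> v \<in> carrier (S p)"
      using vectorspace.subspaceD(3)[OF vs Z_sub uv(1,3)] Z_carrier by blast
    have "X \<oplus>\<^bsub>QS p\<^esub> Y = pr p (u \<oplus>\<^bsub>S p\<^esub> v)" using P.T_add[of u v] uv by simp
    then have "smap QR p q (X \<oplus>\<^bsub>QS p\<^esub> Y) = pr q (smap M p q u \<oplus>\<^bsub>S q\<^esub> smap M p q v)"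
      using QR_smap[OF le s] c by simp
    also have "\<dots> = pr q (smap M p q u) \<oplus>\<^bsub>QS q\<^esub> pr q (smap M p q v)"
      using Q.T_add[of "smap M p q u" "smap M p q v"] Zm[OF le uv(1)] Zm[OF le uv(3)] by simp
    finally show "smap QR p q (X \<oplus>\<^bsub>QS p\<^esub> Y) = smap QR p q X \<oplus>\<^bsub>QS q\<^esub> smap QR p q Y"
      using QR_smap[OF le] c uv by simp
  next
    interpret P: linear_map k "SZ p" "QS p" "pr p" by (rule pr_linear)
    interpret Q: linear_map k "SZ q" "QS q" "pr q" by (rule pr_linear)
    interpret T: linear_map k "S p" "S q" "smap M p q" by (rule lin[OF le])
    fix r X assume rX: "r \<in> carrier k \<and> X \<in> carrier (QS p)"
    then obtain u where u: "u \<in> Z p" "X = pr p u" unfolding QS_carrier by blast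
    have c: "u \<in> carrier (S p)" using u Z_carrier by auto
    have r: "r \<in> carrier k" using rX by simp
    have s: "r \<odot>\<^bsub>S p\<^esub> u \<in> carrier (S p)"
      using vectorspace.subspaceD(4)[OF vs Z_sub r u(1)] Z_carrier by blast
    have "r \<odot>\<^bsub>QS p\<^esub> X = pr p (r \<odot>\<^bsub>S p\<^esub> u)" using P.T_smult[of r u] u r by simp
    then have "smap QR p q (r \<odot>\<^bsub>QS p\<^esub> X) = pr q (r \<odot>\<^bsub>S q\<^esub> smap M p q u)"
      using QR_smap[OF le s] c r by simp
    also have "\<dots> = r \<odot>\<^bsub>QS q\<^esub> pr q (smap M p q u)"
      using Q.T_smult[of r "smap M p q u"] Zm[OF le u(1)] r by simp
    finally show "smap QR p q (r \<odot>\<^bsub>QS p\<^esub> X) = r \<odot>\<^bsub>QS q\<^esub> smap QR p q X"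
      using QR_smap[OF le] c u by simp
  qed
  have I: "smap QR p p X = X" if X: "X \<in> carrier (QS p)" for p X
  proof -
    obtain v where v: "v \<in> Z p" "X = pr p v" using X unfolding QS_carrier by blast
    then show ?thesis using QR_smap[of p p v] Z_carrier smap_id by simp
  qed
  have K: "smap QR q r (smap QR p q X) = smap QR p r X" if le: "p \<le> q" "q \<le> r" and X: "X \<in> carrier (QS p)" for p q r X
  proof -
    obtain v where v: "v \<in> Z p" "X = pr p v" using X unfolding QS_carrier by blast
    have c: "v \<in> carrier (S p)" "smap M p q v \<in> carrier (S q)" using v Z_carrier smap_closed[OF le(1)] by blast+
    have pr: "p \<le> r" using le by order
    show ?thesis unfolding v(2) QR_smap[OF le(1) c(1)] QR_smap[OF le(2) c(2)] QR_smap[OF pr c(1)] smap_comp[OF le c(1)] ..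
  qed
  show ?thesis unfolding rep2_def
    by (intro conjI allI impI ballI)
      (rule V | rule F | (rule H; assumption) | (rule I; assumption) | (rule K; assumption))+
qed

lemma QR_generated:
  assumes G: "\<And>p v. (p, v) \<in> G \<Longrightarrow> v \<in> Z p"
    and gen: "\<And>q. Z q \<subseteq> module.span k (S q) {smap M p q v | p v. (p, v) \<in> G \<and> p \<le> q}"
  shows "carrier (QS q) = module.span k (QS q)
    {smap QR p q X | p X. (p, X) \<in> (\<lambda>(p, v). (p, pr p v)) ` G \<and> p \<le> q}"
proof -
  interpret P: linear_map k "SZ q" "QS q" "pr q" by (rule pr_linear)
  let ?A = "{smap M p q v | p v. (p, v) \<in> G \<and> p \<le> q}"
  have AZ: "?A \<subseteq> Z q" using G Z_map by blast
  have "module.span k (SZ q) ?A = module.span k (S q) ?A"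
    using module.span_li_not_depend(1)[OF vectorspace.axioms(1)[OF vs] AZ vectorspace.is_module[OF vs Z_sub]] .
  moreover have "module.span k (S q) ?A \<subseteq> Z q" using vectorspace.span_le[OF vs AZ Z_sub] .
  ultimately have sp: "module.span k (SZ q) ?A = Z q" using gen[of q] by simp
  have "pr q ` ?A = {smap QR p q X | p X. (p, X) \<in> (\<lambda>(p, v). (p, pr p v)) ` G \<and> p \<le> q}"
  proof (intro equalityI subsetI)
    fix X assume "X \<in> pr q ` ?A"
    then obtain p v where v: "(p, v) \<in> G" "p \<le> q" "X = pr q (smap M p q v)" by blast
    then have "X = smap QR p q (pr p v)" using QR_smap[OF v(2)] Z_carrier[OF G[OF v(1)]] by simp
    moreover have "(p, pr p v) \<in> (\<lambda>(p, v). (p, pr p v)) ` G" using v(1) by force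
    ultimately show "X \<in> {smap QR p q X | p X. (p, X) \<in> (\<lambda>(p, v). (p, pr p v)) ` G \<and> p \<le> q}"
      using v(2) by blast
  next
    fix X assume "X \<in> {smap QR p q X | p X. (p, X) \<in> (\<lambda>(p, v). (p, pr p v)) ` G \<and> p \<le> q}"
    then obtain p Y where Y: "X = smap QR p q Y" "(p, Y) \<in> (\<lambda>(p, v). (p, pr p v)) ` G" "p \<le> q" by blast
    then obtain v where v: "(p, v) \<in> G" "Y = pr p v" by auto
    have "X = pr q (smap M p q v)" using QR_smap[OF Y(3)] Z_carrier[OF G[OF v(1)]] Y(1) v(2) by simp
    then show "X \<in> pr q ` ?A" using v(1) Y(3) by blast
  qed
  moreover have "pr q ` module.span k (SZ q) ?A = module.span k (QS q) (pr q ` ?A)"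
    by (rule P.image_span) (use AZ in simp)
  ultimately show ?thesis unfolding QS_carrier sp by simp
qed

end

section \<open>Counting birth-curves\<close>

lemma carrier_update_self: "V\<lparr>carrier := carrier V\<rparr> = V"
  by simp

text \<open>\<open>U i\<close> acts as the kernel of a functional dual to \<open>m i\<close>: it
  contains \<open>N\<close> and all the other vectors, so modulo \<open>N\<close> no
  \<open>m i\<close> is a combination of the others.\<close>

lemma card_le_dim_quotient:
  assumes V: "vectorspace K V" and fd: "vectorspace.fin_dim K V" and N: "subspace K N V" and F: "finite F"
    and m: "\<And>i. i \<in> F \<Longrightarrow> m i \<in> carrier V"
    and U: "\<And>i. i \<in> F \<Longrightarrow> subspace K (U i) V" "\<And>i. i \<in> F \<Longrightarrow> N \<subseteq> U i"
    and mU: "\<And>i j. i \<in> F \<Longrightarrow> j \<in> F \<Longrightarrow> j \<noteq> i \<Longrightarrow> m j \<in> U i" "\<And>i. i \<in> F \<Longrightarrow> m i \<notin> U i"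
  shows "card F \<le> vectorspace.dim K (quot_space V N)"
proof -
  interpret V: vectorspace K V by (rule V)
  let ?Q = "quot_space V N"
  note qp = quot_space_proj[OF V V.subspace_carrier N, unfolded carrier_update_self]
  interpret Q: vectorspace K ?Q using qp(1) by (simp add: linear_map_def)
  interpret P: linear_map K V ?Q "proj V N" by (rule qp(1))
  have fdQ: "Q.fin_dim" using P.surj_fin_dim[OF fd] qp(2) by simp
  have diff: "u \<ominus>\<^bsub>V\<^esub> v \<in> N" if "u \<in> carrier V" "v \<in> carrier V" "proj V N u = proj V N v" for u v
  proof -
    have c: "u \<ominus>\<^bsub>V\<^esub> v \<in> carrier V" using that by simp
    have "proj V N (u \<ominus>\<^bsub>V\<^esub> v) = \<zero>\<^bsub>?Q\<^esub>" using that by (simp add: Q.module.M.r_neg a_minus_def)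
    then show ?thesis using proj_eq_self_iff[OF V N c] qp(3) by simp
  qed
  have key: "False" if i: "i \<in> F" and s: "s \<in> U i" "proj V N (m i) = proj V N s" for i s
  proof -
    note UD = V.subspaceD[OF U(1)[OF i]]
    have sc: "s \<in> carrier V" using UD(1) s(1) by blast
    have "m i \<ominus>\<^bsub>V\<^esub> s \<in> U i" using diff[OF m[OF i] sc s(2)] U(2)[OF i] by blast
    then have "(m i \<ominus>\<^bsub>V\<^esub> s) \<oplus>\<^bsub>V\<^esub> s \<in> U i" using UD(3) s(1) by blast
    then have "m i \<in> U i" using m[OF i] sc by (simp add: a_minus_def V.module.M.a_assoc V.module.M.l_neg)
    then show False using mU(2)[OF i] by blast
  qed
  let ?f = "\<lambda>i. proj V N (m i)"
  have inj: "inj_on ?f F"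
  proof (rule inj_onI)
    fix i j assume ij: "i \<in> F" "j \<in> F" "?f i = ?f j"
    show "i = j"
    proof (rule ccontr)
      assume "i \<noteq> j"
      then show False using key[OF ij(1) mU(1)[OF ij(1,2)] ij(3)] by blast
    qed
  qed
  have fc: "?f ` F \<subseteq> carrier ?Q" using m P.T_im by blast
  have "\<not> Q.lin_dep (?f ` F)"
  proof
    assume "Q.lin_dep (?f ` F)"
    then obtain i where i: "i \<in> F" "?f i \<in> Q.span (?f ` F - {?f i})"
      using Q.lindep_span[OF fc] F by blast
    let ?L = "m ` (F - {i})"
    have Lc: "?L \<subseteq> carrier V" using m by blast
    have "?f ` F - {?f i} \<subseteq> proj V N ` ?L" by blast
    then have "?f i \<in> Q.span (proj V N ` ?L)" using i(2) Q.module.span_is_monotone by blast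
    then have "?f i \<in> proj V N ` V.span ?L" unfolding P.image_span[OF Lc] .
    then obtain s where s: "s \<in> V.span ?L" "?f i = proj V N s" by blast
    have "?L \<subseteq> U i" using mU(1)[OF i(1)] by blast
    then have "s \<in> U i" using V.span_le[OF _ U(1)[OF i(1)]] s(1) by blast
    then show False using key[OF i(1) _ s(2)] by blast
  qed
  from Q.li_le_dim(2)[OF fdQ fc this] show ?thesis using card_image[OF inj] by simp
qed

text \<open>The body of \<open>fin_gen\<close> with the generating set kept visible: the bound on
  levels and the bound on \<open>beta0\<close> are both read off from it.\<close>

definition generates :: "('a, 'b) ring_scheme \<Rightarrow> ('a, 'v) rep \<Rightarrow> ((int \<times> int) \<times> 'v) set \<Rightarrow> bool" where
  "generates k M G \<longleftrightarrow> finite G \<and> (\<forall>(p, v) \<in> G. v \<in> carrier (Space M p)) \<and>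
     (\<forall>q. carrier (Space M q) = LinearCombinations.module.span k (Space M q) {smap M p q v | p v. (p, v) \<in> G \<and> p \<le> q})"

lemma fin_gen_iff: "fin_gen k M \<longleftrightarrow> (\<exists>G. generates k M G)"
  unfolding fin_gen_def generates_def ..

section \<open>Generators and the radical \<open>xM + yM\<close>\<close>

context pfd_rep begin

lemma image_sub: "p \<le> q \<Longrightarrow> subspace k (smap C p q ` carrier (S p)) (S q)"
  by (rule linear_map.image_subspace[OF lin vectorspace.subspace_carrier[OF vs]])

lemma xy_rad_eq: "xy_rad C p = smap C (p - (1,0)) p ` carrier (S (p - (1,0))) <+>\<^bsub>S p\<^esub>
    smap C (p - (0,1)) p ` carrier (S (p - (0,1)))"
  by (simp add: xy_rad_def x_act_def y_act_def)

lemma pred_le: "p - (1,0) \<le> p" "p - (0,1) \<le> p" for p :: "int \<times> int"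
  by (simp_all add: less_eq_prod_def)

lemma xy_rad_sub: "subspace k (xy_rad C p) (S p)"
proof -
  let ?X = "smap C (p - (1,0)) p ` carrier (S (p - (1,0)))" and ?Y = "smap C (p - (0,1)) p ` carrier (S (p - (0,1)))"
  interpret V: vectorspace k "S p" by (rule vs)
  have "subspace k (V.submodule_sum ?X ?Y) (S p)"
    by (rule V.sum_is_subspace[OF image_sub[OF pred_le(1)] image_sub[OF pred_le(2)]])
  moreover have "V.submodule_sum ?X ?Y = xy_rad C p"
    unfolding xy_rad_eq V.module.submodule_sum_def set_add_def' by auto
  ultimately show ?thesis by simp
qed

lemma xy_rad_least:
  assumes "subspace k U (S p)" "smap C (p - (1,0)) p ` carrier (S (p - (1,0))) \<subseteq> U"
    "smap C (p - (0,1)) p ` carrier (S (p - (0,1))) \<subseteq> U"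
  shows "xy_rad C p \<subseteq> U"
proof
  fix x assume "x \<in> xy_rad C p"
  then obtain a b where "a \<in> U" "b \<in> U" "x = a \<oplus>\<^bsub>S p\<^esub> b"
    using assms(2,3) unfolding xy_rad_eq set_add_mem by blast
  then show "x \<in> U" using vectorspace.subspaceD(3)[OF vs assms(1)] by blast
qed

text \<open>A structure map from a strictly smaller degree can be factored so that its last step is
  \<open>x\<close> or \<open>y\<close>.\<close>

lemma smap_in_xy_rad:
  assumes le: "q \<le> p" and ne: "q \<noteq> p" and v: "v \<in> carrier (S q)"
  shows "smap C q p v \<in> xy_rad C p"
proof -
  interpret V: vectorspace k "S p" by (rule vs)
  let ?X = "smap C (p - (1,0)) p ` carrier (S (p - (1,0)))" and ?Y = "smap C (p - (0,1)) p ` carrier (S (p - (0,1)))"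
  have z: "\<zero>\<^bsub>S p\<^esub> \<in> ?X" "\<zero>\<^bsub>S p\<^esub> \<in> ?Y"
    using V.subspaceD(2)[OF image_sub[OF pred_le(1)]] V.subspaceD(2)[OF image_sub[OF pred_le(2)]] by blast+
  have c: "smap C q p v \<in> carrier (S p)" by (rule smap_closed[OF le v])
  have "fst q < fst p \<or> snd q < snd p" using le ne by (auto simp: less_eq_prod_def prod_eq_iff)
  then show ?thesis
  proof
    assume "fst q < fst p"
    then have l: "q \<le> p - (1,0)" using le by (simp add: less_eq_prod_def)
    have "smap C q p v \<in> ?X" using smap_comp[OF l pred_le(1) v] smap_closed[OF l v] by (metis imageI)
    moreover have "smap C q p v = smap C q p v \<oplus>\<^bsub>S p\<^esub> \<zero>\<^bsub>S p\<^esub>" using c by simp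
    ultimately show ?thesis unfolding xy_rad_eq set_add_mem using z(2) by blast
  next
    assume "snd q < snd p"
    then have l: "q \<le> p - (0,1)" using le by (simp add: less_eq_prod_def)
    have "smap C q p v \<in> ?Y" using smap_comp[OF l pred_le(2) v] smap_closed[OF l v] by (metis imageI)
    moreover have "smap C q p v = \<zero>\<^bsub>S p\<^esub> \<oplus>\<^bsub>S p\<^esub> smap C q p v" using c by simp
    ultimately show ?thesis unfolding xy_rad_eq set_add_mem using z(1) by blast
  qed
qed

lemma generator_carrier: "generates k C G \<Longrightarrow> (p, v) \<in> G \<Longrightarrow> v \<in> carrier (S p)"
  unfolding generates_def by blast

lemma generates_span:
  "generates k C G \<Longrightarrow> carrier (S q) = module.span k (S q) {smap C p q v | p v. (p, v) \<in> G \<and> p \<le> q}"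
  unfolding generates_def by blast

text \<open>Modulo \<open>xM + yM\<close> the contributions of generators from strictly smaller
  degrees vanish, so only those of degree exactly \<open>p\<close> count.\<close>

lemma top_dim_le:
  assumes G: "generates k C G"
  shows "vectorspace.dim k (quot_space (S p) (xy_rad C p)) \<le> card {v. (p, v) \<in> G}"
proof -
  interpret V: vectorspace k "S p" by (rule vs)
  let ?Q = "quot_space (S p) (xy_rad C p)" and ?pr = "proj (S p) (xy_rad C p)"
  note qp = quot_space_proj[OF vs vectorspace.subspace_carrier[OF vs] xy_rad_sub, of p, unfolded carrier_update_self]
  interpret Q: vectorspace k ?Q using qp(1) by (simp add: linear_map_def)
  interpret P: linear_map k "S p" ?Q ?pr by (rule qp(1))
  define A where "A = {smap C q p v | q v. (q, v) \<in> G \<and> q \<le> p}"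
  define H where "H = {v. (p, v) \<in> G}"
  have finH: "finite H"
  proof -
    have "finite G" using G by (simp add: generates_def)
    moreover have "H \<subseteq> snd ` G" by (force simp: H_def)
    ultimately show ?thesis using finite_surj by blast
  qed
  have Hc: "H \<subseteq> carrier (S p)" using generator_carrier[OF G, of p] unfolding H_def by blast
  have Ac: "A \<subseteq> carrier (S p)" using generator_carrier[OF G] smap_closed unfolding A_def by blast
  have "?pr ` A \<subseteq> insert \<zero>\<^bsub>?Q\<^esub> (?pr ` H)"
  proof
    fix x assume "x \<in> ?pr ` A"
    then obtain q v where v: "(q, v) \<in> G" "q \<le> p" "x = ?pr (smap C q p v)" unfolding A_def by blast
    have vc: "v \<in> carrier (S q)" by (rule generator_carrier[OF G v(1)])
    show "x \<in> insert \<zero>\<^bsub>?Q\<^esub> (?pr ` H)"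
    proof (cases "q = p")
      case True
      then show ?thesis using v vc smap_id[of v p] by (simp add: H_def)
    next
      case False
      have "?pr (smap C q p v) = \<zero>\<^bsub>?Q\<^esub>"
        using proj_eq_self_iff[OF vs xy_rad_sub smap_closed[OF v(2) vc]] smap_in_xy_rad[OF v(2) False vc] qp(3) by simp
      then show ?thesis using v(3) by simp
    qed
  qed
  then have sub: "?pr ` A - {\<zero>\<^bsub>?Q\<^esub>} \<subseteq> ?pr ` H" by blast
  have HQ: "?pr ` H \<subseteq> carrier ?Q" and AQ: "?pr ` A \<subseteq> carrier ?Q" using Hc Ac P.T_im by blast+
  have "carrier ?Q = ?pr ` V.span A"
    using qp(2) generates_span[OF G, of p] by (simp add: A_def)
  also have "\<dots> = Q.span (?pr ` A - {\<zero>\<^bsub>?Q\<^esub>})"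
    using P.image_span[OF Ac] Q.span_minus_zero[OF AQ] by simp
  also have "\<dots> \<subseteq> Q.span (?pr ` H)" by (rule Q.module.span_is_monotone[OF sub])
  finally have "Q.gen_set (?pr ` H)" using Q.module.span_is_subset2[OF HQ] by blast
  then have "Q.dim \<le> card (?pr ` H)" using Q.gen_ge_dim[OF _ HQ] finH by blast
  also have "\<dots> \<le> card H" by (rule card_image_le[OF finH])
  finally show ?thesis by (simp add: H_def)
qed

text \<open>Sorting the generators by degree adds up the local bounds. The support of the sum in
  \<open>beta0\<close> lies among the finitely many degrees of generators, so that sum is a genuine
  one.\<close>

lemma beta0_le_card:
  assumes G: "generates k C G"
  shows "finite {p. vectorspace.dim k (quot_space (S p) (xy_rad C p)) \<noteq> 0}" "beta0 k C \<le> card G"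
proof -
  define d where "d p = vectorspace.dim k (quot_space (S p) (xy_rad C p))" for p
  have finG: "finite G" using G by (simp add: generates_def)
  have le: "d p \<le> card {v. (p, v) \<in> G}" for p unfolding d_def by (rule top_dim_le[OF G])
  have sub: "{p. d p \<noteq> 0} \<subseteq> fst ` G"
  proof
    fix p assume "p \<in> {p. d p \<noteq> 0}"
    then have "card {v. (p, v) \<in> G} \<noteq> 0" using le[of p] by simp
    then have "{v. (p, v) \<in> G} \<noteq> {}" by (metis card.empty)
    then show "p \<in> fst ` G" by force
  qed
  then show fin: "finite {p. vectorspace.dim k (quot_space (S p) (xy_rad C p)) \<noteq> 0}"
    unfolding d_def[symmetric] using finG finite_subset by blast
  have finH: "finite {v. (p, v) \<in> G}" for p
    by (rule finite_subset[of _ "snd ` G"]) (use finG in force)+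
  have "beta0 k C = (\<Sum>p | d p \<noteq> 0. d p)" by (simp add: beta0_def d_def)
  also have "\<dots> \<le> (\<Sum>p\<in>fst ` G. d p)" by (rule sum_mono2) (use finG sub in auto)
  also have "\<dots> \<le> (\<Sum>p\<in>fst ` G. card {v. (p, v) \<in> G})" by (rule sum_mono) (rule le)
  also have "\<dots> = card (Sigma (fst ` G) (\<lambda>p. {v. (p, v) \<in> G}))"
    by (rule card_SigmaI[symmetric]) (use finG finH in auto)
  also have "Sigma (fst ` G) (\<lambda>p. {v. (p, v) \<in> G}) = G" by force
  finally show "beta0 k C \<le> card G" .
qed

text \<open>Every element at \<open>q\<close> is a combination of images of generators, and all of
  these images pass through \<open>p\<close>.\<close>

lemma generated_surj:
  assumes G: "generates k C G" and le: "p \<le> q"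
    and far: "\<And>r v. (r, v) \<in> G \<Longrightarrow> r \<le> q \<Longrightarrow> r \<le> p"
  shows "smap C p q ` carrier (S p) = carrier (S q)"
proof
  show "smap C p q ` carrier (S p) \<subseteq> carrier (S q)" using smap_closed[OF le] by blast
  have "{smap C r q v | r v. (r, v) \<in> G \<and> r \<le> q} \<subseteq> smap C p q ` carrier (S p)"
  proof
    fix x assume "x \<in> {smap C r q v | r v. (r, v) \<in> G \<and> r \<le> q}"
    then obtain r v where v: "(r, v) \<in> G" "r \<le> q" "x = smap C r q v" by blast
    have c: "v \<in> carrier (S r)" by (rule generator_carrier[OF G v(1)])
    have rp: "r \<le> p" by (rule far[OF v(1,2)])
    have "x = smap C p q (smap C r p v)" using smap_comp[OF rp le c] v(3) by simp
    then show "x \<in> smap C p q ` carrier (S p)" using smap_closed[OF rp c] by blast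
  qed
  then show "carrier (S q) \<subseteq> smap C p q ` carrier (S p)"
    unfolding generates_span[OF G, of q] by (rule vectorspace.span_le[OF vs _ image_sub[OF le]])
qed

end

section \<open>The cokernel of \<open>xy\<close> and its birth-curves\<close>

locale fg_rep = pfd_rep k M for k :: "('a, 'b) ring_scheme" and M :: "('a, 'v) rep" +
  fixes G
  assumes G: "generates k M G"
begin

text \<open>The image of \<open>xy\<close>, written by functoriality as the image of a single
  structure map; its stability under all structure maps is then again functoriality.\<close>

definition XY :: "int \<times> int \<Rightarrow> 'v set" where
  "XY p = smap M (p - (1,1)) p ` carrier (S (p - (1,1)))"

lemma pred11_le: "p - (1,1) \<le> p" for p :: "int \<times> int"
  by (simp add: less_eq_prod_def)

lemma XY_sub: "subspace k (XY p) (S p)"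
  unfolding XY_def by (rule image_sub[OF pred11_le])

lemma XY_map:
  assumes le: "p \<le> q"
  shows "smap M p q ` XY p \<subseteq> XY q"
proof
  fix x assume "x \<in> smap M p q ` XY p"
  then obtain v where v: "v \<in> carrier (S (p - (1,1)))" "x = smap M p q (smap M (p - (1,1)) p v)"
    unfolding XY_def by blast
  have l: "p - (1,1) \<le> q - (1,1)" using le by (simp add: less_eq_prod_def)
  have "x = smap M (q - (1,1)) q (smap M (p - (1,1)) (q - (1,1)) v)"
    using v smap_comp[OF pred11_le le v(1)] smap_comp[OF l pred11_le v(1)] by simp
  then show "x \<in> XY q" unfolding XY_def using smap_closed[OF l v(1)] by blast
qed

sublocale quot: quotient_rep k M "\<lambda>p. carrier (S p)" XY
proof (intro quotient_rep.intro quotient_rep_axioms.intro)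
  show "pfd_rep k M" by (rule pfd_rep_axioms)
  show "subspace k (carrier (S p)) (S p)" for p by (rule vectorspace.subspace_carrier[OF vs])
  show "subspace k (XY p) (S p)" for p by (rule XY_sub)
  show "smap M p q ` carrier (S p) \<subseteq> carrier (S q)" if "p \<le> q" for p q using smap_closed[OF that] by blast
  show "smap M p q ` XY p \<subseteq> XY q" if "p \<le> q" for p q by (rule XY_map[OF that])
qed

lemma coker_eq: "coker (shift (-1,-1) M) M (xy_mor M) = quot.QR"
proof -
  have W: "xy_mor M p ` carrier (Space (shift (-1,-1) M) p) = XY p" for p
  proof -
    have e: "p + (-1,-1) = p - (1,1)" "p - (1,1) + (0,1) = p - (1,0)" "p - (1,0) + (1,0) = p"
      by (simp_all add: prod_eq_iff)
    have l: "p - (1,1) \<le> p - (1,0)" by (simp add: less_eq_prod_def)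
    have "xy_mor M p ` carrier (Space (shift (-1,-1) M) p)
        = (\<lambda>v. smap M (p - (1,0)) p (smap M (p - (1,1)) (p - (1,0)) v)) ` carrier (S (p - (1,1)))"
      unfolding xy_mor_def x_act_def y_act_def shift_def by (simp add: e image_comp comp_def)
    also have "\<dots> = XY p"
      unfolding XY_def using smap_comp[OF l pred_le(1)] by (intro image_cong refl) blast
    finally show ?thesis .
  qed
  show ?thesis unfolding coker_def W quot_rep_def Let_def carrier_update_self ..
qed

sublocale coker: pfd_rep k quot.QR
  by unfold_locales (rule quot.rep2_QR)

lemma QR_generates: "generates k quot.QR ((\<lambda>(p, v). (p, quot.pr p v)) ` G)"
  unfolding generates_def
proof (intro conjI allI)
  show "finite ((\<lambda>(p, v). (p, quot.pr p v)) ` G)" using G by (simp add: generates_def)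
  show "\<forall>(p, v)\<in>(\<lambda>(p, v). (p, quot.pr p v)) ` G. v \<in> carrier (quot.QS p)"
    using generator_carrier[OF G] quot.QS_carrier by fastforce
  show "carrier (quot.QS q) = module.span k (quot.QS q)
      {smap quot.QR p q v | p v. (p, v) \<in> (\<lambda>(p, v). (p, quot.pr p v)) ` G \<and> p \<le> q}" for q
    by (rule quot.QR_generated) (use generator_carrier[OF G] generates_span[OF G] in blast)+
qed

lemma decomposition_of_coker:
  "\<exists>(J :: ((int \<times> int) \<times> 'v set) set set) I e. coker.decomposes J I e"
proof -
  have finG: "finite G" using G by (simp add: generates_def)
  \<comment> \<open>Inserting zero covers an empty \<open>G\<close>; adding one makes the bound
    strict and gives \<open>D \<ge> 1\<close>.\<close>
  define D where "D = Max (insert 0 ((\<lambda>g. \<bar>lev (fst g)\<bar>) ` G)) + 1"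
  have lt: "\<bar>lev (fst g)\<bar> < D" if "g \<in> G" for g
    using Max_ge[of "insert 0 ((\<lambda>g. \<bar>lev (fst g)\<bar>) ` G)" "\<bar>lev (fst g)\<bar>"] that finG by (simp add: D_def)
  have D1: "D \<ge> 1" using Max_ge[of "insert 0 ((\<lambda>g. \<bar>lev (fst g)\<bar>) ` G)" 0] finG by (simp add: D_def)
  have lt': "\<bar>lev r\<bar> < D" if rX: "(r, X) \<in> (\<lambda>(p, v). (p, quot.pr p v)) ` G" for r X
  proof -
    obtain g where "g \<in> G" "r = fst g" using rX by force
    then show ?thesis using lt by simp
  qed
  interpret xy: xy_null_rep k quot.QR D
  proof
    show "D \<ge> 1" by (rule D1)
    fix p X assume "X \<in> carrier (quot.QS p)"
    then obtain v where v: "v \<in> carrier (S p)" "X = quot.pr p v" unfolding quot.QS_carrier by blast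
    have l: "p \<le> p + (1,1)" by (simp add: less_eq_prod_def)
    have "smap M p (p + (1,1)) v \<in> XY (p + (1,1))" unfolding XY_def using v(1) by simp
    then show "smap quot.QR p (p + (1,1)) X = \<zero>\<^bsub>quot.QS (p + (1,1))\<^esub>"
      using quot.QR_smap[OF l v(1)] quot.pr_zero_iff[OF smap_closed[OF l v(1)]] v(2) by simp
  next
    fix p :: "int \<times> int" assume p: "lev p \<ge> D"
    show "smap quot.QR p (p + (1,0)) ` carrier (quot.QS p) = carrier (quot.QS (p + (1,0)))"
    proof (rule coker.generated_surj[OF QR_generates])
      show "p \<le> p + (1,0)" by (simp add: less_eq_prod_def)
      \<comment> \<open>A generator below \<open>p + (1,0)\<close> but not below \<open>p\<close>
        would lie in the next column and no higher than \<open>p\<close>, so its level would exceed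
        \<open>D\<close>.\<close>
      fix r X assume r: "(r, X) \<in> (\<lambda>(p, v). (p, quot.pr p v)) ` G" "r \<le> p + (1,0)"
      then show "r \<le> p" using lt'[OF r(1)] p by (auto simp: less_eq_prod_def)
    qed
  next
    fix p :: "int \<times> int" assume p: "lev p \<le> - D"
    show "smap quot.QR p (p + (0,1)) ` carrier (quot.QS p) = carrier (quot.QS (p + (0,1)))"
    proof (rule coker.generated_surj[OF QR_generates])
      show "p \<le> p + (0,1)" by (simp add: less_eq_prod_def)
      fix r X assume r: "(r, X) \<in> (\<lambda>(p, v). (p, quot.pr p v)) ` G" "r \<le> p + (0,1)"
      then show "r \<le> p" using lt'[OF r(1)] p by (auto simp: less_eq_prod_def)
    qed
  qed
  show ?thesis by (rule xy.decomposition_exists)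
qed

lemma birth_curvesI: "coker.decomposes J I e \<Longrightarrow> birth_curves k M J I"
  unfolding birth_curves_def coker_eq
  using coker.decomposes_rep_iso[of J I e] by (simp add: coker.decomposes_def)

text \<open>At a minimal point of a curve, its coordinate vanishes on \<open>xM + yM\<close>, since
  the curve contains neither the left nor the lower neighbour. A lift of the unit vector has
  coordinate one, so the curves assigned to one point give independent classes there. The family is
  arbitrary and may a priori be infinite.\<close>

lemma birth_curves_count:
  fixes J :: "'j set"
  assumes bc: "birth_curves k M J I"
  shows "finite J" "card J \<le> beta0 k M"
proof -
  let ?D = "direct_sum_rep J (\<lambda>j. spread_rep k (I j))"
  interpret field k using vs[of undefined] by (simp add: vectorspace_def)
  obtain \<phi> where hom: "\<And>p. \<phi> p \<in> module_hom k (quot.QS p) (Space ?D p)"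
    and bij: "\<And>p. bij_betw (\<phi> p) (carrier (quot.QS p)) (carrier (Space ?D p))"
    and comm: "\<And>p q v. p \<le> q \<Longrightarrow> v \<in> carrier (quot.QS p) \<Longrightarrow> \<phi> q (smap quot.QR p q v) = smap ?D p q (\<phi> p v)"
    using bc unfolding birth_curves_def coker_eq rep_iso_def by blast
  \<comment> \<open>Coordinates are read on \<open>M\<close> itself and not on the cokernel, so that
    they can be compared with \<open>xM + yM\<close> inside \<open>M\<close>.\<close>
  define f where "f p v = \<phi> p (quot.pr p v)" for p v
  have prc: "quot.pr p v \<in> carrier (quot.QS p)" if "v \<in> carrier (S p)" for p v
    using that quot.QS_carrier by blast
  have f_add: "f p (u \<oplus>\<^bsub>S p\<^esub> v) j = f p u j \<oplus>\<^bsub>k\<^esub> f p v j"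
    if "u \<in> carrier (S p)" "v \<in> carrier (S p)" "j \<in> J" for p u v j
  proof -
    interpret P: linear_map k "S p\<lparr>carrier := carrier (S p)\<rparr>" "quot.QS p" "quot.pr p" by (rule quot.pr_linear)
    have "quot.pr p (u \<oplus>\<^bsub>S p\<^esub> v) = quot.pr p u \<oplus>\<^bsub>quot.QS p\<^esub> quot.pr p v"
      using P.T_add[of u v] that by simp
    then have "f p (u \<oplus>\<^bsub>S p\<^esub> v) = f p u \<oplus>\<^bsub>Space ?D p\<^esub> f p v"
      unfolding f_def using module_hom_add[OF hom prc[OF that(1)] prc[OF that(2)]] by simp
    then show ?thesis using that(3) by (simp add: direct_sum_rep_def spread_rep_def)
  qed
  have f_smult: "f p (a \<odot>\<^bsub>S p\<^esub> v) j = a \<otimes>\<^bsub>k\<^esub> f p v j"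
    if "a \<in> carrier k" "v \<in> carrier (S p)" "j \<in> J" for p a v j
  proof -
    interpret P: linear_map k "S p\<lparr>carrier := carrier (S p)\<rparr>" "quot.QS p" "quot.pr p" by (rule quot.pr_linear)
    have "quot.pr p (a \<odot>\<^bsub>S p\<^esub> v) = a \<odot>\<^bsub>quot.QS p\<^esub> quot.pr p v"
      using P.T_smult[of a v] that by simp
    then have "f p (a \<odot>\<^bsub>S p\<^esub> v) = a \<odot>\<^bsub>Space ?D p\<^esub> f p v"
      unfolding f_def using module_hom_smult[OF hom that(1) prc[OF that(2)]] by simp
    then show ?thesis using that(3) by (simp add: direct_sum_rep_def spread_rep_def)
  qed
  have f_smap: "f q (smap M p q v) j = (if p \<in> I j \<and> q \<in> I j then f p v j else \<zero>\<^bsub>k\<^esub>)"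
    if "p \<le> q" "v \<in> carrier (S p)" "j \<in> J" for p q v j
    using comm[OF that(1) prc[OF that(2)]] quot.QR_smap[OF that(1,2)] that(3)
    by (simp add: f_def direct_sum_rep_def spread_rep_def)
  define ind where "ind p j = (\<lambda>i\<in>J. if i = j then \<one>\<^bsub>k\<^esub> else \<zero>\<^bsub>k\<^esub>)" for p :: "int \<times> int" and j
  have ex: "\<exists>v. v \<in> carrier (S p) \<and> f p v = ind p j" if j: "j \<in> J" "p \<in> I j" for p j
  proof -
    have "finite {i \<in> J. ind p j i \<noteq> \<zero>\<^bsub>k\<^esub>}"
      by (rule finite_subset[of _ "{j}"]) (auto simp: ind_def)
    then have "ind p j \<in> carrier (Space ?D p)"
      using j by (auto simp: direct_sum_rep_def spread_rep_def ind_def PiE_iff)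
    moreover have "\<phi> p ` carrier (quot.QS p) = carrier (Space ?D p)"
      using bij[of p] unfolding bij_betw_def by (rule conjunct2)
    ultimately have "ind p j \<in> \<phi> p ` carrier (quot.QS p)" by simp
    then obtain X where X: "X \<in> carrier (quot.QS p)" "ind p j = \<phi> p X" by (rule imageE)
    obtain v where "v \<in> carrier (S p)" "X = quot.pr p v" using X(1) unfolding quot.QS_carrier by blast
    then have "v \<in> carrier (S p) \<and> f p v = ind p j" using X(2) by (simp add: f_def)
    then show ?thesis by blast
  qed
  \<comment> \<open>\<open>m p j\<close> is a lift to \<open>M\<close> of the unit vector of the
    curve \<open>j\<close>; the kernel of the coordinate \<open>j\<close> will be
    \<open>U p j\<close>. Together they form the dual system that
    \<open>card_le_dim_quotient\<close> asks for.\<close>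
  define m where "m p j = (SOME v. v \<in> carrier (S p) \<and> f p v = ind p j)" for p j
  have m: "m p j \<in> carrier (S p)" "f p (m p j) = ind p j" if "j \<in> J" "p \<in> I j" for p j
    using someI_ex[OF ex[OF that]] unfolding m_def by (rule conjunct1, rule conjunct2)
  have zero_f: "f p \<zero>\<^bsub>S p\<^esub> j = \<zero>\<^bsub>k\<^esub>" if "j \<in> J" for p j
  proof -
    interpret V: vectorspace k "S p" by (rule vs)
    have "f p \<zero>\<^bsub>S p\<^esub> j \<in> carrier k"
    proof -
      have "f p \<zero>\<^bsub>S p\<^esub> \<in> carrier (Space ?D p)"
        unfolding f_def using bij[of p] prc[of "\<zero>\<^bsub>S p\<^esub>" p] by (auto simp: bij_betw_def)
      then show ?thesis using that by (auto simp: direct_sum_rep_def spread_rep_def PiE_iff split: if_splits)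
    qed
    then show ?thesis using f_smult[of "\<zero>\<^bsub>k\<^esub>" "\<zero>\<^bsub>S p\<^esub>" p j] that by simp
  qed
  define U where "U p j = {v \<in> carrier (S p). f p v j = \<zero>\<^bsub>k\<^esub>}" for p j
  have U_sub: "subspace k (U p j) (S p)" if "j \<in> J" for p j
  proof -
    interpret V: vectorspace k "S p" by (rule vs)
    show ?thesis
      by (rule V.subspaceI) (use that f_add f_smult zero_f in \<open>auto simp: U_def\<close>)
  qed
  \<comment> \<open>A point of a curve carries a nonzero vector, hence lies above some generator, so
    the coordinate sums on curves are bounded below by \<open>c\<close>. In particular a curve
    forces \<open>G\<close> to be nonempty, and \<open>Min\<close> is then meaningful.\<close>
  define c where "c = Min ((\<lambda>g. fst (fst g) + snd (fst g)) ` G)"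
  have finG: "finite G" using G by (simp add: generates_def)
  have low: "c \<le> fst p + snd p" if j: "j \<in> J" "p \<in> I j" for p j
  proof -
    interpret V: vectorspace k "S p" by (rule vs)
    have "\<exists>q v. (q, v) \<in> G \<and> q \<le> p"
    proof (rule ccontr)
      assume "\<nexists>q v. (q, v) \<in> G \<and> q \<le> p"
      then have emp: "{smap M q p v | q v. (q, v) \<in> G \<and> q \<le> p} = {}" by blast
      have "carrier (S p) = V.span {}" using generates_span[OF G, of p] unfolding emp .
      then have "carrier (S p) = {\<zero>\<^bsub>S p\<^esub>}" unfolding V.span_empty .
      then have "m p j = \<zero>\<^bsub>S p\<^esub>" using m(1)[OF j] by blast
      then have "ind p j j = \<zero>\<^bsub>k\<^esub>" using m(2)[OF j] zero_f[OF j(1)] by metis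
      then show False using j(1) by (simp add: ind_def)
    qed
    then obtain q v where q: "(q, v) \<in> G" "q \<le> p" by blast
    have "c \<le> fst q + snd q" unfolding c_def by (rule Min_le) (use finG q in force)+
    then show ?thesis using q(2) by (simp add: less_eq_prod_def)
  qed
  have "\<exists>p. p \<in> I j \<and> p - (1,0) \<notin> I j \<and> p - (0,1) \<notin> I j" if j: "j \<in> J" for j
  proof -
    have "I j \<noteq> {}" using bc j unfolding birth_curves_def spread_curve_def by blast
    then obtain p0 where "p0 \<in> I j" by blast
    \<comment> \<open>By \<open>low\<close> the difference is nonnegative on the curve, so
      \<open>nat\<close> truncates nothing and a step to the left or lower neighbour would decrease
      the measure.\<close>
    then obtain p where p: "p \<in> I j" "\<And>q. q \<in> I j \<Longrightarrow> nat (fst p + snd p - c) \<le> nat (fst q + snd q - c)"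
      using ex_has_least_nat[of "\<lambda>p. p \<in> I j" p0 "\<lambda>p. nat (fst p + snd p - c)"] by blast
    have "p - (1,0) \<notin> I j"
    proof
      assume h: "p - (1,0) \<in> I j"
      show False using p(2)[OF h] low[OF j h] by simp
    qed
    moreover have "p - (0,1) \<notin> I j"
    proof
      assume h: "p - (0,1) \<in> I j"
      show False using p(2)[OF h] low[OF j h] by simp
    qed
    ultimately show ?thesis using p(1) by blast
  qed
  then obtain b where b: "\<And>j. j \<in> J \<Longrightarrow> b j \<in> I j" "\<And>j. j \<in> J \<Longrightarrow> b j - (1,0) \<notin> I j"
    "\<And>j. j \<in> J \<Longrightarrow> b j - (0,1) \<notin> I j" by metis
  define d where "d p = vectorspace.dim k (quot_space (S p) (xy_rad M p))" for p
  define Jp where "Jp p = {j \<in> J. b j = p}" for p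
  \<comment> \<open>Stated for finite subsets, because the finiteness of \<open>Jp p\<close> is
    itself deduced from this bound.\<close>
  have bound: "card F \<le> d p" if F: "finite F" "F \<subseteq> Jp p" for F p
    unfolding d_def
  proof (rule card_le_dim_quotient[OF vs fd xy_rad_sub F(1), where m = "m p" and U = "U p"])
    have FJ: "j \<in> J" "p \<in> I j" "p - (1,0) \<notin> I j" "p - (0,1) \<notin> I j" if "j \<in> F" for j
      using that F(2) b[of j] by (auto simp: Jp_def)
    show "m p i \<in> carrier (S p)" if "i \<in> F" for i using m(1) FJ[OF that] by blast
    show "subspace k (U p i) (S p)" if "i \<in> F" for i using U_sub FJ(1)[OF that] by blast
    show "xy_rad M p \<subseteq> U p i" if i: "i \<in> F" for i
    proof (rule xy_rad_least[OF U_sub[OF FJ(1)[OF i]]])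
      show "smap M (p - (1,0)) p ` carrier (S (p - (1,0))) \<subseteq> U p i"
      proof
        fix x assume "x \<in> smap M (p - (1,0)) p ` carrier (S (p - (1,0)))"
        then obtain v where v: "v \<in> carrier (S (p - (1,0)))" "x = smap M (p - (1,0)) p v" by blast
        have "f p x i = \<zero>\<^bsub>k\<^esub>" using f_smap[OF pred_le(1) v(1) FJ(1)[OF i]] FJ(3)[OF i] v(2) by simp
        then show "x \<in> U p i" using smap_closed[OF pred_le(1) v(1)] v(2) by (simp add: U_def)
      qed
      show "smap M (p - (0,1)) p ` carrier (S (p - (0,1))) \<subseteq> U p i"
      proof
        fix x assume "x \<in> smap M (p - (0,1)) p ` carrier (S (p - (0,1)))"
        then obtain v where v: "v \<in> carrier (S (p - (0,1)))" "x = smap M (p - (0,1)) p v" by blast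
        have "f p x i = \<zero>\<^bsub>k\<^esub>" using f_smap[OF pred_le(2) v(1) FJ(1)[OF i]] FJ(4)[OF i] v(2) by simp
        then show "x \<in> U p i" using smap_closed[OF pred_le(2) v(1)] v(2) by (simp add: U_def)
      qed
    qed
    show "m p j \<in> U p i" if "i \<in> F" "j \<in> F" "j \<noteq> i" for i j
      using m FJ[OF that(1)] FJ[OF that(2)] that(3) by (simp add: U_def ind_def)
    show "m p i \<notin> U p i" if "i \<in> F" for i
      using m FJ[OF that] by (simp add: U_def ind_def)
  qed
  have finJp: "finite (Jp p)" for p
  proof (rule ccontr)
    assume "infinite (Jp p)"
    then obtain F where F: "finite F" "F \<subseteq> Jp p" "card F = Suc (d p)"
      using infinite_arbitrarily_large by metis
    then show False using bound[OF F(1,2)] by simp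
  qed
  have supp: "d p \<noteq> 0" if "j \<in> Jp p" for j p using bound[of "{j}" p] that by simp
  have fins: "finite {p. d p \<noteq> 0}" unfolding d_def by (rule beta0_le_card(1)[OF G])
  \<comment> \<open>The chosen minimal point of each curve has a nonzero quotient by
    \<open>xM + yM\<close>, so the curves are distributed over the finite support of
    \<open>beta0\<close>.\<close>
  have Jeq: "J = (\<Union>p\<in>{p. d p \<noteq> 0}. Jp p)" using supp by (auto simp: Jp_def)
  show "finite J" by (subst Jeq) (use fins finJp in blast)
  have "card J \<le> (\<Sum>p | d p \<noteq> 0. card (Jp p))"
    by (subst Jeq) (rule card_UN_le[OF fins])
  also have "\<dots> \<le> (\<Sum>p | d p \<noteq> 0. d p)" by (rule sum_mono) (rule bound[OF finJp subset_refl])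
  finally show "card J \<le> beta0 k M" by (simp add: beta0_def d_def)
qed

text \<open>\<open>N2\<close> chooses among families indexed by \<open>{..<n}\<close>, so the
  decomposition is renumbered to show that such an \<open>n\<close> exists; the count then applies
  to whichever number is chosen.\<close>

lemma N2_le_beta0: "N2 k M \<le> beta0 k M"
proof -
  obtain J :: "((int \<times> int) \<times> 'v set) set set" and I e where dec: "coker.decomposes J I e"
    using decomposition_of_coker by blast
  have finJ: "finite J" by (rule birth_curves_count(1)[OF birth_curvesI[OF dec]])
  obtain h where h: "bij_betw h {0..<card J} J" using ex_bij_betw_nat_finite[OF finJ] by blast
  then have h: "inj_on h {..<card J}" "h ` {..<card J} = J" by (auto simp: bij_betw_def lessThan_atLeast0)
  have hJ: "h j \<in> J" if "j \<in> {..<card J}" for j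
    using imageI[OF that, of h] unfolding h(2) .
  have im: "(\<lambda>j. e (h j) p) ` {j \<in> {..<card J}. p \<in> I (h j)} = (\<lambda>j. e j p) ` {j \<in> J. p \<in> I j}" for p
  proof -
    have "{j \<in> h ` {..<card J}. p \<in> I j} = h ` {j \<in> {..<card J}. p \<in> I (h j)}" by blast
    then have "{j \<in> J. p \<in> I j} = h ` {j \<in> {..<card J}. p \<in> I (h j)}" unfolding h(2) .
    then show ?thesis by (simp add: image_image)
  qed
  have "coker.decomposes {..<card J} (\<lambda>j. I (h j)) (\<lambda>j. e (h j))"
    unfolding coker.decomposes_def
  proof (intro conjI ballI allI impI)
    show "spread_curve (I (h j))" if "j \<in> {..<card J}" for j
      using dec hJ[OF that] unfolding coker.decomposes_def by blast
    show "vectorspace.basis k (quot.QS p) ((\<lambda>j. e (h j) p) ` {j \<in> {..<card J}. p \<in> I (h j)})" for p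
      unfolding im using dec unfolding coker.decomposes_def by blast
    show "inj_on (\<lambda>j. e (h j) p) {j \<in> {..<card J}. p \<in> I (h j)}" for p
    proof (rule inj_onI)
      fix i j assume ij: "i \<in> {j \<in> {..<card J}. p \<in> I (h j)}" "j \<in> {j \<in> {..<card J}. p \<in> I (h j)}" "e (h i) p = e (h j) p"
      have "inj_on (\<lambda>j. e j p) {j \<in> J. p \<in> I j}" using dec unfolding coker.decomposes_def by blast
      moreover have "h i \<in> {j \<in> J. p \<in> I j}" "h j \<in> {j \<in> J. p \<in> I j}" using ij(1,2) hJ by simp_all
      ultimately have "h i = h j" using ij(3) by (simp add: inj_on_def)
      then show "i = j" using inj_onD[OF h(1)] ij by simp
    qed
    show "smap quot.QR p q (e (h j) p) = (if q \<in> I (h j) then e (h j) q else \<zero>\<^bsub>quot.QS q\<^esub>)"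
      if "p \<le> q" "j \<in> {..<card J}" "p \<in> I (h j)" for p q j
    proof -
      have "h j \<in> J" by (rule hJ[OF that(2)])
      then show ?thesis using dec that(1,3) unfolding coker.decomposes_def by blast
    qed
  qed
  from birth_curvesI[OF this] have "\<exists>n::nat. \<exists>I. birth_curves k M {..<n} I" by blast
  then have "\<exists>I. birth_curves k M {..<N2 k M} I" unfolding N2_def by (rule someI_ex)
  then show ?thesis using birth_curves_count(2) by fastforce
qed

end

section \<open>Homology of bifiltered complexes\<close>

lemma chains_simps [simp]:
  "\<zero>\<^bsub>chains k T n\<^esub> = (\<lambda>\<sigma>. \<zero>\<^bsub>k\<^esub>)"
  "c \<oplus>\<^bsub>chains k T n\<^esub> d = (\<lambda>\<sigma>. c \<sigma> \<oplus>\<^bsub>k\<^esub> d \<sigma>)"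
  "a \<odot>\<^bsub>chains k T n\<^esub> c = (\<lambda>\<sigma>. a \<otimes>\<^bsub>k\<^esub> c \<sigma>)"
  by (simp_all add: chains_def)

lemma chains_carrier:
  "c \<in> carrier (chains k T n) \<longleftrightarrow>
     (\<forall>\<sigma>. (\<sigma> \<in> simplices n T \<longrightarrow> c \<sigma> \<in> carrier k) \<and> (\<sigma> \<notin> simplices n T \<longrightarrow> c \<sigma> = \<zero>\<^bsub>k\<^esub>))"
  by (auto simp: chains_def)

text \<open>Chain records of different complexes differ only in the carrier, so the chains of a
  subcomplex are literally a subspace of the chains of \<open>K\<close>, with the induced
  structure.\<close>

lemma chains_carrier_update:
  "chains k K n\<lparr>carrier := carrier (chains k T n)\<rparr> = chains k T n"
  by (simp add: chains_def)

section \<open>Simplicial chains and the boundary over a field\<close>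

context field begin

lemma chains_val: "c \<in> carrier (chains R T n) \<Longrightarrow> c \<sigma> \<in> carrier R"
  unfolding chains_carrier by (cases "\<sigma> \<in> simplices n T") auto

lemma chains_vs: "vectorspace R (chains R T n)"
proof (rule vs_criteria[OF field_axioms])
  show "\<forall>c\<in>carrier (chains R T n). \<exists>d\<in>carrier (chains R T n). c \<oplus>\<^bsub>chains R T n\<^esub> d = \<zero>\<^bsub>chains R T n\<^esub>"
  proof
    fix c assume c: "c \<in> carrier (chains R T n)"
    then have "(\<lambda>\<sigma>. \<ominus> c \<sigma>) \<in> carrier (chains R T n)" by (auto simp: chains_carrier)
    moreover have "c \<oplus>\<^bsub>chains R T n\<^esub> (\<lambda>\<sigma>. \<ominus> c \<sigma>) = \<zero>\<^bsub>chains R T n\<^esub>"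
      using chains_val[OF c] by (simp add: r_neg)
    ultimately show "\<exists>d\<in>carrier (chains R T n). c \<oplus>\<^bsub>chains R T n\<^esub> d = \<zero>\<^bsub>chains R T n\<^esub>" by blast
  qed
qed (auto simp: chains_val a_ac m_assoc l_distr r_distr fun_eq_iff, auto simp: chains_carrier)

lemma chains_span_deltas:
  assumes fin: "finite (simplices n T)"
  shows "carrier (chains R T n) = module.span R (chains R T n) ((\<lambda>\<sigma> \<tau>. if \<tau> = \<sigma> then \<one> else \<zero>) ` simplices n T)"
proof -
  interpret V: vectorspace R "chains R T n" by (rule chains_vs)
  let ?\<delta> = "\<lambda>\<sigma> \<tau>. if \<tau> = \<sigma> then \<one> else \<zero>"
  have dc: "?\<delta> ` simplices n T \<subseteq> carrier (chains R T n)" by (auto simp: chains_carrier)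
  have key: "c \<in> V.span (?\<delta> ` X)"
    if "finite X" "X \<subseteq> simplices n T" "\<forall>\<sigma>\<in>X. c \<sigma> \<in> carrier R" "\<forall>\<sigma>. \<sigma> \<notin> X \<longrightarrow> c \<sigma> = \<zero>" for X c
    using that
  proof (induction X arbitrary: c rule: finite_induct)
    case empty
    then have "c = \<zero>\<^bsub>chains R T n\<^esub>" by (simp add: fun_eq_iff)
    then show ?case using V.span_zero by metis
  next
    case (insert \<sigma> X)
    have Xc: "?\<delta> ` insert \<sigma> X \<subseteq> carrier (chains R T n)" using dc insert(4) by blast
    define d where "d = (\<lambda>\<tau>. if \<tau> = \<sigma> then \<zero> else c \<tau>)"
    have "d \<in> V.span (?\<delta> ` X)"
      by (rule insert.IH) (use insert in \<open>auto simp: d_def\<close>)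
    then have 1: "d \<in> V.span (?\<delta> ` insert \<sigma> X)"
      using V.module.span_is_monotone[of "?\<delta> ` X" "?\<delta> ` insert \<sigma> X"] by blast
    have cs: "c \<sigma> \<in> carrier R" using insert by simp
    have "?\<delta> \<sigma> \<in> V.span (?\<delta> ` insert \<sigma> X)" using V.module.in_own_span[OF Xc] by blast
    then have 2: "c \<sigma> \<odot>\<^bsub>chains R T n\<^esub> ?\<delta> \<sigma> \<in> V.span (?\<delta> ` insert \<sigma> X)"
      using V.subspaceD(4)[OF V.span_is_subspace[OF Xc] cs] by blast
    have ct: "c \<tau> \<in> carrier R" for \<tau> using insert by (cases "\<tau> \<in> insert \<sigma> X") auto
    have "c = d \<oplus>\<^bsub>chains R T n\<^esub> (c \<sigma> \<odot>\<^bsub>chains R T n\<^esub> ?\<delta> \<sigma>)"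
      using ct cs by (auto simp: d_def fun_eq_iff)
    then show ?case using V.span_add1[OF Xc 1 2] by metis
  qed
  have "carrier (chains R T n) \<subseteq> V.span (?\<delta> ` simplices n T)"
  proof
    fix c assume "c \<in> carrier (chains R T n)"
    then show "c \<in> V.span (?\<delta> ` simplices n T)"
      by (intro key[OF fin subset_refl]) (simp_all add: chains_carrier)
  qed
  then show ?thesis using V.module.span_is_subset2[OF dc] by blast
qed

lemma chains_fin_dim:
  assumes fin: "finite (simplices n T)"
  shows "vectorspace.fin_dim R (chains R T n)" "vectorspace.dim R (chains R T n) \<le> card (simplices n T)"
proof -
  interpret V: vectorspace R "chains R T n" by (rule chains_vs)
  let ?A = "(\<lambda>\<sigma> \<tau>. if \<tau> = \<sigma> then \<one> else \<zero>) ` simplices n T"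
  have A: "finite ?A" "?A \<subseteq> carrier (chains R T n)" using fin by (auto simp: chains_carrier)
  note sp = chains_span_deltas[OF fin]
  show "vectorspace.fin_dim R (chains R T n)"
    unfolding V.fin_dim_def by (rule exI[of _ ?A]) (use A sp in simp)
  have "V.dim \<le> card ?A" by (rule V.gen_ge_dim[OF A sp[symmetric]])
  also have "\<dots> \<le> card (simplices n T)" by (rule card_image_le[OF fin])
  finally show "V.dim \<le> card (simplices n T)" .
qed

lemma boundary_add:
  fixes c d :: "'v::linorder set \<Rightarrow> 'a"
  assumes "\<And>\<sigma>. c \<sigma> \<in> carrier R" "\<And>\<sigma>. d \<sigma> \<in> carrier R"
  shows "boundary R T (\<lambda>\<sigma>. c \<sigma> \<oplus> d \<sigma>) = (\<lambda>\<tau>. boundary R T c \<tau> \<oplus> boundary R T d \<tau>)"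
proof
  fix \<tau> :: "'v set"
  let ?s = "\<lambda>v. (\<ominus> \<one>) [^] card {w \<in> \<tau>. w < v}"
  have "(\<Oplus>v\<in>A. ?s v \<otimes> (c (insert v \<tau>) \<oplus> d (insert v \<tau>)))
      = (\<Oplus>v\<in>A. ?s v \<otimes> c (insert v \<tau>)) \<oplus> (\<Oplus>v\<in>A. ?s v \<otimes> d (insert v \<tau>))" for A
    using assms by (simp add: r_distr finsum_addf Pi_iff)
  then show "boundary R T (\<lambda>\<sigma>. c \<sigma> \<oplus> d \<sigma>) \<tau> = boundary R T c \<tau> \<oplus> boundary R T d \<tau>"
    unfolding boundary_def by simp
qed

lemma boundary_smult:
  fixes c :: "'v::linorder set \<Rightarrow> 'a"
  assumes "\<And>\<sigma>. c \<sigma> \<in> carrier R" "a \<in> carrier R" and fin: "finite (\<Union>T)"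
  shows "boundary R T (\<lambda>\<sigma>. a \<otimes> c \<sigma>) = (\<lambda>\<tau>. a \<otimes> boundary R T c \<tau>)"
proof
  fix \<tau> :: "'v set"
  let ?s = "\<lambda>v. (\<ominus> \<one>) [^] card {w \<in> \<tau>. w < v}"
  let ?A = "{v. v \<notin> \<tau> \<and> insert v \<tau> \<in> T}"
  have A: "finite ?A" by (rule finite_subset[OF _ fin]) blast
  have "a \<otimes> (\<Oplus>v\<in>?A. ?s v \<otimes> c (insert v \<tau>)) = (\<Oplus>v\<in>?A. a \<otimes> (?s v \<otimes> c (insert v \<tau>)))"
    by (rule finsum_rdistr[OF A assms(2)]) (use assms(1) in auto)
  also have "\<dots> = (\<Oplus>v\<in>?A. ?s v \<otimes> (a \<otimes> c (insert v \<tau>)))"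
    by (rule finsum_cong') (use assms in \<open>auto simp: m_lcomm\<close>)
  finally show "boundary R T (\<lambda>\<sigma>. a \<otimes> c \<sigma>) \<tau> = a \<otimes> boundary R T c \<tau>"
    using assms(2) unfolding boundary_def by simp
qed

lemma boundary_closed:
  assumes "\<And>\<sigma>. c \<sigma> \<in> carrier R"
  shows "boundary R T c \<tau> \<in> carrier R"
  using assms unfolding boundary_def by (auto intro!: finsum_closed)

text \<open>The two sums differ only by cofaces outside \<open>T\<close>, where \<open>c\<close> is
  zero. Boundaries can therefore all be computed in one large complex.\<close>

lemma boundary_cong_complex:
  fixes T :: "'v::linorder set set"
  assumes T: "T \<subseteq> T'" and fin: "finite (\<Union>T')" and c: "c \<in> carrier (chains R T n)"
  shows "boundary R T c = boundary R T' c"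
proof
  fix \<tau> :: "'v set"
  let ?s = "\<lambda>v. (\<ominus> \<one>) [^] card {w \<in> \<tau>. w < v}"
  have "(\<Oplus>v\<in>{v. v \<notin> \<tau> \<and> insert v \<tau> \<in> T}. ?s v \<otimes> c (insert v \<tau>))
      = (\<Oplus>v\<in>{v. v \<notin> \<tau> \<and> insert v \<tau> \<in> T'}. ?s v \<otimes> c (insert v \<tau>))"
  proof (rule add.finprod_mono_neutral_cong_left)
    show "finite {v. v \<notin> \<tau> \<and> insert v \<tau> \<in> T'}" by (rule finite_subset[OF _ fin]) blast
    show "{v. v \<notin> \<tau> \<and> insert v \<tau> \<in> T} \<subseteq> {v. v \<notin> \<tau> \<and> insert v \<tau> \<in> T'}" using T by blast
    fix v assume v: "v \<in> {v. v \<notin> \<tau> \<and> insert v \<tau> \<in> T'} - {v. v \<notin> \<tau> \<and> insert v \<tau> \<in> T}"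
    then have "insert v \<tau> \<notin> simplices n T" by (auto simp: simplices_def)
    then have "c (insert v \<tau>) = \<zero>" using c by (simp add: chains_carrier)
    then show "?s v \<otimes> c (insert v \<tau>) = \<zero>" by simp
  qed (use chains_val[OF c] in auto)
  then show "boundary R T c \<tau> = boundary R T' c \<tau>" unfolding boundary_def by simp
qed

text \<open>A coface that contributes to the coefficient at \<open>\<tau>\<close> has
  \<open>\<tau>\<close> as a face with one vertex fewer, which is then a simplex of the
  complex.\<close>

lemma boundary_chain:
  fixes T :: "'v::linorder set set"
  assumes T: "\<And>\<sigma> \<tau>. \<sigma> \<in> T \<Longrightarrow> \<tau> \<subseteq> \<sigma> \<Longrightarrow> \<tau> \<noteq> {} \<Longrightarrow> \<tau> \<in> T" and fin: "\<And>\<sigma>. \<sigma> \<in> T \<Longrightarrow> finite \<sigma>"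
    and c: "c \<in> carrier (chains R T (Suc n))"
  shows "boundary R T c \<in> carrier (chains R T n)"
  unfolding chains_carrier
proof (intro allI conjI impI)
  fix \<tau> assume \<tau>: "\<tau> \<notin> simplices n T"
  let ?s = "\<lambda>v. (\<ominus> \<one>) [^] card {w \<in> \<tau>. w < v}"
  show "boundary R T c \<tau> = \<zero>"
  proof (cases "\<tau> = {}")
    case True
    then show ?thesis by (simp add: boundary_def)
  next
    case False
    have "c (insert v \<tau>) = \<zero>" if v: "v \<notin> \<tau>" "insert v \<tau> \<in> T" for v
    proof -
      have "\<tau> \<in> T" using T[OF v(2) _ False] by blast
      moreover have "finite \<tau>" using fin[OF v(2)] by simp
      ultimately have "insert v \<tau> \<notin> simplices (Suc n) T" using \<tau> v(1) by (auto simp: simplices_def)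
      then show ?thesis using c by (simp add: chains_carrier)
    qed
    then have "(\<Oplus>v\<in>{v. v \<notin> \<tau> \<and> insert v \<tau> \<in> T}. ?s v \<otimes> c (insert v \<tau>))
        = (\<Oplus>v\<in>{v. v \<notin> \<tau> \<and> insert v \<tau> \<in> T}. \<zero>)"
      by (intro finsum_cong') auto
    then show ?thesis using False by (simp add: boundary_def)
  qed
qed (use boundary_closed chains_val[OF c] in blast)

end

section \<open>Cycles and homology of a bifiltered complex\<close>

locale bifiltration =
  fixes k :: "('a, 'b) ring_scheme" and K :: "'v::linorder set set" and f :: "'v set \<Rightarrow> int \<times> int" and n :: nat
  assumes field: "field k" and complex: "bifiltered_complex K f"
begin

sublocale field k by (rule field)

definition sub :: "int \<times> int \<Rightarrow> 'v set set" where
  "sub p = {\<sigma> \<in> K. f \<sigma> \<le> p}"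

abbreviation "V \<equiv> chains k K n"

definition chain_rep :: "('a, 'v set \<Rightarrow> 'a) rep" where
  "chain_rep = \<lparr>Space = (\<lambda>p. chains k (sub p) n), smap = (\<lambda>p q c. c)\<rparr>"

lemma finK: "finite K" and fin_simplex: "\<sigma> \<in> K \<Longrightarrow> finite \<sigma>"
  and face: "\<sigma> \<in> K \<Longrightarrow> \<tau> \<subseteq> \<sigma> \<Longrightarrow> \<tau> \<noteq> {} \<Longrightarrow> \<tau> \<in> K"
  and mono: "\<sigma> \<in> K \<Longrightarrow> \<tau> \<in> K \<Longrightarrow> \<sigma> \<subseteq> \<tau> \<Longrightarrow> f \<sigma> \<le> f \<tau>"
  using complex unfolding bifiltered_complex_def by blast+

lemma finUK: "finite (\<Union>K)"
  using finK fin_simplex by blast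

lemma sub_K: "sub p \<subseteq> K"
  by (auto simp: sub_def)

lemma sub_mono: "p \<le> q \<Longrightarrow> sub p \<subseteq> sub q"
  by (auto simp: sub_def)

lemma finUsub: "finite (\<Union>(sub p))"
  using finite_subset[OF Union_mono[OF sub_K] finUK] .

lemma fin_simplices: "T \<subseteq> K \<Longrightarrow> finite (simplices m T)"
  using finite_subset[OF _ finK] by (auto simp: simplices_def)

lemma face_sub: "\<sigma> \<in> sub p \<Longrightarrow> \<tau> \<subseteq> \<sigma> \<Longrightarrow> \<tau> \<noteq> {} \<Longrightarrow> \<tau> \<in> sub p"
  unfolding sub_def using face mono by (blast intro: order_trans)

lemma chains_mono:
  assumes "T \<subseteq> T'"
  shows "carrier (chains k T m) \<subseteq> carrier (chains k T' m)"
proof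
  fix c assume c: "c \<in> carrier (chains k T m)"
  show "c \<in> carrier (chains k T' m)"
    unfolding chains_carrier
  proof (intro allI conjI impI)
    show "c \<sigma> \<in> carrier k" for \<sigma> by (rule chains_val[OF c])
    fix \<sigma> assume "\<sigma> \<notin> simplices m T'"
    then have "\<sigma> \<notin> simplices m T" using assms by (auto simp: simplices_def)
    then show "c \<sigma> = \<zero>\<^bsub>k\<^esub>" using c by (simp add: chains_carrier)
  qed
qed

lemma chain_rep_pfd: "pfd_rep k chain_rep"
proof
  show "rep2 k chain_rep"
    unfolding rep2_def chain_rep_def rep.simps
  proof (intro conjI allI impI ballI)
    show "vectorspace k (chains k (sub p) n)" for p by (rule chains_vs)
    show "vectorspace.fin_dim k (chains k (sub p) n)" for p
      by (rule chains_fin_dim(1)[OF fin_simplices[OF sub_K]])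
    show "(\<lambda>c. c) \<in> module_hom k (chains k (sub p) n) (chains k (sub q) n)" if "p \<le> q" for p q
      using chains_mono[OF sub_mono[OF that], of n] by (auto simp: module_hom_def)
  qed simp_all
qed

text \<open>With the boundary taken in \<open>K\<close>, the degree \<open>p\<close> enters the
  cycle condition only through the support.\<close>

lemma cycles_eq:
  "cycles k (sub p) n = {c \<in> carrier (chains k (sub p) n). boundary k K c = (\<lambda>\<tau>. \<zero>\<^bsub>k\<^esub>)}"
proof -
  have "boundary k (sub p) c = boundary k K c" if "c \<in> carrier (chains k (sub p) n)" for c
    by (rule boundary_cong_complex[OF sub_K finUK that])
  then show ?thesis unfolding cycles_def by (intro Collect_cong) metis
qed

lemma cycles_sub:
  assumes "T \<subseteq> K"
  shows "subspace k (cycles k T n) (chains k T n)"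
proof -
  interpret W: vectorspace k "chains k T n" by (rule chains_vs)
  have fin: "finite (\<Union>T)" using finite_subset[OF Union_mono[OF assms] finUK] .
  show ?thesis
  proof (rule W.subspaceI)
    show "cycles k T n \<subseteq> carrier (chains k T n)" by (auto simp: cycles_def)
    have z: "boundary k T (\<lambda>\<sigma>. \<zero>\<^bsub>k\<^esub>) = (\<lambda>\<tau>. \<zero>\<^bsub>k\<^esub>)"
      using boundary_smult[OF _ zero_closed fin, of "\<lambda>\<sigma>. \<zero>\<^bsub>k\<^esub>"] boundary_closed[of "\<lambda>\<sigma>. \<zero>\<^bsub>k\<^esub>" T]
      by simp
    show "\<zero>\<^bsub>chains k T n\<^esub> \<in> cycles k T n"
      using W.subspaceD(2)[OF W.subspace_carrier] z by (simp add: cycles_def)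
    show "u \<oplus>\<^bsub>chains k T n\<^esub> v \<in> cycles k T n" if uv: "u \<in> cycles k T n" "v \<in> cycles k T n" for u v
    proof -
      have c: "u \<in> carrier (chains k T n)" "v \<in> carrier (chains k T n)" using uv by (auto simp: cycles_def)
      have "boundary k T (u \<oplus>\<^bsub>chains k T n\<^esub> v) = (\<lambda>\<tau>. \<zero>\<^bsub>k\<^esub>)"
        using boundary_add[of u v T] chains_val[OF c(1)] chains_val[OF c(2)] uv by (simp add: cycles_def)
      then show ?thesis using W.subspaceD(3)[OF W.subspace_carrier c] by (simp add: cycles_def)
    qed
    show "a \<odot>\<^bsub>chains k T n\<^esub> v \<in> cycles k T n" if av: "a \<in> carrier k" "v \<in> cycles k T n" for a v
    proof -
      have c: "v \<in> carrier (chains k T n)" using av by (auto simp: cycles_def)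
      have "boundary k T (a \<odot>\<^bsub>chains k T n\<^esub> v) = (\<lambda>\<tau>. \<zero>\<^bsub>k\<^esub>)"
        using boundary_smult[OF _ av(1) fin, of v] chains_val[OF c] av by (simp add: cycles_def)
      then show ?thesis using W.subspaceD(4)[OF W.subspace_carrier av(1) c] by (simp add: cycles_def)
    qed
  qed
qed

lemma boundaries_sub: "subspace k (boundaries k (sub p) n) (chains k (sub p) n)"
proof -
  have fs: "finite \<sigma>" if "\<sigma> \<in> sub p" for \<sigma> using that fin_simplex sub_K by blast
  have l: "linear_map k (chains k (sub p) (Suc n)) (chains k (sub p) n) (boundary k (sub p))"
    using chains_vs vectorspace.axioms(1)[OF chains_vs] boundary_chain[of "sub p", OF face_sub fs]
    by (auto simp: linear_map_def mod_hom_def mod_hom_axioms_def module_hom_def boundary_add boundary_smult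
        chains_val finUsub)
  show ?thesis
    unfolding boundaries_def
    by (rule linear_map.image_subspace[OF l vectorspace.subspace_carrier[OF chains_vs]])
qed

sublocale hom: quotient_rep k chain_rep "\<lambda>p. cycles k (sub p) n" "\<lambda>p. boundaries k (sub p) n"
proof (intro quotient_rep.intro quotient_rep_axioms.intro chain_rep_pfd)
  show "subspace k (cycles k (sub p) n) (Space chain_rep p)" for p
    using cycles_sub[OF sub_K] by (simp add: chain_rep_def)
  show "subspace k (boundaries k (sub p) n) (Space chain_rep p)" for p
    using boundaries_sub by (simp add: chain_rep_def)
  show "smap chain_rep p q ` cycles k (sub p) n \<subseteq> cycles k (sub q) n" if "p \<le> q" for p q
    using chains_mono[OF sub_mono[OF that], of n] unfolding cycles_eq chain_rep_def by auto
  show "smap chain_rep p q ` boundaries k (sub p) n \<subseteq> boundaries k (sub q) n" if "p \<le> q" for p q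
    unfolding boundaries_def chain_rep_def
    using boundary_cong_complex[OF sub_mono[OF that] finUsub] chains_mono[OF sub_mono[OF that], of "Suc n"]
    by auto
qed

lemma homology_rep_eq: "homology_rep k K f n = hom.QR"
  unfolding homology_rep_def homology_def quot_rep_def chain_rep_def Let_def sub_def[symmetric] by simp

text \<open>The join of the degrees occurring in the support, hence the least degree at which a
  nonzero \<open>z\<close> is a chain. It is applied to basis elements, which are nonzero.\<close>

definition level :: "('v set \<Rightarrow> 'a) \<Rightarrow> int \<times> int" where
  "level z = (Max ((\<lambda>\<sigma>. fst (f \<sigma>)) ` {\<sigma>. z \<sigma> \<noteq> \<zero>\<^bsub>k\<^esub>}), Max ((\<lambda>\<sigma>. snd (f \<sigma>)) ` {\<sigma>. z \<sigma> \<noteq> \<zero>\<^bsub>k\<^esub>}))"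

lemma cycles_sub_iff:
  "z \<in> cycles k (sub p) n \<longleftrightarrow> z \<in> cycles k K n \<and> (\<forall>\<sigma>. z \<sigma> \<noteq> \<zero>\<^bsub>k\<^esub> \<longrightarrow> f \<sigma> \<le> p)"
proof -
  have "z \<in> carrier (chains k (sub p) n) \<longleftrightarrow> z \<in> carrier V \<and> (\<forall>\<sigma>. z \<sigma> \<noteq> \<zero>\<^bsub>k\<^esub> \<longrightarrow> f \<sigma> \<le> p)" (is "?l \<longleftrightarrow> ?r")
  proof
    assume l: ?l
    have "f \<sigma> \<le> p" if "z \<sigma> \<noteq> \<zero>\<^bsub>k\<^esub>" for \<sigma>
    proof -
      have "\<sigma> \<in> simplices n (sub p)" using l that unfolding chains_carrier by blast
      then show ?thesis by (simp add: simplices_def sub_def)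
    qed
    then show ?r using l chains_mono[OF sub_K] by blast
  next
    assume r: ?r
    then have zc: "z \<in> carrier V" and le: "\<And>\<sigma>. z \<sigma> \<noteq> \<zero>\<^bsub>k\<^esub> \<Longrightarrow> f \<sigma> \<le> p" by blast+
    show ?l
      unfolding chains_carrier
    proof (intro allI conjI impI)
      show "z \<sigma> \<in> carrier k" for \<sigma> by (rule chains_val[OF zc])
      fix \<sigma> assume s: "\<sigma> \<notin> simplices n (sub p)"
      show "z \<sigma> = \<zero>\<^bsub>k\<^esub>"
      proof (rule ccontr)
        assume nz: "z \<sigma> \<noteq> \<zero>\<^bsub>k\<^esub>"
        then have "\<sigma> \<in> simplices n K" using zc unfolding chains_carrier by blast
        then show False using s le[OF nz] by (simp add: simplices_def sub_def)
      qed
    qed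
  qed
  then show ?thesis unfolding cycles_eq by (auto simp: cycles_def)
qed

text \<open>Each basis cycle becomes a generator at its \<open>level\<close>. Those of level at most
  \<open>q\<close> span the cycles of degree \<open>q\<close> by adaptedness to an intersection, and
  the basis is independent among the chains of \<open>K\<close>, which bounds its size.\<close>

lemma cycle_generators:
  obtains G where "card G \<le> card (simplices n K)" "finite G"
    "\<And>p z. (p, z) \<in> G \<Longrightarrow> z \<in> cycles k (sub p) n"
    "\<And>q. cycles k (sub q) n \<subseteq> module.span k (Space chain_rep q) {smap chain_rep p q z | p z. (p, z) \<in> G \<and> p \<le> q}"
proof -
  interpret V: vectorspace k V by (rule chains_vs)
  have fdV: "V.fin_dim" and dimV: "V.dim \<le> card (simplices n K)"
    using chains_fin_dim[OF fin_simplices[OF subset_refl]] by blast+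
  let ?Z = "cycles k K n"
  have Zs: "subspace k ?Z V" by (rule cycles_sub[OF subset_refl])
  note Zm = V.is_module[OF Zs]
  let ?W = "V\<lparr>carrier := ?Z\<rparr>"
  interpret W: vectorspace k ?W by (rule V.subspace_is_vs[OF Zs])
  have fdW: "W.fin_dim" by (rule V.subspace_fin_dim[OF fdV Zs])
  define X where "X a = {z \<in> ?Z. \<forall>\<sigma>. z \<sigma> \<noteq> \<zero>\<^bsub>k\<^esub> \<longrightarrow> fst (f \<sigma>) \<le> a}" for a
  define Y where "Y b = {z \<in> ?Z. \<forall>\<sigma>. z \<sigma> \<noteq> \<zero>\<^bsub>k\<^esub> \<longrightarrow> snd (f \<sigma>) \<le> b}" for b
  have Zval: "z \<sigma> \<in> carrier k" if "z \<in> ?Z" for z \<sigma> using that chains_val[of z K n] by (auto simp: cycles_def)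
  have sub: "subspace k {z \<in> ?Z. \<forall>\<sigma>. z \<sigma> \<noteq> \<zero>\<^bsub>k\<^esub> \<longrightarrow> P \<sigma>} ?W" for P
  proof (rule W.subspaceI)
    note ZD = V.subspaceD[OF Zs]
    show "\<zero>\<^bsub>?W\<^esub> \<in> {z \<in> ?Z. \<forall>\<sigma>. z \<sigma> \<noteq> \<zero>\<^bsub>k\<^esub> \<longrightarrow> P \<sigma>}" using ZD(2) by simp
    show "u \<oplus>\<^bsub>?W\<^esub> v \<in> {z \<in> ?Z. \<forall>\<sigma>. z \<sigma> \<noteq> \<zero>\<^bsub>k\<^esub> \<longrightarrow> P \<sigma>}"
      if uv: "u \<in> {z \<in> ?Z. \<forall>\<sigma>. z \<sigma> \<noteq> \<zero>\<^bsub>k\<^esub> \<longrightarrow> P \<sigma>}" "v \<in> {z \<in> ?Z. \<forall>\<sigma>. z \<sigma> \<noteq> \<zero>\<^bsub>k\<^esub> \<longrightarrow> P \<sigma>}" for u v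
    proof -
      have "u \<sigma> \<oplus>\<^bsub>k\<^esub> v \<sigma> = \<zero>\<^bsub>k\<^esub>" if "\<not> P \<sigma>" for \<sigma>
      proof -
        have "u \<sigma> = \<zero>\<^bsub>k\<^esub>" "v \<sigma> = \<zero>\<^bsub>k\<^esub>" using uv that by blast+
        then show ?thesis by simp
      qed
      then show ?thesis using ZD(3)[of u v] uv by auto
    qed
    show "a \<odot>\<^bsub>?W\<^esub> v \<in> {z \<in> ?Z. \<forall>\<sigma>. z \<sigma> \<noteq> \<zero>\<^bsub>k\<^esub> \<longrightarrow> P \<sigma>}"
      if av: "a \<in> carrier k" "v \<in> {z \<in> ?Z. \<forall>\<sigma>. z \<sigma> \<noteq> \<zero>\<^bsub>k\<^esub> \<longrightarrow> P \<sigma>}" for a v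
    proof -
      have "a \<otimes>\<^bsub>k\<^esub> v \<sigma> = \<zero>\<^bsub>k\<^esub>" if "\<not> P \<sigma>" for \<sigma>
      proof -
        have "v \<sigma> = \<zero>\<^bsub>k\<^esub>" using av that by blast
        then show ?thesis using av(1) by simp
      qed
      then show ?thesis using ZD(4)[of a v] av by auto
    qed
  qed auto
  have flX: "W.flag (range X)"
    unfolding W.flag_def
  proof (intro conjI ballI)
    show "subspace k R ?W" if "R \<in> range X" for R using that sub unfolding X_def by auto
    fix R R' assume "R \<in> range X" "R' \<in> range X"
    then obtain a b where ab: "R = X a" "R' = X b" by blast
    show "R \<subseteq> R' \<or> R' \<subseteq> R" unfolding ab X_def using linorder_linear[of a b] by fastforce
  qed
  have flY: "W.flag (range Y)"
    unfolding W.flag_def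
  proof (intro conjI ballI)
    show "subspace k R ?W" if "R \<in> range Y" for R using that sub unfolding Y_def by auto
    fix R R' assume "R \<in> range Y" "R' \<in> range Y"
    then obtain a b where ab: "R = Y a" "R' = Y b" by blast
    show "R \<subseteq> R' \<or> R' \<subseteq> R" unfolding ab Y_def using linorder_linear[of a b] by fastforce
  qed
  obtain B where B: "W.basis B" and ad: "\<forall>R\<in>range X. \<forall>R'\<in>range Y. R \<inter> R' \<subseteq> W.span (B \<inter> (R \<inter> R'))"
    by (rule W.adapted_to_two_flags[OF fdW flX flY])
  have BZ: "B \<subseteq> ?Z" and Bi: "\<not> W.lin_dep B" using B by (simp_all add: W.basis_def)
  have Bc: "B \<subseteq> carrier V" using BZ V.subspaceD(1)[OF Zs] by blast
  have BiV: "\<not> V.lin_dep B" using Bi V.module.span_li_not_depend(2)[OF BZ Zm] by simp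
  have finB: "finite B" and cardB: "card B \<le> card (simplices n K)"
    using V.li_le_dim[OF fdV Bc BiV] dimV by simp_all
  \<comment> \<open>Being below \<open>q\<close> in the product order is one condition on each
    coordinate; this is how the two parameters turn into two flags.\<close>
  have XY: "X (fst q) \<inter> Y (snd q) = cycles k (sub q) n" for q
  proof (intro equalityI subsetI)
    fix z assume "z \<in> X (fst q) \<inter> Y (snd q)"
    then show "z \<in> cycles k (sub q) n" unfolding cycles_sub_iff X_def Y_def by (simp add: less_eq_prod_def)
  next
    fix z assume "z \<in> cycles k (sub q) n"
    then show "z \<in> X (fst q) \<inter> Y (snd q)" unfolding cycles_sub_iff X_def Y_def by (simp add: less_eq_prod_def)
  qed
  have level_iff: "z \<in> cycles k (sub q) n \<longleftrightarrow> level z \<le> q" if z: "z \<in> B" for z q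
  proof -
    have zZ: "z \<in> ?Z" using z BZ by blast
    let ?s = "{\<sigma>. z \<sigma> \<noteq> \<zero>\<^bsub>k\<^esub>}"
    have "?s \<subseteq> simplices n K" using zZ by (auto simp: cycles_def chains_carrier)
    then have fin: "finite ?s" using finite_subset fin_simplices[OF subset_refl] by blast
    \<comment> \<open>A basis vector is nonzero, so its support is nonempty and the maxima in
      \<open>level\<close> are genuine.\<close>
    have "z \<noteq> \<zero>\<^bsub>?W\<^esub>" using W.vs_zero_lin_dep[of B] BZ Bi z by auto
    then have ne: "?s \<noteq> {}" by (auto simp: fun_eq_iff)
    have "level z \<le> q \<longleftrightarrow> (\<forall>\<sigma>\<in>?s. fst (f \<sigma>) \<le> fst q) \<and> (\<forall>\<sigma>\<in>?s. snd (f \<sigma>) \<le> snd q)"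
      using fin ne by (simp add: level_def less_eq_prod_def)
    then show ?thesis unfolding cycles_sub_iff using zZ by (auto simp: less_eq_prod_def)
  qed
  define G where "G = (\<lambda>z. (level z, z)) ` B"
  show thesis
  proof
    show "finite G" using finB by (simp add: G_def)
    show "card G \<le> card (simplices n K)" using card_image_le[OF finB, of "\<lambda>z. (level z, z)"] cardB by (simp add: G_def)
    show "z \<in> cycles k (sub p) n" if "(p, z) \<in> G" for p z using that level_iff[of z "level z"] by (auto simp: G_def)
    fix q
    let ?C = "B \<inter> cycles k (sub q) n"
    \<comment> \<open>Spans are compared in the cycles of \<open>K\<close>, in the chains of
      \<open>K\<close> and in the chains of \<open>sub q\<close>. They agree because the first and
      the last are subspaces of the chains of \<open>K\<close>.\<close>
    have sq: "subspace k (carrier (chains k (sub q) n)) V"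
    proof (rule V.subspaceI)
      interpret Q: vectorspace k "chains k (sub q) n" by (rule chains_vs)
      note QD = Q.subspaceD[OF Q.subspace_carrier]
      show "carrier (chains k (sub q) n) \<subseteq> carrier V" by (rule chains_mono[OF sub_K])
      show "\<zero>\<^bsub>V\<^esub> \<in> carrier (chains k (sub q) n)" using QD(2) by simp
      show "u \<oplus>\<^bsub>V\<^esub> v \<in> carrier (chains k (sub q) n)"
        if "u \<in> carrier (chains k (sub q) n)" "v \<in> carrier (chains k (sub q) n)" for u v
        using QD(3)[OF that] by simp
      show "a \<odot>\<^bsub>V\<^esub> v \<in> carrier (chains k (sub q) n)"
        if "a \<in> carrier k" "v \<in> carrier (chains k (sub q) n)" for a v
        using QD(4)[OF that] by simp
    qed
    have CC: "?C \<subseteq> carrier (chains k (sub q) n)" by (auto simp: cycles_def)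
    have "cycles k (sub q) n \<subseteq> W.span ?C" using ad[rule_format, OF rangeI rangeI, of "fst q" "snd q"] unfolding XY .
    also have "\<dots> = V.span ?C" by (rule V.module.span_li_not_depend(1)[OF _ Zm]) (use BZ in blast)
    also have "\<dots> = module.span k (chains k (sub q) n) ?C"
      using V.module.span_li_not_depend(1)[OF CC V.is_module[OF sq]] by (simp add: chains_carrier_update)
    also have "?C = {smap chain_rep p q z | p z. (p, z) \<in> G \<and> p \<le> q}"
    proof -
      have "{smap chain_rep p q z | p z. (p, z) \<in> G \<and> p \<le> q} = {z \<in> B. level z \<le> q}"
        by (auto simp: chain_rep_def G_def)
      also have "\<dots> = ?C" using level_iff by blast
      finally show ?thesis by simp
    qed
    finally show "cycles k (sub q) n \<subseteq> module.span k (Space chain_rep q) {smap chain_rep p q z | p z. (p, z) \<in> G \<and> p \<le> q}"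
      by (simp add: chain_rep_def)
  qed
qed

text \<open>The classes of the generating cycles generate homology. Some of them may be redundant,
  but \<open>beta0\<close> is at most the size of any generating set.\<close>

lemma N2_homology: "N2 k (homology_rep k K f n) \<le> card (simplices n K)"
proof -
  obtain G where G: "card G \<le> card (simplices n K)" "finite G"
    "\<And>p z. (p, z) \<in> G \<Longrightarrow> z \<in> cycles k (sub p) n"
    "\<And>q. cycles k (sub q) n \<subseteq> module.span k (Space chain_rep q) {smap chain_rep p q z | p z. (p, z) \<in> G \<and> p \<le> q}"
    using cycle_generators by blast
  let ?H = "(\<lambda>(p, z). (p, hom.pr p z)) ` G"
  have gen: "generates k hom.QR ?H"
    unfolding generates_def
  proof (intro conjI allI)
    show "finite ?H" using G(2) by simp
    show "\<forall>(p, X)\<in>?H. X \<in> carrier (hom.QS p)" using G(3) hom.QS_carrier by fastforce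
    show "carrier (hom.QS q) = module.span k (hom.QS q) {smap hom.QR p q X | p X. (p, X) \<in> ?H \<and> p \<le> q}" for q
      by (rule hom.QR_generated[OF G(3,4)])
  qed
  interpret Q: fg_rep k hom.QR ?H
    by (intro fg_rep.intro fg_rep_axioms.intro pfd_rep.intro hom.rep2_QR gen)
  have "N2 k hom.QR \<le> beta0 k hom.QR" by (rule Q.N2_le_beta0)
  also have "\<dots> \<le> card ?H" by (rule Q.beta0_le_card(2)[OF gen])
  also have "\<dots> \<le> card G" by (rule card_image_le[OF G(2)])
  finally show ?thesis using G(1) homology_rep_eq by simp
qed

end

theorem corollaryE:
  fixes k :: "('a, 'b) ring_scheme"
  assumes "field k"
  shows "(\<forall>M :: ('a, 'm) rep. rep2 k M \<longrightarrow> fin_gen k M \<longrightarrow> N2 k M \<le> beta0 k M) \<and>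
    (\<forall>(K :: 'v::linorder set set) f i. bifiltered_complex K f \<longrightarrow>
       N2 k (homology_rep k K f i) \<le> card (simplices i K))"
proof (intro conjI allI impI)
  fix M :: "('a, 'm) rep" assume "rep2 k M" "fin_gen k M"
  then obtain G where "fg_rep k M G"
    unfolding fin_gen_iff fg_rep_def fg_rep_axioms_def pfd_rep_def by blast
  then show "N2 k M \<le> beta0 k M" by (rule fg_rep.N2_le_beta0)
next
  fix K :: "'v set set" and f i assume "bifiltered_complex K f"
  then show "N2 k (homology_rep k K f i) \<le> card (simplices i K)"
    using bifiltration.N2_homology[of k K f i] assms by (simp add: bifiltration_def)
qed

end
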